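(* The set $\mathcal{H}$ consists precisely of $P_3\cup P_4$, $K_2\cup P_5$, $K_2\cup 2P_3$, $2K_2\cup K_3$, $2K_2\cup P_4^+$, $3K_2\cup K_{1,3}$ and their disconnected subgraphs of order at least $3$ (without isolated vertices). That is, a disconnected graph $H$ of order at least $3$ without isolated vertices belongs to $\mathcal{H}$ if and only if $H$ is isomorphic to a subgraph of one of these six graphs.
   Context: All graphs are finite and simple; the order of a graph is its number of vertices. $P_n$ is the path on $n$ vertices, $P_4^+$ is the tree with degree sequence $1,1,1,2,3$, $G\cup H$ denotes the disjoint union, and $nG$ denotes the disjoint union of $n$ copies of $G$. An edge-coloring of $K_n$ "using all the $m$ colors" is a map $c:E(K_n)\to\{1,\dots,m\}$ that is surjective. A colored graph is rainbow if all its edges have different colors, and monochromatic if all its edges have the same color. A coloring of $K_n$ is rainbow $H$-free if it contains no rainbow subgraph isomorphic to $H$. Given $k,m$, an almost spanning $k$-connected monochromatic subgraph, $ASMS(k)$, in a coloring of $K_n$ using all the $m$ colors is a $k$-connected monochromatic subgraph of order at least $n-f(k,m)$, where $f(k,m)$ does not depend on $n$ (nor on the coloring). $\mathcal{H}$ is the set of disconnected graphs $H$ of order at least $3$ without isolated vertices such that for positive integers $n\gg m\gg k$ with $m\ge |E(H)|$, there is an $ASMS(k)$ in every rainbow $H$-free coloring of $K_n$ using all the $m$ colors. Explicitly: for every $k\ge 1$ there is $m_0$ such that for every $m\ge \max\{m_0,|E(H)|\}$ there are $n_0$ and a constant $f$ such that for every $n\ge n_0$, every rainbow $H$-free coloring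 of $K_n$ using all the $m$ colors contains a $k$-connected monochromatic subgraph of order at least $n-f$. *)

theory Defs
  imports Main
begin

datatype 'a graph = Graph (verts: "'a set") (edges: "'a set set")

definition simple_graph :: "'a graph \<Rightarrow> bool" where
  "simple_graph G \<longleftrightarrow>
     finite (verts G) \<and> (\<forall>e \<in> edges G. e \<subseteq> verts G \<and> card e = 2)"

definition graph_order :: "'a graph \<Rightarrow> nat" where
  "graph_order G = card (verts G)"

definition graph_degree :: "'a graph \<Rightarrow> 'a \<Rightarrow> nat" where
  "graph_degree G v = card {e \<in> edges G. v \<in> e}"

definition no_isolated_vertices :: "'a graph \<Rightarrow> bool" where
  "no_isolated_vertices G \<longleftrightarrow> (\<forall>v \<in> verts G. graph_degree G v \<noteq> 0)"

definition subgraph :: "'a graph \<Rightarrow> 'a graph \<Rightarrow> bool" where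
  "subgraph G H \<longleftrightarrow>
     simple_graph G \<and> verts G \<subseteq> verts H \<and> edges G \<subseteq> edges H"

definition isomorphic :: "'a graph \<Rightarrow> 'b graph \<Rightarrow> bool" where
  "isomorphic G H \<longleftrightarrow>
     (\<exists>\<phi>. bij_betw \<phi> (verts G) (verts H) \<and> (\<lambda>e. \<phi> ` e) ` edges G = edges H)"

definition isomorphic_to_subgraph :: "'a graph \<Rightarrow> 'b graph \<Rightarrow> bool" where
  "isomorphic_to_subgraph H G \<longleftrightarrow> (\<exists>G'. subgraph G' G \<and> isomorphic H G')"

definition connected_graph :: "'a graph \<Rightarrow> bool" where
  "connected_graph G \<longleftrightarrow> verts G \<noteq> {} \<and>
     (\<forall>u \<in> verts G. \<forall>v \<in> verts G. (u, v) \<in> {(x, y). {x, y} \<in> edges G}\<^sup>*)"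

definition delete_verts :: "'a graph \<Rightarrow> 'a set \<Rightarrow> 'a graph" where
  "delete_verts G X = Graph (verts G - X) {e \<in> edges G. e \<inter> X = {}}"

definition k_connected :: "nat \<Rightarrow> 'a graph \<Rightarrow> bool" where
  "k_connected k G \<longleftrightarrow> graph_order G > k \<and>
     (\<forall>X \<subseteq> verts G. card X < k \<longrightarrow> connected_graph (delete_verts G X))"

definition complete_graph :: "nat \<Rightarrow> nat graph" where
  "complete_graph n = Graph {..<n} {e. e \<subseteq> {..<n} \<and> card e = 2}"

text \<open>\<open>path_graph n\<close> is the path on \<open>n\<close> vertices (not of length \<open>n\<close>).\<close>

definition path_graph :: "nat \<Rightarrow> nat graph" where
  "path_graph n = Graph {..<n} {{i, Suc i} | i. Suc i < n}"

text \<open>\<open>star_graph s\<close> is \<open>K\<^bsub>1,s\<^esub>\<close>, with centre \<open>0\<close>.\<close>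

definition star_graph :: "nat \<Rightarrow> nat graph" where
  "star_graph s = Graph {..s} {{0, i} | i. 1 \<le> i \<and> i \<le> s}"

text \<open>
  The tree with degree sequence \<open>1, 1, 1, 2, 3\<close> is unique up to isomorphism: the path
  \<open>0 - 1 - 2 - 3\<close> with a pendant vertex \<open>4\<close> attached to \<open>1\<close>.
\<close>

definition P4_plus :: "nat graph" where
  "P4_plus = Graph {0, 1, 2, 3, 4} {{0, 1}, {1, 2}, {2, 3}, {1, 4}}"

definition disjoint_union :: "'a graph \<Rightarrow> 'b graph \<Rightarrow> ('a + 'b) graph"
    (infixr "\<uplus>\<^sub>G" 65) where
  "G \<uplus>\<^sub>G H = Graph (verts G <+> verts H)
     ((\<lambda>e. Inl ` e) ` edges G \<union> (\<lambda>e. Inr ` e) ` edges H)"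

definition graph_copies :: "nat \<Rightarrow> 'a graph \<Rightarrow> (nat \<times> 'a) graph" where
  "graph_copies n G = Graph ({..<n} \<times> verts G) {Pair i ` e | i e. i < n \<and> e \<in> edges G}"

text \<open>
  A coloring of \<open>K\<^sub>n\<close> is a function on vertex sets of which only the values on the edges
  of \<open>K\<^sub>n\<close> matter.
\<close>

type_synonym coloring = "nat set \<Rightarrow> nat"

definition coloring_using_all :: "nat \<Rightarrow> nat \<Rightarrow> coloring \<Rightarrow> bool" where
  "coloring_using_all n m c \<longleftrightarrow> c ` edges (complete_graph n) = {1..m}"

definition rainbow :: "coloring \<Rightarrow> nat graph \<Rightarrow> bool" where
  "rainbow c G \<longleftrightarrow> inj_on c (edges G)"

definition monochromatic :: "coloring \<Rightarrow> nat graph \<Rightarrow> bool" where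
  "monochromatic c G \<longleftrightarrow> (\<forall>e \<in> edges G. \<forall>e' \<in> edges G. c e = c e')"

definition rainbow_free :: "nat \<Rightarrow> coloring \<Rightarrow> 'a graph \<Rightarrow> bool" where
  "rainbow_free n c H \<longleftrightarrow>
     \<not> (\<exists>G. subgraph G (complete_graph n) \<and> isomorphic H G \<and> rainbow c G)"

text \<open>
  The lower bound \<open>n - f\<close> on the order is stated without truncated subtraction.
\<close>

definition has_ASMS :: "nat \<Rightarrow> nat \<Rightarrow> nat \<Rightarrow> coloring \<Rightarrow> bool" where
  "has_ASMS k f n c \<longleftrightarrow>
     (\<exists>G. subgraph G (complete_graph n) \<and> monochromatic c G \<and> k_connected k G \<and>
          n \<le> graph_order G + f)"

text \<open>
  The condition \<open>n \<gg> m \<gg> k\<close> is the quantifier prefix over \<open>k, m\<^sub>0, m, n\<^sub>0, n\<close>; the constant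
  \<open>f\<close> may depend on \<open>k\<close> and \<open>m\<close> (and \<open>H\<close>), but not on \<open>n\<close> or the coloring.
\<close>

definition ASMS_graphs :: "'a graph set" where
  "ASMS_graphs = {H.
     simple_graph H \<and> \<not> connected_graph H \<and> graph_order H \<ge> 3 \<and> no_isolated_vertices H \<and>
     (\<forall>k\<ge>1. \<exists>m\<^sub>0. \<forall>m \<ge> max m\<^sub>0 (card (edges H)). \<exists>n\<^sub>0 f. \<forall>n\<ge>n\<^sub>0. \<forall>c.
        coloring_using_all n m c \<and> rainbow_free n c H \<longrightarrow> has_ASMS k f n c)}"

end

theory Submission
  imports Defs "HOL-Library.Ramsey"
begin

text \<open>
  The heart of the sufficiency direction is a robust form of Gallai's theorem that a coloring
  without rainbow triangles has a connected spanning color class. Let \<open>K\<close> be a largest set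
  that is highly connected in some color \<open>a\<close>, with connectivity \<open>l\<close> far above \<open>k\<close> and \<open>m\<close>.
  Vertices outside \<open>K\<close> with at least \<open>k\<close> neighbours of color \<open>a\<close> in \<open>K\<close> can all be absorbed
  at connectivity \<open>k\<close>. If there is no almost spanning \<open>k\<close>-connected monochromatic subgraph,
  more than \<open>f\<close> vertices \<open>r\<close> therefore have fewer than \<open>k\<close> such neighbours. Few of these send
  almost all of their edges to \<open>K\<close> in one color \<open>b\<close>: otherwise they and almost all of \<open>K\<close>
  would form a larger highly connected set in color \<open>b\<close>. Every remaining \<open>r\<close> divides \<open>K\<close> into
  two non-negligible parts by color. As \<open>l\<close> exceeds \<open>k\<close> by so much, edges of color \<open>a\<close> between
  the parts cannot be destroyed by deleting few vertices, so \<open>r\<close> is the centre of many rainbow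
  triangles. Pigeonholing the colors gives three colors \<open>a\<close>, \<open>b\<close>, \<open>g\<close> such that windmills of
  rainbow triangles in these colors survive every deletion of boundedly many vertices
  (\<open>no_ASMS_imp_windmills\<close>).

  When \<open>m\<close> is large, the other \<open>m - 3\<close> colors contain a rainbow star or a rainbow matching.
  Either of them, together with disjoint windmills, contains rainbow copies of all six
  maximal graphs (\<open>rainbow_copies_of_maximal\<close>). For a matching edge \<open>uw\<close>, the edges between \<open>u\<close>
  and a windmill have their colors forced until a contradiction or a copy appears.

  For the necessity direction, four families of colorings use all \<open>m\<close> colors and have no almost
  spanning connected monochromatic subgraph even for \<open>k = 1\<close>, because every color leaves both
  sides of some large vertex partition unconnected. A member \<open>H\<close> of the class has a rainbow copy
  in each family. The first one yields a vertex that meets all but at most three edges of \<open>H\<close>.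
  The other three exclude eight small subgraphs of \<open>H\<close> (\<open>ASMS_excluded_copies\<close>). A disconnected
  graph without isolated vertices that satisfies these restrictions is found in the list by
  distinguishing the component of that vertex from the at most three remaining edges
  (\<open>ASMS_graphs_listed\<close>).
\<close>

section \<open>Embeddings and edge lists\<close>

lemma simple_edgeE:
  assumes "simple_graph G" "e \<in> edges G"
  obtains x y where "e = {x, y}" "x \<noteq> y" "x \<in> verts G" "y \<in> verts G"
  using assms unfolding simple_graph_def by (metis card_2_iff insert_subset)

text \<open>
  An injective map that preserves edges stands for the isomorphic subgraph; all embeddings below
  are built in this form.
\<close>

lemma isomorphic_to_subgraph_iff:
  assumes "simple_graph H"
  shows "isomorphic_to_subgraph H G \<longleftrightarrow>
    (\<exists>\<phi>. inj_on \<phi> (verts H) \<and> \<phi> ` verts H \<subseteq> verts G \<and> (\<forall>e\<in>edges H. \<phi> ` e \<in> edges G))"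
proof
  assume "isomorphic_to_subgraph H G"
  then show "\<exists>\<phi>. inj_on \<phi> (verts H) \<and> \<phi> ` verts H \<subseteq> verts G \<and> (\<forall>e\<in>edges H. \<phi> ` e \<in> edges G)"
    unfolding isomorphic_to_subgraph_def subgraph_def isomorphic_def bij_betw_def
    by (metis image_eqI subset_eq)
next
  assume "\<exists>\<phi>. inj_on \<phi> (verts H) \<and> \<phi> ` verts H \<subseteq> verts G \<and> (\<forall>e\<in>edges H. \<phi> ` e \<in> edges G)"
  then obtain \<phi> where \<phi>: "inj_on \<phi> (verts H)" "\<phi> ` verts H \<subseteq> verts G" "\<forall>e\<in>edges H. \<phi> ` e \<in> edges G"
    by (elim exE conjE)
  let ?G' = "Graph (\<phi> ` verts H) ((`) \<phi> ` edges H)"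
  have "card (\<phi> ` e) = 2" if "e \<in> edges H" for e
    using assms that \<phi>(1) unfolding simple_graph_def by (metis card_image inj_on_subset)
  then have "simple_graph ?G'"
    using assms by (auto simp: simple_graph_def)
  then have "subgraph ?G' G" using \<phi> by (auto simp: subgraph_def)
  moreover have "isomorphic H ?G'" using \<phi>(1) by (auto simp: isomorphic_def bij_betw_def)
  ultimately show "isomorphic_to_subgraph H G" unfolding isomorphic_to_subgraph_def by blast
qed

text \<open>
  Graphs given by an edge list on an initial segment of the natural numbers. Concrete embeddings
  between them are lists of positions, which the simplifier can check.
\<close>

definition list_graph :: "nat \<Rightarrow> (nat \<times> nat) list \<Rightarrow> nat graph" where
  "list_graph r L = Graph {..<r} ((\<lambda>(i, j). {i, j}) ` set L)"

definition list_edges :: "nat \<Rightarrow> (nat \<times> nat) list \<Rightarrow> bool" where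
  "list_edges r L \<longleftrightarrow> (\<forall>(i, j)\<in>set L. i < r \<and> j < r \<and> i \<noteq> j)"

lemma embedding_into_isomorphic:
  assumes H: "simple_graph H" and T: "simple_graph T" and iso: "isomorphic T T'"
  shows "isomorphic_to_subgraph H T \<longleftrightarrow> isomorphic_to_subgraph H T'"
proof -
  obtain \<phi> where \<phi>: "bij_betw \<phi> (verts T) (verts T')" "(\<lambda>e. \<phi> ` e) ` edges T = edges T'"
    using iso unfolding isomorphic_def by blast
  let ?\<psi> = "inv_into (verts T) \<phi>"
  have \<psi>: "bij_betw ?\<psi> (verts T') (verts T)" using \<phi>(1) by (rule bij_betw_inv_into)
  have inv: "?\<psi> ` \<phi> ` e = e" if "e \<in> edges T" for e
    using that T \<phi>(1) unfolding simple_graph_def by (metis bij_betw_imp_inj_on inv_into_image_cancel)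
  have comp: "isomorphic_to_subgraph H B"
    if AB: "isomorphic_to_subgraph H A" "bij_betw \<theta> (verts A) (verts B)" "\<forall>e\<in>edges A. \<theta> ` e \<in> edges B"
    for A :: "'x graph" and B :: "'y graph" and \<theta>
  proof -
    obtain \<eta> where \<eta>: "inj_on \<eta> (verts H)" "\<eta> ` verts H \<subseteq> verts A" "\<forall>e\<in>edges H. \<eta> ` e \<in> edges A"
      using AB(1) unfolding isomorphic_to_subgraph_iff[OF H] by (elim exE conjE)
    have "inj_on (\<theta> \<circ> \<eta>) (verts H)"
      using \<eta>(1,2) AB(2) by (intro comp_inj_on) (auto simp: bij_betw_def intro: inj_on_subset)
    moreover have "(\<theta> \<circ> \<eta>) ` verts H \<subseteq> verts B" using \<eta>(2) AB(2) by (auto simp: bij_betw_def)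
    moreover have "\<forall>e\<in>edges H. (\<theta> \<circ> \<eta>) ` e \<in> edges B"
      using \<eta>(3) AB(3) by (metis image_comp)
    ultimately show ?thesis unfolding isomorphic_to_subgraph_iff[OF H] by (intro exI conjI)
  qed
  show ?thesis
  proof
    assume "isomorphic_to_subgraph H T"
    then show "isomorphic_to_subgraph H T'" by (rule comp[OF _ \<phi>(1)]) (use \<phi>(2) in auto)
  next
    assume "isomorphic_to_subgraph H T'"
    moreover have "\<forall>e\<in>edges T'. ?\<psi> ` e \<in> edges T" unfolding \<phi>(2)[symmetric] using inv by simp
    ultimately show "isomorphic_to_subgraph H T" by (intro comp[OF _ \<psi>])
  qed
qed

text \<open>
  The six maximal graphs as edge lists. The positions are those of the six isomorphisms
  proved below, component after component.
\<close>

definition P3_P4 :: "(nat \<times> nat) list" where "P3_P4 = [(0,1),(1,2),(3,4),(4,5),(5,6)]"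

definition K2_P5 :: "(nat \<times> nat) list" where "K2_P5 = [(0,1),(2,3),(3,4),(4,5),(5,6)]"

definition K2_2P3 :: "(nat \<times> nat) list" where "K2_2P3 = [(0,1),(2,3),(3,4),(5,6),(6,7)]"

definition twoK2_K3 :: "(nat \<times> nat) list" where "twoK2_K3 = [(0,1),(2,3),(4,5),(5,6),(4,6)]"

definition twoK2_P4plus :: "(nat \<times> nat) list" where "twoK2_P4plus = [(0,1),(2,3),(4,5),(5,6),(6,7),(5,8)]"

definition threeK2_K13 :: "(nat \<times> nat) list" where "threeK2_K13 = [(0,1),(2,3),(4,5),(6,7),(6,8),(6,9)]"

lemmas maximal_defs = P3_P4_def K2_P5_def K2_2P3_def twoK2_K3_def twoK2_P4plus_def threeK2_K13_def

lemma lessThan_numerals: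
  "{..<2::nat} = {0,1}" "{..<3::nat} = {0,1,2}" "{..<4::nat} = {0,1,2,3}" "{..<5::nat} = {0,1,2,3,4}"
  "{..<7::nat} = {0,1,2,3,4,5,6}" "{..<8::nat} = {0,1,2,3,4,5,6,7}"
  "{..<9::nat} = {0,1,2,3,4,5,6,7,8}" "{..<10::nat} = {0,1,2,3,4,5,6,7,8,9}"
  "{..3::nat} = {0,1,2,3}"
  by (simp_all add: lessThan_nat_numeral atMost_nat_numeral lessThan_Suc atMost_Suc insert_commute)

lemma edges_complete_2: "edges (complete_graph 2) = {{0,1}}"
proof -
  have "e \<subseteq> {0, 1::nat} \<and> card e = 2 \<longleftrightarrow> e = {0, 1}" for e
    by (auto simp: card_2_iff)
  then show ?thesis by (auto simp: complete_graph_def lessThan_numerals)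
qed

lemma edges_complete_3: "edges (complete_graph 3) = {{0,1},{0,2},{1,2}}"
proof -
  have "e \<subseteq> {0, 1, 2::nat} \<and> card e = 2 \<longleftrightarrow> e = {0, 1} \<or> e = {0, 2} \<or> e = {1, 2}" for e
    by (rule iffI) (force simp: card_2_iff, auto)
  then show ?thesis by (auto simp: complete_graph_def lessThan_numerals)
qed

lemma edges_path: "edges (path_graph n) = (\<lambda>i. {i, Suc i}) ` {..<n - 1}"
  by (auto simp: path_graph_def)

lemma edges_path_numeral:
  "edges (path_graph 3) = {{0,1},{1,2}}" "edges (path_graph 4) = {{0,1},{1,2},{2,3}}"
  "edges (path_graph 5) = {{0,1},{1,2},{2,3},{3,4}}"
  by (auto simp: edges_path lessThan_numerals)

lemma edges_star_3: "edges (star_graph 3) = {{0,1},{0,2},{0,3}}"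
proof -
  have "1 \<le> i \<and> i \<le> 3 \<longleftrightarrow> i = 1 \<or> i = 2 \<or> i = 3" for i :: nat by arith
  then show ?thesis by (auto simp: star_graph_def)
qed

lemma edges_graph_copies: "edges (graph_copies k G) = (\<Union>i\<in>{..<k}. image (Pair i) ` edges G)"
  by (auto simp: graph_copies_def)

lemma verts_basic: "verts (complete_graph k) = {..<k}" "verts (path_graph k) = {..<k}"
  "verts (star_graph k) = {..k}" "verts (graph_copies k G) = {..<k} \<times> verts G"
  by (auto simp: complete_graph_def path_graph_def star_graph_def graph_copies_def)

lemmas concrete_graph_simps = disjoint_union_def edges_complete_2 edges_complete_3 edges_path_numeral edges_star_3 edges_graph_copies verts_basic P4_plus_def list_graph_def
  maximal_defs lessThan_numerals

lemma isomorphicI: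
  assumes "inj_on \<phi> (verts G)" "\<phi> ` verts G = verts G'" "(\<lambda>e. \<phi> ` e) ` edges G = edges G'"
  shows "isomorphic G G'"
  using assms by (auto simp: isomorphic_def bij_betw_def)

lemma iso_P3_P4: "isomorphic (path_graph 3 \<uplus>\<^sub>G path_graph 4) (list_graph 7 P3_P4)"
  by (rule isomorphicI[where \<phi> = "case_sum (\<lambda>i. i) (\<lambda>i. i + 3)"])
     (simp_all add: concrete_graph_simps Plus_def inj_on_def image_Un insert_commute Sigma_def del: add_2_eq_Suc add_2_eq_Suc')

lemma iso_K2_P5: "isomorphic (complete_graph 2 \<uplus>\<^sub>G path_graph 5) (list_graph 7 K2_P5)"
  by (rule isomorphicI[where \<phi> = "case_sum (\<lambda>i. i) (\<lambda>i. i + 2)"])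
     (simp_all add: concrete_graph_simps Plus_def inj_on_def image_Un insert_commute Sigma_def del: add_2_eq_Suc add_2_eq_Suc')

lemma iso_K2_2P3: "isomorphic (complete_graph 2 \<uplus>\<^sub>G graph_copies 2 (path_graph 3)) (list_graph 8 K2_2P3)"
  by (rule isomorphicI[where \<phi> = "case_sum (\<lambda>i. i) (\<lambda>(k, i). 2 + 3 * k + i)"])
     (simp_all add: concrete_graph_simps Plus_def inj_on_def image_Un insert_commute Sigma_def del: add_2_eq_Suc add_2_eq_Suc')

lemma iso_twoK2_K3: "isomorphic (graph_copies 2 (complete_graph 2) \<uplus>\<^sub>G complete_graph 3) (list_graph 7 twoK2_K3)"
  by (rule isomorphicI[where \<phi> = "case_sum (\<lambda>(k, i). 2 * k + i) (\<lambda>i. i + 4)"])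
     (simp_all add: concrete_graph_simps Plus_def inj_on_def image_Un insert_commute Sigma_def del: add_2_eq_Suc add_2_eq_Suc')

lemma iso_twoK2_P4plus: "isomorphic (graph_copies 2 (complete_graph 2) \<uplus>\<^sub>G P4_plus) (list_graph 9 twoK2_P4plus)"
  by (rule isomorphicI[where \<phi> = "case_sum (\<lambda>(k, i). 2 * k + i) (\<lambda>i. i + 4)"])
     (simp_all add: concrete_graph_simps Plus_def inj_on_def image_Un insert_commute Sigma_def del: add_2_eq_Suc add_2_eq_Suc')

lemma iso_threeK2_K13: "isomorphic (graph_copies 3 (complete_graph 2) \<uplus>\<^sub>G star_graph 3) (list_graph 10 threeK2_K13)"
  by (rule isomorphicI[where \<phi> = "case_sum (\<lambda>(k, i). 2 * k + i) (\<lambda>i. i + 6)"])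
     (simp_all add: concrete_graph_simps Plus_def inj_on_def image_Un insert_commute Sigma_def del: add_2_eq_Suc add_2_eq_Suc')

section \<open>Highly connected sets in one color\<close>

text \<open>
  Connectivity is phrased through vertex cuts instead of paths, since the arguments below either
  build a cut or need an edge across one. The formulation is about vertex sets: the graph meant
  is the one of all edges of color \<open>a\<close> inside \<open>U\<close>.
\<close>

definition kconn :: "coloring \<Rightarrow> nat \<Rightarrow> nat \<Rightarrow> nat set \<Rightarrow> bool" where
  "kconn c a k U \<longleftrightarrow> finite U \<and> k < card U \<and>
     (\<forall>X A B. finite X \<longrightarrow> card X < k \<longrightarrow> U - X = A \<union> B \<longrightarrow> A \<inter> B = {} \<longrightarrow> A \<noteq> {} \<longrightarrow> B \<noteq> {} \<longrightarrow>
        (\<exists>x\<in>A. \<exists>y\<in>B. c {x, y} = a))"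

lemma kconnI:
  assumes "finite U" "k < card U"
    "\<And>X A B. \<lbrakk>finite X; card X < k; U - X = A \<union> B; A \<inter> B = {}; A \<noteq> {}; B \<noteq> {}\<rbrakk>
      \<Longrightarrow> \<exists>x\<in>A. \<exists>y\<in>B. c {x, y} = a"
  shows "kconn c a k U"
  using assms unfolding kconn_def by blast

lemma kconnD:
  assumes "kconn c a k U" "finite X" "card X < k" "U - X = A \<union> B" "A \<inter> B = {}" "A \<noteq> {}" "B \<noteq> {}"
  shows "\<exists>x\<in>A. \<exists>y\<in>B. c {x, y} = a"
  using assms unfolding kconn_def by blast

text \<open>
  A vertex set reachable from a given vertex and its complement would be a forbidden cut, so
  cut-connectivity yields the path-connectivity of the definition.
\<close>

lemma kconn_has_ASMS:
  assumes kc: "kconn c a k U" and U: "U \<subseteq> {..<n}" and n: "n \<le> card U + f"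
  shows "has_ASMS k f n c"
proof -
  define G where "G = Graph U {e. e \<subseteq> U \<and> card e = 2 \<and> c e = a}"
  have fin: "finite U" and cU: "k < card U" using kc by (auto simp: kconn_def)
  have "subgraph G (complete_graph n)"
    using U fin by (auto simp: G_def subgraph_def simple_graph_def complete_graph_def)
  moreover have "Defs.monochromatic c G"
    by (auto simp: G_def Defs.monochromatic_def)
  moreover have "connected_graph (delete_verts G X)" if X: "X \<subseteq> U" "card X < k" for X
  proof -
    have finX: "finite X" using X(1) fin finite_subset by blast
    have "U - X \<noteq> {}" using X(2) cU finX by (metis Diff_eq_empty_iff card_mono leD less_trans)
    moreover have "(u, v) \<in> {(x, y). {x, y} \<in> edges (delete_verts G X)}\<^sup>*" (is "_ \<in> ?R\<^sup>*")
      if uv: "u \<in> U - X" "v \<in> U - X" for u v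
    proof (rule ccontr)
      assume nv: "(u, v) \<notin> ?R\<^sup>*"
      define A where "A = {w \<in> U - X. (u, w) \<in> ?R\<^sup>*}"
      define B where "B = (U - X) - A"
      have "u \<in> A" "v \<in> B" using uv nv by (auto simp: A_def B_def)
      then have "\<exists>x\<in>A. \<exists>y\<in>B. c {x, y} = a"
        by (intro kconnD[OF kc finX X(2)]) (auto simp: A_def B_def)
      then obtain x y where xy: "x \<in> A" "y \<in> B" "c {x, y} = a" by blast
      have "x \<noteq> y" using xy by (auto simp: B_def)
      then have "(x, y) \<in> ?R" using xy by (auto simp: A_def B_def G_def delete_verts_def)
      moreover have "(u, x) \<in> ?R\<^sup>*" using xy by (auto simp: A_def)
      ultimately have "(u, y) \<in> ?R\<^sup>*" by (rule rtrancl_into_rtrancl[rotated])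
      then show False using xy by (auto simp: A_def B_def)
    qed
    ultimately show ?thesis
      by (auto simp: connected_graph_def G_def delete_verts_def)
  qed
  then have "k_connected k G" using cU by (simp add: k_connected_def G_def graph_order_def)
  ultimately show ?thesis unfolding has_ASMS_def using n by (auto simp: G_def graph_order_def)
qed

lemma exists_neighbour_outside:
  assumes "k \<le> card {u \<in> U. P u}" "finite X" "card X < k"
  obtains u where "u \<in> U" "P u" "u \<notin> X"
proof -
  have "\<not> {u \<in> U. P u} \<subseteq> X" using assms by (metis card_mono leD le_trans)
  then show ?thesis using that by blast
qed

text \<open>
  A vertex with \<open>k\<close> neighbours in \<open>U\<close> keeps one of them when fewer than \<open>k\<close> vertices are deleted.
  So arbitrarily many such vertices can be added at once, at the price of lowering the
  connectivity from \<open>l\<close> to \<open>k\<close>.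
\<close>

lemma kconn_absorb:
  assumes kc: "kconn c a l U" and "k \<le> l" and fin: "finite W"
    and W: "\<And>w. w \<in> W \<Longrightarrow> k \<le> card {u \<in> U. c {w, u} = a}"
  shows "kconn c a k (U \<union> W)"
proof (rule kconnI)
  have finU: "finite U" and cU: "l < card U" using kc by (auto simp: kconn_def)
  show "finite (U \<union> W)" using finU fin by simp
  have "card U \<le> card (U \<union> W)" using finU fin by (simp add: card_mono)
  then show "k < card (U \<union> W)" using cU \<open>k \<le> l\<close> by simp
  fix X A B assume X: "finite X" "card X < k" and AB: "U \<union> W - X = A \<union> B" "A \<inter> B = {}" "A \<noteq> {}" "B \<noteq> {}"
  have one: "\<exists>x\<in>P. \<exists>y\<in>Q. c {x, y} = a"
    if PQ: "U \<union> W - X = P \<union> Q" "P \<inter> Q = {}" "Q \<noteq> {}" "U \<inter> Q = {}" for P Q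
  proof -
    obtain q where q: "q \<in> Q" "q \<in> W" using PQ by blast
    obtain u where "u \<in> U" "c {q, u} = a" "u \<notin> X"
      using exists_neighbour_outside[OF W[OF q(2)] X] by blast
    then show ?thesis using q PQ by (metis (no_types, lifting) DiffI UnE UnI1 disjoint_iff insert_commute)
  qed
  show "\<exists>x\<in>A. \<exists>y\<in>B. c {x, y} = a"
  proof (cases "U \<inter> A = {} \<or> U \<inter> B = {}")
    case True
    then show ?thesis
    proof
      assume "U \<inter> A = {}"
      then have "\<exists>x\<in>B. \<exists>y\<in>A. c {x, y} = a" using one[of B A] AB by (simp add: Un_commute Int_commute)
      then show ?thesis by (metis insert_commute)
    qed (use one[of A B] AB in blast)
  next
    case False
    have "\<exists>x\<in>U \<inter> A. \<exists>y\<in>U \<inter> B. c {x, y} = a"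
      by (rule kconnD[OF kc X(1)]) (use X(2) \<open>k \<le> l\<close> AB False in auto)
    then show ?thesis by blast
  qed
qed

lemma kconn_clique:
  assumes "finite U" "k < card U" "\<And>x y. \<lbrakk>x \<in> U; y \<in> U; x \<noteq> y\<rbrakk> \<Longrightarrow> c {x, y} = a"
  shows "kconn c a k U"
proof (rule kconnI)
  fix X A B assume "U - X = A \<union> B" "A \<inter> B = {}" "A \<noteq> {}" "B \<noteq> {}"
  then show "\<exists>x\<in>A. \<exists>y\<in>B. c {x, y} = a" using assms(3) by (metis DiffD1 UnI1 UnI2 disjoint_iff ex_in_conv)
qed (use assms in auto)

text \<open>
  Ramsey's theorem for \<open>m\<close> colors. Its monochromatic cliques are the highly connected sets from
  which the maximal one is chosen.
\<close>

lemma exists_large_clique: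
  "\<exists>N. \<forall>n\<ge>N. \<forall>c :: coloring. (\<forall>u<n. \<forall>v<n. u \<noteq> v \<longrightarrow> c {u, v} \<in> {1..m :: nat}) \<longrightarrow>
     (\<exists>U a. U \<subseteq> {..<n} \<and> card U = q \<and> (\<forall>x\<in>U. \<forall>y\<in>U. x \<noteq> y \<longrightarrow> c {x, y} = a))"
proof -
  obtain N where N: "partn_lst {..<N::nat} (replicate m q) 2" using ramsey_full by blast
  have "\<exists>U a. U \<subseteq> {..<n} \<and> card U = q \<and> (\<forall>x\<in>U. \<forall>y\<in>U. x \<noteq> y \<longrightarrow> c {x, y} = a)"
    if n: "n \<ge> N" and c: "\<forall>u<n. \<forall>v<n. u \<noteq> v \<longrightarrow> c {u, v} \<in> {1..m}" for n :: nat and c :: coloring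
  proof -
    define g where "g e = c e - 1" for e
    have g: "g \<in> nsets {..<n} 2 \<rightarrow> {..<length (replicate m q)}"
    proof
      fix e assume "e \<in> nsets {..<n} 2"
      then obtain u v where "e = {u, v}" "u < n" "v < n" "u \<noteq> v" by (auto elim: nsets2_E)
      then have "c e \<in> {1..m}" using c by blast
      then show "g e \<in> {..<length (replicate m q)}" by (auto simp: g_def)
    qed
    have "\<exists>i<length (replicate m q). \<exists>H\<in>nsets {..<n} (replicate m q ! i). g ` nsets H 2 \<subseteq> {i}"
      using partn_lst_greater_resource[OF N n] g
      unfolding partn_lst_def Ramsey.monochromatic_def by (elim bspec)
    then obtain i U where U: "i < m" "U \<in> nsets {..<n} q" "g ` nsets U 2 \<subseteq> {i}" by auto
    have "c {x, y} = Suc i" if "x \<in> U" "y \<in> U" "x \<noteq> y" for x y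
    proof -
      have "{x, y} \<in> nsets U 2" using that by (auto simp: nsets_def)
      then have "g {x, y} = i" using U by blast
      moreover have "c {x, y} \<in> {1..m}" using c that U(2) by (auto simp: nsets_def)
      ultimately show ?thesis by (auto simp: g_def)
    qed
    then show ?thesis using U(2) by (auto simp: nsets_def)
  qed
  then show ?thesis by blast
qed

section \<open>Windmills of rainbow triangles\<close>

text \<open>
  Triangles with common vertex \<open>r\<close> that no deletion of \<open>t\<close> vertices destroys. By choosing them one
  after the other, they can be taken to be disjoint apart from \<open>r\<close>. Quantifying over deleted sets
  makes pigeonhole arguments short: if every color fails, the union of the witnessing sets is
  still small.
\<close>

definition book :: "coloring \<Rightarrow> nat set \<Rightarrow> nat \<Rightarrow> nat \<Rightarrow> nat \<Rightarrow> nat \<Rightarrow> nat \<Rightarrow> bool" where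
  "book c V a b g t r \<longleftrightarrow> (\<forall>D. finite D \<longrightarrow> card D \<le> t \<longrightarrow>
     (\<exists>x\<in>V - D. \<exists>y\<in>V - D. c {x, y} = a \<and> c {r, x} = b \<and> c {r, y} = g))"

definition windmills :: "coloring \<Rightarrow> nat set \<Rightarrow> nat \<Rightarrow> nat \<Rightarrow> nat \<Rightarrow> nat \<Rightarrow> bool" where
  "windmills c V a b g t \<longleftrightarrow> (\<forall>D. finite D \<longrightarrow> card D \<le> t \<longrightarrow> (\<exists>r\<in>V - D. book c V a b g t r))"

lemma sum_card_swap:
  assumes "finite A" "finite B"
  shows "(\<Sum>x\<in>A. card {y \<in> B. P x y}) = (\<Sum>y\<in>B. card {x \<in> A. P x y})"
proof -
  have "card {y \<in> B. P x y} = (\<Sum>y\<in>B. if P x y then 1 else 0)" for x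
    using assms(2) by (simp add: sum.If_cases Int_def)
  moreover have "card {x \<in> A. P x y} = (\<Sum>x\<in>A. if P x y then 1 else 0)" for y
    using assms(1) by (simp add: sum.If_cases Int_def)
  ultimately show ?thesis by (simp add: sum.swap[of _ B A])
qed

text \<open>
  Double counting the edges between \<open>U\<close> and \<open>R\<close> that do not have color \<open>b\<close> shows that at most \<open>2l\<close>
  vertices of \<open>U\<close> have fewer than \<open>l\<close> neighbours in \<open>R\<close>. The others are joined to \<open>R\<close>, and any two
  vertices of \<open>R\<close> have many common neighbours, so the union is highly connected. It is larger
  than \<open>U\<close> since \<open>R\<close> has \<open>2l + 1\<close> elements.
\<close>

lemma dominated_extension:
  assumes U: "finite U" "5 * l + 2 \<le> card U" and R: "finite R" "card R = 2 * l + 1" "U \<inter> R = {}"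
    and dom: "\<And>r. r \<in> R \<Longrightarrow> card {u \<in> U. c {r, u} \<noteq> b} \<le> l"
  shows "\<exists>U'. kconn c b l U' \<and> U' \<subseteq> U \<union> R \<and> card U < card U'"
proof -
  define Bad where "Bad = {u \<in> U. card {r \<in> R. c {r, u} = b} < l}"
  define G where "G = U - Bad"
  have "finite Bad" "Bad \<subseteq> U" using U by (auto simp: Bad_def)
  have miss: "l + 2 \<le> card {r \<in> R. c {r, u} \<noteq> b}" if "u \<in> Bad" for u
  proof -
    have "card R = card ({r \<in> R. c {r, u} = b} \<union> {r \<in> R. c {r, u} \<noteq> b})"
      by (rule arg_cong[of _ _ card]) blast
    also have "\<dots> \<le> card {r \<in> R. c {r, u} = b} + card {r \<in> R. c {r, u} \<noteq> b}"
      by (rule card_Un_le)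
    finally have "card R \<le> card {r \<in> R. c {r, u} = b} + card {r \<in> R. c {r, u} \<noteq> b}" .
    then show ?thesis using that R(2) by (auto simp: Bad_def)
  qed
  have "card Bad * (l + 2) \<le> (\<Sum>u\<in>Bad. card {r \<in> R. c {r, u} \<noteq> b})"
    using sum_bounded_below[of Bad "l + 2" "\<lambda>u. card {r \<in> R. c {r, u} \<noteq> b}"] miss by simp
  also have "\<dots> = (\<Sum>r\<in>R. card {u \<in> Bad. c {r, u} \<noteq> b})"
    using \<open>finite Bad\<close> R(1) by (rule sum_card_swap)
  also have "\<dots> \<le> (\<Sum>r\<in>R. card {u \<in> U. c {r, u} \<noteq> b})"
    using \<open>Bad \<subseteq> U\<close> U(1) by (intro sum_mono card_mono) auto
  also have "\<dots> \<le> (2 * l + 1) * l"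
    using sum_bounded_above[of R "\<lambda>r. card {u \<in> U. c {r, u} \<noteq> b}" l] dom R(2) by simp
  finally have "card Bad * (l + 2) \<le> (2 * l + 1) * l" .
  moreover have "(2 * l + 1) * l \<le> 2 * l * (l + 2)" by (simp add: algebra_simps)
  ultimately have "card Bad * (l + 2) \<le> 2 * l * (l + 2)" by linarith
  then have Bad: "card Bad \<le> 2 * l" by (metis add_is_0 mult_le_cancel2 not_gr0 zero_neq_numeral)
  have cG: "card G + card Bad = card U" using U(1) \<open>Bad \<subseteq> U\<close>
    by (metis G_def card_Diff_subset card_mono finite_subset le_add_diff_inverse2)
  have disj: "G \<inter> R = {}" and finG: "finite G" using R(3) U(1) by (auto simp: G_def)
  have cU': "card (G \<union> R) = card G + (2 * l + 1)" using disj finG R by (simp add: card_Un_disjoint)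
  have Gdeg: "l \<le> card {r \<in> R. c {u, r} = b}" if "u \<in> G" for u
  proof -
    have "{r \<in> R. c {u, r} = b} = {r \<in> R. c {r, u} = b}" by (simp add: insert_commute)
    then show ?thesis using that by (auto simp: G_def Bad_def)
  qed
  have "kconn c b l (G \<union> R)"
  proof (rule kconnI)
    show "finite (G \<union> R)" using finG R by simp
    show "l < card (G \<union> R)" using cU' by simp
    fix X A B assume X: "finite X" "card X < l" and AB: "G \<union> R - X = A \<union> B" "A \<inter> B = {}" "A \<noteq> {}" "B \<noteq> {}"
    have common: "\<exists>u\<in>G - X. c {p, u} = b \<and> c {q, u} = b" if "p \<in> R" "q \<in> R" for p q
    proof (rule ccontr)
      assume "\<not> ?thesis"
      then have "G \<subseteq> X \<union> {u \<in> U. c {p, u} \<noteq> b} \<union> {u \<in> U. c {q, u} \<noteq> b}" by (auto simp: G_def)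
      then have "card G \<le> card (X \<union> {u \<in> U. c {p, u} \<noteq> b} \<union> {u \<in> U. c {q, u} \<noteq> b})"
        using X U by (intro card_mono) auto
      also have "\<dots> \<le> card X + card {u \<in> U. c {p, u} \<noteq> b} + card {u \<in> U. c {q, u} \<noteq> b}"
        by (meson add_mono card_Un_le le_refl order_trans)
      also have "\<dots> \<le> l + l + l" using X dom that by (intro add_mono) auto
      finally show False using cG Bad U(2) by simp
    qed
    have one: "\<exists>x\<in>P. \<exists>y\<in>Q. c {x, y} = b"
      if PQ: "G \<union> R - X = P \<union> Q" "P \<inter> Q = {}" "Q \<noteq> {}" "R \<inter> Q = {}" for P Q
    proof -
      obtain q where q: "q \<in> Q" "q \<in> G" using PQ by blast
      obtain u where u: "u \<in> R" "c {q, u} = b" "u \<notin> X"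
        using exists_neighbour_outside[OF Gdeg[OF q(2)] X] by blast
      then have "u \<in> P" using PQ by blast
      then show ?thesis using q u by (metis insert_commute)
    qed
    show "\<exists>x\<in>A. \<exists>y\<in>B. c {x, y} = b"
    proof (cases "R \<inter> A = {} \<or> R \<inter> B = {}")
      case True
      then show ?thesis
      proof
        assume "R \<inter> A = {}"
        then have "\<exists>x\<in>B. \<exists>y\<in>A. c {x, y} = b" using one[of B A] AB by (simp add: Un_commute Int_commute)
        then show ?thesis by (metis insert_commute)
      qed (use one[of A B] AB in blast)
    next
      case False
      then obtain p q where pq: "p \<in> R" "p \<in> A" "q \<in> R" "q \<in> B" by blast
      then obtain u where u: "u \<in> G - X" "c {p, u} = b" "c {q, u} = b" using common by blast
      then have "u \<in> A \<or> u \<in> B" using AB by blast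
      then show ?thesis using pq u by (metis insert_commute)
    qed
  qed
  moreover have "card U < card (G \<union> R)" using cU' cG Bad by simp
  ultimately show ?thesis by (intro exI[of _ "G \<union> R"]) (auto simp: G_def)
qed

lemma card_UN_bound:
  assumes "finite I" "\<And>i. i \<in> I \<Longrightarrow> card (D i) \<le> t"
  shows "card (\<Union>i\<in>I. D i) \<le> card I * t"
  using card_UN_le[OF assms(1), of D] sum_bounded_above[of I "\<lambda>i. card (D i)" t] assms(2) by simp

text \<open>
  The colors at \<open>r\<close> split \<open>U\<close> into the vertices joined to \<open>r\<close> in a frequent color \<open>b\<close> and the rest.
  If each third color \<open>g\<close> failed for some set of \<open>t\<close> vertices, deleting all these sets and the fewer
  than \<open>k\<close> vertices joined to \<open>r\<close> in color \<open>a\<close> would remove fewer than \<open>l\<close> vertices. Then an edge of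
  color \<open>a\<close> joins the two parts, and it forms a triangle with \<open>r\<close>.
\<close>

lemma exists_book:
  assumes kc: "kconn c a l U" and l: "k + m * t < l" and r: "r \<notin> U"
    and low: "card {u \<in> U. c {r, u} = a} < k"
    and col: "\<And>u. u \<in> U \<Longrightarrow> c {r, u} \<in> {1..m}"
    and big: "m * l < card U"
    and nondom: "\<And>b. b \<in> {1..m} \<Longrightarrow> l < card {u \<in> U. c {r, u} \<noteq> b}"
  shows "\<exists>b\<in>{1..m}. \<exists>g\<in>{1..m}. a \<noteq> b \<and> a \<noteq> g \<and> b \<noteq> g \<and> book c U a b g t r"
proof -
  have finU: "finite U" using kc by (simp add: kconn_def)
  define N where "N b = {u \<in> U. c {r, u} = b}" for b
  have finN: "finite (N b)" for b using finU by (simp add: N_def)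
  have "\<exists>b\<in>{1..m}. l < card (N b)"
  proof (rule ccontr)
    assume "\<not> ?thesis"
    then have "card (\<Union>b\<in>{1..m}. N b) \<le> card {1..m} * l" by (intro card_UN_bound) (auto simp: not_less)
    moreover have "(\<Union>b\<in>{1..m}. N b) = U" using col by (auto simp: N_def)
    ultimately show False using big by simp
  qed
  then obtain b where b: "b \<in> {1..m}" "l < card (N b)" by blast
  have "b \<noteq> a" using b(2) low l by (auto simp: N_def)
  have "\<exists>g\<in>{1..m} - {a, b}. book c U a b g t r"
  proof (rule ccontr)
    assume no: "\<not> ?thesis"
    define Q where "Q g D \<longleftrightarrow> finite D \<and> card D \<le> t \<and>
        \<not> (\<exists>x\<in>U - D. \<exists>y\<in>U - D. c {x, y} = a \<and> c {r, x} = b \<and> c {r, y} = g)" for g D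
    have "\<forall>g. \<exists>D. g \<in> {1..m} - {a, b} \<longrightarrow> Q g D"
      using no unfolding book_def Q_def by meson
    then have "\<exists>D. \<forall>g. g \<in> {1..m} - {a, b} \<longrightarrow> Q g (D g)" by (rule choice)
    then obtain D where "\<forall>g. g \<in> {1..m} - {a, b} \<longrightarrow> Q g (D g)" by (elim exE)
    then have D: "finite (D g) \<and> card (D g) \<le> t \<and>
        \<not> (\<exists>x\<in>U - D g. \<exists>y\<in>U - D g. c {x, y} = a \<and> c {r, x} = b \<and> c {r, y} = g)"
      if "g \<in> {1..m} - {a, b}" for g using that unfolding Q_def by simp
    define X where "X = N a \<union> (\<Union>g\<in>{1..m} - {a, b}. D g)"
    have finX: "finite X" using D finN by (auto simp: X_def)
    have "card (\<Union>g\<in>{1..m} - {a, b}. D g) \<le> card ({1..m} - {a, b}) * t"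
      using D by (intro card_UN_bound) auto
    also have "\<dots> \<le> m * t" using card_mono[of "{1..m}" "{1..m} - {a, b}"] by simp
    finally have "card X \<le> card (N a) + m * t" unfolding X_def by (meson add_left_mono card_Un_le order_trans)
    then have cX: "card X < l" using low l by (simp add: N_def)
    have ne: "S - X \<noteq> {}" if "finite S" "l < card S" for S
      using that cX finX by (metis Diff_eq_empty_iff card_mono leD less_trans)
    have "l < card {u \<in> U. c {r, u} \<noteq> b}" using nondom b(1) .
    then have "N b - X \<noteq> {}" "{u \<in> U. c {r, u} \<noteq> b} - X \<noteq> {}"
      using ne b(2) finN finU by auto
    then have "\<exists>x\<in>N b - X. \<exists>y\<in>{u \<in> U. c {r, u} \<noteq> b} - X. c {x, y} = a"
      by (intro kconnD[OF kc finX cX]) (auto simp: N_def)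
    then obtain x y where xy: "x \<in> N b - X" "y \<in> U - X" "c {r, y} \<noteq> b" "c {x, y} = a" by blast
    have "c {r, y} \<noteq> a" using xy(2) by (auto simp: X_def N_def)
    then have g: "c {r, y} \<in> {1..m} - {a, b}" using xy col by blast
    then have "x \<in> U - D (c {r, y})" "y \<in> U - D (c {r, y})" using xy by (auto simp: X_def N_def)
    moreover have "c {r, x} = b" using xy by (simp add: N_def)
    ultimately show False using D[OF g] xy(4) by blast
  qed
  then obtain g where "g \<in> {1..m}" "g \<noteq> a" "g \<noteq> b" "book c U a b g t r" by (elim bexE DiffE) simp
  then show ?thesis using b(1) \<open>b \<noteq> a\<close> by (intro bexI[of _ b] bexI[of _ g]) auto
qed

lemma book_mono: "book c U a b g t r \<Longrightarrow> U \<subseteq> V \<Longrightarrow> book c V a b g t r"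
  unfolding book_def by (meson Diff_mono order_refl subsetD)

text \<open>
  The argument described at the beginning. The connectivity \<open>l\<close> of the largest set exceeds the
  connectivity \<open>k\<close> used for absorption, which keeps the vertices joined to \<open>r\<close> in color \<open>a\<close> from
  blocking all edges between the two parts of that set.
\<close>

theorem no_ASMS_imp_windmills:
  "\<exists>f N. \<forall>n\<ge>N. \<forall>c :: coloring. (\<forall>u<n. \<forall>v<n. u \<noteq> v \<longrightarrow> c {u, v} \<in> {1..m :: nat}) \<longrightarrow>
     \<not> has_ASMS k f n c \<longrightarrow>
     (\<exists>a b g. a \<noteq> b \<and> a \<noteq> g \<and> b \<noteq> g \<and> windmills c {..<n} a b g t)"
proof -
  \<comment> \<open>The connectivity \<open>l\<close> allows deleting \<open>k\<close> vertices and one set of \<open>t\<close> vertices per color. The clique of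
    size \<open>q\<close> makes the largest set big enough for a frequent color and for common neighbours. The two
    summands of \<open>f\<close> pay for the dominated vertices and for the pigeonhole over pairs of colors.\<close>
  define l where "l = k + m * t + 1"
  define q where "q = (m + 5) * l + 2"
  define f where "f = m * (2 * l) + m * m * t"
  obtain N where N: "\<And>n (c :: coloring). \<lbrakk>n \<ge> N; \<forall>u<n. \<forall>v<n. u \<noteq> v \<longrightarrow> c {u, v} \<in> {1..m}\<rbrakk> \<Longrightarrow>
     (\<exists>U a. U \<subseteq> {..<n} \<and> card U = q \<and> (\<forall>x\<in>U. \<forall>y\<in>U. x \<noteq> y \<longrightarrow> c {x, y} = a))"
    using exists_large_clique[of m q] by blast
  have "\<exists>a b g. a \<noteq> b \<and> a \<noteq> g \<and> b \<noteq> g \<and> windmills c {..<n} a b g t"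
    if n: "n \<ge> N" and col: "\<forall>u<n. \<forall>v<n. u \<noteq> v \<longrightarrow> c {u, v} \<in> {1..m}" and no: "\<not> has_ASMS k f n c"
    for n and c :: coloring
  proof -
    let ?V = "{..<n}"
    define S where "S = (\<lambda>(U, a). U \<subseteq> ?V \<and> kconn c a l U)"
    obtain U0 a0 where U0: "U0 \<subseteq> ?V" "card U0 = q" "\<forall>x\<in>U0. \<forall>y\<in>U0. x \<noteq> y \<longrightarrow> c {x, y} = a0"
      using N[OF n col] by blast
    have fin: "finite W" if "W \<subseteq> ?V" for W using that finite_subset by blast
    have S0: "S (U0, a0)" unfolding S_def using U0 fin
      by (auto intro!: kconn_clique simp: q_def algebra_simps)
    moreover have "\<forall>p. S p \<longrightarrow> card (fst p) < Suc n"
      by (auto simp: S_def less_Suc_eq_le dest: card_mono[rotated])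
    ultimately have "\<exists>p. S p \<and> (\<forall>p'. S p' \<longrightarrow> card (fst p') \<le> card (fst p))"
      by (rule ex_has_greatest_nat)
    then obtain p where p: "S p" "\<forall>p'. S p' \<longrightarrow> card (fst p') \<le> card (fst p)" by (elim exE conjE)
    define U where "U = fst p"
    define a where "a = snd p"
    have Ua: "S (U, a)" using p(1) by (simp add: U_def a_def)
    have max: "card (fst p') \<le> card U" if "S p'" for p' unfolding U_def using p(2)[rule_format, OF that] .
    have U: "U \<subseteq> ?V" "kconn c a l U" using Ua by (auto simp: S_def)
    have cU: "q \<le> card U" using max[OF S0] U0 by simp
    have finU: "finite U" using U fin by blast
    define R where "R = {r \<in> ?V - U. card {u \<in> U. c {r, u} = a} < k}"
    have finR: "finite R" by (simp add: R_def)
    have "f < card R"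
    proof (rule ccontr)
      assume "\<not> f < card R"
      have "kconn c a k (U \<union> (?V - U - R))"
        by (rule kconn_absorb[OF U(2)]) (auto simp: R_def l_def not_less)
      moreover have "U \<union> (?V - U - R) = ?V - R" using U(1) by (auto simp: R_def)
      ultimately have "kconn c a k (?V - R)" by simp
      moreover have "card (?V - R) = n - card R" by (subst card_Diff_subset[OF finR]) (auto simp: R_def)
      ultimately have "has_ASMS k f n c"
        using \<open>\<not> f < card R\<close> by (intro kconn_has_ASMS[of c a k "?V - R"]) auto
      then show False using no by blast
    qed
    define Dom where "Dom b = {r \<in> R. card {u \<in> U. c {r, u} \<noteq> b} \<le> l}" for b
    have Dom: "card (Dom b) \<le> 2 * l" for b
    proof (rule ccontr)
      assume "\<not> ?thesis"
      then obtain T where T: "T \<subseteq> Dom b" "card T = 2 * l + 1"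
        by (metis Suc_eq_plus1 not_less_eq_eq obtain_subset_with_card_n)
      have "\<exists>U'. kconn c b l U' \<and> U' \<subseteq> U \<union> T \<and> card U < card U'"
      proof (rule dominated_extension[OF finU])
        show "5 * l + 2 \<le> card U" using cU by (simp add: q_def algebra_simps)
        show "finite T" using T(1) finR by (auto simp: Dom_def intro: finite_subset)
      qed (use T in \<open>auto simp: Dom_def R_def\<close>)
      then obtain U' where U': "kconn c b l U'" "U' \<subseteq> U \<union> T" "card U < card U'" by blast
      have "U' \<subseteq> ?V" using U' U(1) T(1) by (auto simp: Dom_def R_def)
      then have "S (U', b)" using U' by (simp add: S_def)
      then show False using max U'(3) by fastforce
    qed
    define R' where "R' = R - (\<Union>b\<in>{1..m}. Dom b)"
    have "card (\<Union>b\<in>{1..m}. Dom b) \<le> card {1..m} * (2 * l)" using Dom by (intro card_UN_bound) auto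
    moreover have "card R \<le> card R' + card (\<Union>b\<in>{1..m}. Dom b)"
    proof -
      have "R \<subseteq> R' \<union> (\<Union>b\<in>{1..m}. Dom b)" by (auto simp: R'_def)
      then have "card R \<le> card (R' \<union> (\<Union>b\<in>{1..m}. Dom b))"
        using finR by (intro card_mono) (auto simp: R'_def Dom_def)
      then show ?thesis using card_Un_le order_trans by blast
    qed
    ultimately have R': "m * m * t < card R'" using \<open>f < card R\<close> by (simp add: f_def)
    have books: "\<exists>b\<in>{1..m}. \<exists>g\<in>{1..m}. a \<noteq> b \<and> a \<noteq> g \<and> b \<noteq> g \<and> book c ?V a b g t r" if "r \<in> R'" for r
    proof -
      have r: "r \<in> R" "r < n" "r \<notin> U" using that by (auto simp: R'_def R_def)
      have "\<exists>b\<in>{1..m}. \<exists>g\<in>{1..m}. a \<noteq> b \<and> a \<noteq> g \<and> b \<noteq> g \<and> book c U a b g t r"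
      proof (rule exists_book[OF U(2)])
        show "c {r, u} \<in> {1..m}" if "u \<in> U" for u using col r U(1) that by blast
        show "m * l < card U" using cU by (simp add: q_def algebra_simps)
        show "l < card {u \<in> U. c {r, u} \<noteq> b}" if "b \<in> {1..m}" for b
          using that \<open>r \<in> R'\<close> r(1) by (auto simp: R'_def Dom_def not_le)
      qed (use r in \<open>auto simp: l_def R_def\<close>)
      then show ?thesis using book_mono U(1) by blast
    qed
    show ?thesis
    proof (rule ccontr)
      assume contra: "\<not> ?thesis"
      \<comment> \<open>Here \<open>p\<close> is the pair of the second and the third color.\<close>
      define Q where "Q p D \<longleftrightarrow>
          finite D \<and> card D \<le> t \<and> (\<forall>r\<in>?V - D. \<not> book c ?V a (fst p) (snd p) t r)" for p D
      have "\<exists>D. Q p D" if "a \<noteq> fst p" "a \<noteq> snd p" "fst p \<noteq> snd p" for p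
      proof -
        have "\<not> windmills c ?V a (fst p) (snd p) t" using contra that by blast
        then show ?thesis unfolding windmills_def Q_def by meson
      qed
      then have "\<forall>p. \<exists>D. a \<noteq> fst p \<and> a \<noteq> snd p \<and> fst p \<noteq> snd p \<longrightarrow> Q p D" by meson
      then have "\<exists>D. \<forall>p. a \<noteq> fst p \<and> a \<noteq> snd p \<and> fst p \<noteq> snd p \<longrightarrow> Q p (D p)" by (rule choice)
      then obtain D where DQ: "\<forall>p. a \<noteq> fst p \<and> a \<noteq> snd p \<and> fst p \<noteq> snd p \<longrightarrow> Q p (D p)" by (elim exE)
      have D: "finite (D p) \<and> card (D p) \<le> t \<and> (\<forall>r\<in>?V - D p. \<not> book c ?V a (fst p) (snd p) t r)"
        if "a \<noteq> fst p" "a \<noteq> snd p" "fst p \<noteq> snd p" for p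
        using DQ[rule_format, of p] that unfolding Q_def by blast
      define I where "I = {p \<in> {1..m} \<times> {1..m}. a \<noteq> fst p \<and> a \<noteq> snd p \<and> fst p \<noteq> snd p}"
      have "card I \<le> m * m" using card_mono[of "{1..m} \<times> {1..m}" I] by (auto simp: I_def)
      have "finite I" by (simp add: I_def)
      have "card (\<Union>p\<in>I. D p) \<le> card I * t" using D \<open>finite I\<close> by (intro card_UN_bound) (auto simp: I_def)
      also have "\<dots> \<le> m * m * t" using \<open>card I \<le> m * m\<close> by simp
      finally have "card (\<Union>p\<in>I. D p) < card R'" using R' by simp
      moreover have "finite (\<Union>p\<in>I. D p)" using D \<open>finite I\<close> by (auto simp: I_def)
      ultimately have "\<not> R' \<subseteq> (\<Union>p\<in>I. D p)" by (metis card_mono leD)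
      then obtain r where r: "r \<in> R'" "r \<notin> (\<Union>p\<in>I. D p)" by blast
      obtain b g where bg: "b \<in> {1..m}" "g \<in> {1..m}" "a \<noteq> b" "a \<noteq> g" "b \<noteq> g" "book c ?V a b g t r"
        using books[OF r(1)] by blast
      then have "r \<notin> D (b, g)" using r(2) by (auto simp: I_def)
      moreover have "r < n" using r(1) by (auto simp: R'_def R_def)
      ultimately show False using D[of "(b, g)"] bg by auto
    qed
  qed
  then show ?thesis by blast
qed

section \<open>Rainbow pieces found in windmills\<close>

text \<open>
  The host vertices are listed in the order of the positions used by the edge list \<open>L\<close>.
\<close>

definition rainbow_copy :: "coloring \<Rightarrow> nat \<Rightarrow> nat \<Rightarrow> (nat \<times> nat) list \<Rightarrow> bool" where
  "rainbow_copy c n r L \<longleftrightarrow> (\<exists>xs. length xs = r \<and> distinct xs \<and> set xs \<subseteq> {..<n} \<and>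
     distinct (map (\<lambda>(i, j). c {xs ! i, xs ! j}) L))"

lemma rainbow_copyI:
  assumes "distinct xs" "set xs \<subseteq> {..<n}" "length xs = r" "distinct (map (\<lambda>(i, j). c {xs ! i, xs ! j}) L)"
  shows "rainbow_copy c n r L"
  using assms unfolding rainbow_copy_def by blast

text \<open>
  The number 40 leaves room for all vertices to be avoided below: up to 30 of them at a time,
  and the vertices of the windmill that have been chosen already.
\<close>

locale windmill_coloring =
  fixes c :: coloring and n a b g :: nat
  assumes windmills: "windmills c {..<n} a b g 40"
    and abg: "a \<noteq> b" "a \<noteq> g" "b \<noteq> g"
begin

definition base :: "nat set" where "base = {a, b, g}"

lemma base_colours [simp]: "a \<in> base" "b \<in> base" "g \<in> base"
  by (auto simp: base_def)

text \<open>
  The set \<open>D\<close> and the list \<open>ds\<close> are both to be avoided. The list is for vertices known by name, so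
  that the simplifier can derive that all vertices of a constructed copy are distinct.
\<close>

lemma ex_windmill:
  assumes "finite D" "card D + length ds \<le> 30"
  obtains r x1 y1 x2 y2 where
    "distinct [r, x1, y1, x2, y2]" "set [r, x1, y1, x2, y2] \<inter> (D \<union> set ds) = {}"
    "set [r, x1, y1, x2, y2] \<subseteq> {..<n}"
    "c {x1, y1} = a" "c {r, x1} = b" "c {r, y1} = g" "c {x2, y2} = a" "c {r, x2} = b" "c {r, y2} = g"
proof -
  have "card (D \<union> set ds) \<le> card D + length ds"
    by (meson add_left_mono card_Un_le card_length order_trans)
  then have D: "finite (D \<union> set ds)" "card (D \<union> set ds) \<le> 30" using assms by auto
  then obtain r where r: "r < n" "r \<notin> D \<union> set ds" "book c {..<n} a b g 40 r"
    using windmills[unfolded windmills_def, rule_format, of "D \<union> set ds"] by auto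
  have ins: "card (insert z E) \<le> Suc (card E)" for z :: nat and E by (cases "finite E") (auto simp: card_insert_if)
  have c1: "card (insert r (D \<union> set ds)) \<le> 31" using D(2) ins[of r "D \<union> set ds"] by linarith
  then have "\<exists>x\<in>{..<n} - insert r (D \<union> set ds). \<exists>y\<in>{..<n} - insert r (D \<union> set ds). c {x, y} = a \<and> c {r, x} = b \<and> c {r, y} = g"
    using r(3)[unfolded book_def, rule_format, of "insert r (D \<union> set ds)"] D(1) by simp
  then obtain x1 y1 where 1: "x1 < n" "x1 \<notin> insert r (D \<union> set ds)" "y1 < n" "y1 \<notin> insert r (D \<union> set ds)"
    "c {x1, y1} = a" "c {r, x1} = b" "c {r, y1} = g" by blast
  let ?E = "insert x1 (insert y1 (insert r (D \<union> set ds)))"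
  have "card ?E \<le> 33" using c1 ins[of y1 "insert r (D \<union> set ds)"] ins[of x1 "insert y1 (insert r (D \<union> set ds))"] by linarith
  then have "\<exists>x\<in>{..<n} - ?E. \<exists>y\<in>{..<n} - ?E. c {x, y} = a \<and> c {r, x} = b \<and> c {r, y} = g"
    using r(3)[unfolded book_def, rule_format, of ?E] D(1) by simp
  then obtain x2 y2 where 2: "x2 < n" "x2 \<notin> ?E" "y2 < n" "y2 \<notin> ?E"
    "c {x2, y2} = a" "c {r, x2} = b" "c {r, y2} = g" by blast
  have "x1 \<noteq> y1" "x2 \<noteq> y2" using 1 2 abg by auto
  then show ?thesis using that[of r x1 y1 x2 y2] r 1 2 by auto
qed

text \<open>
  Each pair of the three colors meets at a vertex of a triangle.
\<close>

lemma ex_base_path: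
  assumes "finite D" "card D + length ds \<le> 30" and e: "e \<in> base" "e' \<in> base" "e \<noteq> e'"
  obtains p q s where "distinct [p, q, s]" "set [p, q, s] \<inter> (D \<union> set ds) = {}" "set [p, q, s] \<subseteq> {..<n}"
    "c {p, q} = e" "c {q, s} = e'"
proof -
  obtain r x1 y1 x2 y2 where *:
    "distinct [r, x1, y1, x2, y2]" "set [r, x1, y1, x2, y2] \<inter> (D \<union> set ds) = {}"
    "set [r, x1, y1, x2, y2] \<subseteq> {..<n}"
    "c {x1, y1} = a" "c {r, x1} = b" "c {r, y1} = g" "c {x2, y2} = a" "c {r, x2} = b" "c {r, y2} = g"
    by (rule ex_windmill[OF assms(1,2)])
  have sym: "c {y1, x1} = a" "c {x1, r} = b" "c {y1, r} = g" using * by (simp_all add: insert_commute)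
  consider "e = a" "e' = b" | "e = b" "e' = a" | "e = a" "e' = g" | "e = g" "e' = a" | "e = b" "e' = g" | "e = g" "e' = b"
    using e unfolding base_def by auto
  then show ?thesis
  proof cases
    case 1 then show ?thesis by (intro that[of y1 x1 r]) (use * sym in auto)
  next
    case 2 then show ?thesis by (intro that[of r x1 y1]) (use * sym in auto)
  next
    case 3 then show ?thesis by (intro that[of x1 y1 r]) (use * sym in auto)
  next
    case 4 then show ?thesis by (intro that[of r y1 x1]) (use * sym in auto)
  next
    case 5 then show ?thesis by (intro that[of x1 r y1]) (use * sym in auto)
  next
    case 6 then show ?thesis by (intro that[of y1 r x1]) (use * sym in auto)
  qed
qed

lemma ex_base_edge:
  assumes "finite D" "card D + length ds \<le> 30" and e: "e \<in> base"
  obtains p q where "p \<noteq> q" "set [p, q] \<inter> (D \<union> set ds) = {}" "set [p, q] \<subseteq> {..<n}" "c {p, q} = e"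
proof -
  obtain e' where e': "e' \<in> base" "e \<noteq> e'" using abg base_colours by metis
  obtain p q s where "distinct [p, q, s]" "set [p, q, s] \<inter> (D \<union> set ds) = {}" "set [p, q, s] \<subseteq> {..<n}"
    "c {p, q} = e" "c {q, s} = e'"
    by (rule ex_base_path[OF assms(1,2) e e'])
  then show ?thesis using that[of p q] by auto
qed

lemma ex_base_triangle:
  assumes "finite D" "card D + length ds \<le> 30"
  obtains p q s where "distinct [p, q, s]" "set [p, q, s] \<inter> (D \<union> set ds) = {}" "set [p, q, s] \<subseteq> {..<n}"
    "c {p, q} = a" "c {q, s} = g" "c {p, s} = b"
proof -
  obtain r x1 y1 x2 y2 where
    "distinct [r, x1, y1, x2, y2]" "set [r, x1, y1, x2, y2] \<inter> (D \<union> set ds) = {}"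
    "set [r, x1, y1, x2, y2] \<subseteq> {..<n}"
    "c {x1, y1} = a" "c {r, x1} = b" "c {r, y1} = g" "c {x2, y2} = a" "c {r, x2} = b" "c {r, y2} = g"
    by (rule ex_windmill[OF assms(1,2)])
  then show ?thesis by (intro that[of x1 y1 r]) (auto simp: insert_commute)
qed

text \<open>
  Two triangles of the same windmill are needed: the path runs through the centre.
\<close>

lemma ex_base_P4:
  assumes "finite D" "card D + length ds \<le> 30"
  obtains p q s t where "distinct [p, q, s, t]" "set [p, q, s, t] \<inter> (D \<union> set ds) = {}" "set [p, q, s, t] \<subseteq> {..<n}"
    "c {p, q} = a" "c {q, s} = g" "c {s, t} = b"
proof -
  obtain r x1 y1 x2 y2 where
    "distinct [r, x1, y1, x2, y2]" "set [r, x1, y1, x2, y2] \<inter> (D \<union> set ds) = {}"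
    "set [r, x1, y1, x2, y2] \<subseteq> {..<n}"
    "c {x1, y1} = a" "c {r, x1} = b" "c {r, y1} = g" "c {x2, y2} = a" "c {r, x2} = b" "c {r, y2} = g"
    by (rule ex_windmill[OF assms(1,2)])
  then show ?thesis by (intro that[of x1 y1 r x2]) (auto simp: insert_commute)
qed

lemma two_base_colours:
  obtains e1 e2 where "e1 \<in> base" "e2 \<in> base" "e1 \<noteq> e2" "e1 \<noteq> e" "e2 \<noteq> e"
proof -
  consider "e = a" | "e = b" | "e \<noteq> a" "e \<noteq> b" by blast
  then show ?thesis
    by cases (use that[of b g] that[of a g] that[of a b] abg in simp_all)
qed

lemma third_base_colour:
  obtains e where "e \<in> base" "e \<noteq> e1" "e \<noteq> e2"
proof -
  have "\<not> base \<subseteq> {e1, e2}" unfolding base_def using abg by auto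
  then show ?thesis using that by blast
qed

end

section \<open>A rainbow star in further colors\<close>

locale star_coloring = windmill_coloring +
  fixes v a1 a2 a3 a4 a5 :: nat
  assumes dist: "distinct [v, a1, a2, a3, a4, a5]" and less: "set [v, a1, a2, a3, a4, a5] \<subseteq> {..<n}"
    and dcol: "distinct [c {v, a1}, c {v, a2}, c {v, a3}, c {v, a4}, c {v, a5}]"
    and new: "set [c {v, a1}, c {v, a2}, c {v, a3}, c {v, a4}, c {v, a5}] \<inter> base = {}"
begin

abbreviation (input) "leaves \<equiv> [v, a1, a2, a3, a4, a5]"

lemmas new_abg = new[unfolded base_def]

text \<open>
  For two leaves, the edge between them differs in color from at least one of the two edges that
  join them to the centre. So the star can be extended by an edge at one of its leaves.
\<close>

lemma star_path:
  obtains p q l l' where "distinct [v, p, q, l, l']" "set [v, p, q, l, l'] \<subseteq> {..<n}"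
    "distinct [c {v, p}, c {v, l}, c {v, l'}, c {p, q}]" "c {v, p} \<notin> base" "c {v, l} \<notin> base" "c {v, l'} \<notin> base"
proof -
  define e where "e = c {a1, a2}"
  obtain l l' where l: "(l, l') \<in> {(a3, a4), (a3, a5), (a4, a5)}" "c {v, l} \<noteq> e" "c {v, l'} \<noteq> e"
  proof -
    consider "c {v, a3} = e" | "c {v, a4} = e" | "c {v, a3} \<noteq> e" "c {v, a4} \<noteq> e" by blast
    then show thesis
      by cases (use that[of a4 a5] that[of a3 a5] that[of a3 a4] dcol in auto)
  qed
  have e': "e = c {a2, a1}" by (simp add: e_def insert_commute)
  show ?thesis
  proof (cases "c {v, a1} = e")
    case False
    then show ?thesis using that[of a1 a2 l l'] l dist less dcol new unfolding e_def by auto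
  next
    case True
    then have "c {v, a2} \<noteq> e" using dcol by auto
    then show ?thesis using that[of a2 a1 l l'] l dist less dcol new unfolding e' by auto
  qed
qed

lemma rainbow_threeK2_K13: "rainbow_copy c n 10 threeK2_K13"
proof -
  obtain p q where 1: "p \<noteq> q" "set [p, q] \<inter> ({} \<union> set leaves) = {}" "set [p, q] \<subseteq> {..<n}" "c {p, q} = a"
    by (rule ex_base_edge[of "{}" leaves a]) auto
  obtain p' q' where 2: "p' \<noteq> q'" "set [p', q'] \<inter> ({} \<union> set (p # q # leaves)) = {}" "set [p', q'] \<subseteq> {..<n}" "c {p', q'} = b"
    by (rule ex_base_edge[of "{}" "p # q # leaves" b]) auto
  obtain p'' q'' where 3: "p'' \<noteq> q''" "set [p'', q''] \<inter> ({} \<union> set (p' # q' # p # q # leaves)) = {}" "set [p'', q''] \<subseteq> {..<n}" "c {p'', q''} = g"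
    by (rule ex_base_edge[of "{}" "p' # q' # p # q # leaves" g]) auto
  show ?thesis
    by (rule rainbow_copyI[of "[p, q, p', q', p'', q'', v, a1, a2, a3]"])
       (use 1 2 3 dist less dcol new_abg abg in \<open>auto simp: threeK2_K13_def\<close>)
qed

lemma rainbow_K2_2P3: "rainbow_copy c n 8 K2_2P3"
proof -
  obtain p q where 1: "p \<noteq> q" "set [p, q] \<inter> ({} \<union> set leaves) = {}" "set [p, q] \<subseteq> {..<n}" "c {p, q} = a"
    by (rule ex_base_edge[of "{}" leaves a]) auto
  obtain p' q' s where 2: "distinct [p', q', s]" "set [p', q', s] \<inter> ({} \<union> set (p # q # leaves)) = {}" "set [p', q', s] \<subseteq> {..<n}" "c {p', q'} = b" "c {q', s} = g"
    by (rule ex_base_path[of "{}" "p # q # leaves" b g]) (use abg in auto)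
  have leafv: "c {a1, v} = c {v, a1}" by (simp add: insert_commute)
  show ?thesis
    by (rule rainbow_copyI[of "[p, q, p', q', s, a1, v, a2]"])
       (use 1 2 leafv dist less dcol new_abg abg in \<open>auto simp: K2_2P3_def\<close>)
qed

lemma rainbow_P3_P4: "rainbow_copy c n 7 P3_P4"
proof -
  obtain p q l l' where 1: "distinct [v, p, q, l, l']" "set [v, p, q, l, l'] \<subseteq> {..<n}"
    "distinct [c {v, p}, c {v, l}, c {v, l'}, c {p, q}]" "c {v, p} \<notin> base" "c {v, l} \<notin> base"
    by (rule star_path)
  obtain e1 e2 where e: "e1 \<in> base" "e2 \<in> base" "e1 \<noteq> e2" "e1 \<noteq> c {p, q}" "e2 \<noteq> c {p, q}"
    by (rule two_base_colours)
  obtain p' q' s where 2: "distinct [p', q', s]" "set [p', q', s] \<inter> ({} \<union> set [v, p, q, l]) = {}" "set [p', q', s] \<subseteq> {..<n}" "c {p', q'} = e1" "c {q', s} = e2"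
    by (rule ex_base_path[of "{}" "[v, p, q, l]" e1 e2]) (use e in auto)
  have [simp]: "c {l, v} = c {v, l}" by (simp add: insert_commute)
  show ?thesis
    by (rule rainbow_copyI[of "[p', q', s, l, v, p, q]"])
       (use 1 2 e in \<open>auto simp: P3_P4_def\<close>)
qed

lemma rainbow_twoK2_P4plus: "rainbow_copy c n 9 twoK2_P4plus"
proof -
  obtain p q l l' where 1: "distinct [v, p, q, l, l']" "set [v, p, q, l, l'] \<subseteq> {..<n}"
    "distinct [c {v, p}, c {v, l}, c {v, l'}, c {p, q}]" "c {v, p} \<notin> base" "c {v, l} \<notin> base" "c {v, l'} \<notin> base"
    by (rule star_path)
  obtain e1 e2 where e: "e1 \<in> base" "e2 \<in> base" "e1 \<noteq> e2" "e1 \<noteq> c {p, q}" "e2 \<noteq> c {p, q}"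
    by (rule two_base_colours)
  obtain p' q' where 2: "p' \<noteq> q'" "set [p', q'] \<inter> ({} \<union> set [v, p, q, l, l']) = {}" "set [p', q'] \<subseteq> {..<n}" "c {p', q'} = e1"
    by (rule ex_base_edge[of "{}" "[v, p, q, l, l']" e1]) (use e in auto)
  obtain p'' q'' where 3: "p'' \<noteq> q''" "set [p'', q''] \<inter> ({} \<union> set [v, p, q, l, l', p', q']) = {}" "set [p'', q''] \<subseteq> {..<n}" "c {p'', q''} = e2"
    by (rule ex_base_edge[of "{}" "[v, p, q, l, l', p', q']" e2]) (use e in auto)
  have [simp]: "c {l, v} = c {v, l}" by (simp add: insert_commute)
  show ?thesis
    by (rule rainbow_copyI[of "[p', q', p'', q'', l, v, p, q, l']"])
       (use 1 2 3 e in \<open>auto simp: twoK2_P4plus_def\<close>)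
qed

text \<open>
  Two leaves and the centre form a triangle. If the edge between the leaves has one of the three
  windmill colors, the other two windmill colors supply the two edges. Otherwise this edge and
  another edge of the star are the two disjoint edges, and the triangle comes from a windmill.
\<close>

lemma rainbow_twoK2_K3: "rainbow_copy c n 7 twoK2_K3"
proof (cases "c {a1, a2} \<in> base")
  case True
  obtain e1 e2 where e: "e1 \<in> base" "e2 \<in> base" "e1 \<noteq> e2" "e1 \<noteq> c {a1, a2}" "e2 \<noteq> c {a1, a2}"
    by (rule two_base_colours)
  obtain p' q' where 2: "p' \<noteq> q'" "set [p', q'] \<inter> ({} \<union> set leaves) = {}" "set [p', q'] \<subseteq> {..<n}" "c {p', q'} = e1"
    by (rule ex_base_edge[of "{}" leaves e1]) (use e in auto)
  obtain p'' q'' where 3: "p'' \<noteq> q''" "set [p'', q''] \<inter> ({} \<union> set (p' # q' # leaves)) = {}" "set [p'', q''] \<subseteq> {..<n}" "c {p'', q''} = e2"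
    by (rule ex_base_edge[of "{}" "p' # q' # leaves" e2]) (use e in auto)
  show ?thesis
    by (rule rainbow_copyI[of "[p', q', p'', q'', v, a1, a2]"])
       (use 2 3 e dist less dcol new True in \<open>auto simp: twoK2_K3_def\<close>)
next
  case False
  have "\<exists>l\<in>{a3, a4}. c {v, l} \<noteq> c {a1, a2}" using dcol by auto
  then obtain l where l: "l \<in> {a3, a4}" "c {v, l} \<noteq> c {a1, a2}" by (elim bexE)
  obtain p q s where 1: "distinct [p, q, s]" "set [p, q, s] \<inter> ({} \<union> set leaves) = {}" "set [p, q, s] \<subseteq> {..<n}"
    "c {p, q} = a" "c {q, s} = g" "c {p, s} = b"
    by (rule ex_base_triangle[of "{}" leaves]) auto
  show ?thesis
    by (rule rainbow_copyI[of "[a1, a2, v, l, p, q, s]"])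
       (use 1 l False[unfolded base_def] dist less dcol new_abg abg in \<open>auto simp: twoK2_K3_def\<close>)
qed

text \<open>
  The path starts in the star, passes the leaf \<open>l\<close> and enters the windmill at \<open>s\<close>. It fails to be
  rainbow only if the edge from \<open>l\<close> to \<open>s\<close> repeats the color of the edge from the centre to \<open>l\<close>.
\<close>

lemma K2_P5_leaf:
  assumes l: "l \<in> {a1, a2}" and s: "distinct [s, s1, s2]" "set [s, s1, s2] \<inter> set leaves = {}" "set [s, s1, s2] \<subseteq> {..<n}"
    and bs: "c {s, s1} \<in> base" "c {s, s2} \<in> base" "c {s, s1} \<noteq> c {s, s2}"
    and ne: "c {l, s} \<noteq> c {v, l}"
  shows "rainbow_copy c n 7 K2_P5"
proof -
  let ?e = "c {l, s}"
  have "\<exists>j\<in>{a3, a4}. c {v, j} \<noteq> ?e" using dcol by auto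
  then obtain j where j: "j \<in> {a3, a4}" "c {v, j} \<noteq> ?e" by (elim bexE)
  have "\<exists>s'\<in>{s1, s2}. c {s, s'} \<noteq> ?e" using bs(3) by auto
  then obtain s' where s': "s' \<in> {s1, s2}" "c {s, s'} \<noteq> ?e" by (elim bexE)
  obtain e where e: "e \<in> base" "e \<noteq> ?e" "e \<noteq> c {s, s'}" by (rule third_base_colour)
  obtain p q where 1: "p \<noteq> q" "set [p, q] \<inter> ({} \<union> set (s # s1 # s2 # leaves)) = {}" "set [p, q] \<subseteq> {..<n}" "c {p, q} = e"
    by (rule ex_base_edge[of "{}" "s # s1 # s2 # leaves" e]) (use e in auto)
  have b': "c {s, s'} \<in> base" using s' bs by auto
  have jl: "c {v, j} \<noteq> c {v, l}" "c {v, j} \<notin> base" "c {v, l} \<notin> base" using j l dcol new by auto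
  have nn: "c {j, v} = c {v, j}" by (simp add: insert_commute)
  show ?thesis
    by (rule rainbow_copyI[of "[p, q, j, v, l, s, s']"])
       (use 1 j l s s' e b' jl ne dist less in \<open>auto simp: K2_P5_def nn\<close>)
qed

text \<open>
  If the previous lemma never applies, two leaves are joined to a windmill in their own colors.
  Then the path runs from the first leaf through the windmill to the second.
\<close>

lemma rainbow_K2_P5: "rainbow_copy c n 7 K2_P5"
proof (rule ccontr)
  assume no: "\<not> ?thesis"
  obtain r x1 y1 x2 y2 where *:
    "distinct [r, x1, y1, x2, y2]" "set [r, x1, y1, x2, y2] \<inter> ({} \<union> set leaves) = {}"
    "set [r, x1, y1, x2, y2] \<subseteq> {..<n}"
    "c {x1, y1} = a" "c {r, x1} = b" "c {r, y1} = g" "c {x2, y2} = a" "c {r, x2} = b" "c {r, y2} = g"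
    by (rule ex_windmill[of "{}" leaves]) auto
  have com: "c {x1, r} = b" "c {y2, x2} = a" "c {y2, r} = g" "c {y2, a2} = c {a2, y2}"
    using * by (simp_all add: insert_commute)
  have "c {a1, x1} = c {v, a1}"
    by (rule ccontr, erule notE[OF no, OF K2_P5_leaf[of a1 x1 y1 r], rotated -1]) (use * com abg in auto)
  moreover have "c {a2, y2} = c {v, a2}"
    by (rule ccontr, erule notE[OF no, OF K2_P5_leaf[of a2 y2 x2 r], rotated -1]) (use * com abg in auto)
  moreover obtain p q where 1: "p \<noteq> q" "set [p, q] \<inter> ({} \<union> set (r # x1 # y2 # leaves)) = {}" "set [p, q] \<subseteq> {..<n}" "c {p, q} = a"
    by (rule ex_base_edge[of "{}" "r # x1 # y2 # leaves" a]) auto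
  ultimately have "rainbow_copy c n 7 K2_P5"
    by (intro rainbow_copyI[of "[p, q, a1, x1, r, y2, a2]"])
       (use * com dist less dcol new_abg abg in \<open>auto simp: K2_P5_def\<close>)
  then show False using no by blast
qed

end

section \<open>A rainbow matching in further colors\<close>

text \<open>
  Nine edges suffice: at most two are used in a construction, a rainbow part outside the rest of
  the matching blocks at most four more by its colors, and three disjoint edges must remain.
\<close>

locale matching_coloring = windmill_coloring +
  fixes M :: "(nat \<times> nat) set"
  assumes finite_M: "finite M" and card_M: "card M = 9"
    and M_edge: "(u, w) \<in> M \<Longrightarrow> u \<noteq> w \<and> u < n \<and> w < n \<and> c {u, w} \<notin> base"
    and M_disjoint: "\<lbrakk>(u, w) \<in> M; (u', w') \<in> M; (u, w) \<noteq> (u', w')\<rbrakk> \<Longrightarrow>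
      {u, w} \<inter> {u', w'} = {} \<and> c {u, w} \<noteq> c {u', w'}"
begin

definition "matched_verts = fst ` M \<union> snd ` M"

lemma matched_verts: "finite matched_verts" "card matched_verts \<le> 18"
proof -
  show "finite matched_verts" using finite_M by (simp add: matched_verts_def)
  have "card matched_verts \<le> card (fst ` M) + card (snd ` M)" unfolding matched_verts_def by (rule card_Un_le)
  also have "\<dots> \<le> card M + card M" using finite_M by (intro add_mono card_image_le)
  finally show "card matched_verts \<le> 18" using card_M by simp
qed

definition matched :: "nat \<Rightarrow> nat \<Rightarrow> bool" where "matched u w \<longleftrightarrow> (u, w) \<in> M \<or> (w, u) \<in> M"

lemma matched_sym: "matched u w \<Longrightarrow> matched w u"
  by (auto simp: matched_def)

lemma matchedD:
  assumes "matched u w"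
  shows "u \<noteq> w" "u < n" "w < n" "u \<in> matched_verts" "w \<in> matched_verts" "c {u, w} \<notin> base" "c {w, u} = c {u, w}"
proof -
  have "u \<noteq> w \<and> u < n \<and> w < n \<and> c {u, w} \<notin> base"
    using assms M_edge[of u w] M_edge[of w u] unfolding matched_def by (auto simp: insert_commute)
  then show "u \<noteq> w" "u < n" "w < n" "c {u, w} \<notin> base" by auto
  show "u \<in> matched_verts" "w \<in> matched_verts" using assms by (force simp: matched_def matched_verts_def)+
  show "c {w, u} = c {u, w}" by (simp add: insert_commute)
qed

text \<open>
  A rainbow subgraph with at most four edges that meets the matching only in the pairs \<open>P\<close> and \<open>P'\<close>
  can be extended by three disjoint matching edges in further colors.
\<close>

lemma further_pairs:
  assumes P: "P \<in> M" "P' \<in> M" and ds: "set ds \<inter> matched_verts \<subseteq> {fst P, snd P, fst P', snd P'}" and cs: "length cs \<le> 4"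
  obtains u1 w1 u2 w2 u3 w3 where "distinct [u1, w1, u2, w2, u3, w3]"
    "set [u1, w1, u2, w2, u3, w3] \<inter> set ds = {}" "set [u1, w1, u2, w2, u3, w3] \<subseteq> {..<n}"
    "distinct [c {u1, w1}, c {u2, w2}, c {u3, w3}]"
    "set [c {u1, w1}, c {u2, w2}, c {u3, w3}] \<inter> set cs = {}"
proof -
  define col where "col p = c {fst p, snd p}" for p
  have inj: "inj_on col M"
  proof (rule inj_onI, rule ccontr)
    fix p q assume "p \<in> M" "q \<in> M" "col p = col q" "p \<noteq> q"
    then show False using M_disjoint[of "fst p" "snd p" "fst q" "snd q"] by (simp add: col_def)
  qed
  define N where "N = {p \<in> M - {P, P'}. col p \<notin> set cs}"
  define N' where "N' = {p \<in> M - {P, P'}. col p \<in> set cs}"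
  have "card N' \<le> card (set cs)"
    by (rule card_inj_on_le[of col]) (use inj in \<open>auto simp: N'_def intro: inj_on_subset\<close>)
  then have "card N' \<le> 4" using cs card_length[of cs] by linarith
  moreover have "card (M - {P, P'}) = card N + card N'"
    using finite_M by (subst card_Un_disjoint[symmetric]) (auto simp: N_def N'_def intro!: arg_cong[of _ _ card])
  moreover have "card M - card {P, P'} \<le> card (M - {P, P'})" by (rule diff_card_le_card_Diff) simp
  moreover have "card {P, P'} \<le> 2" by (cases "P = P'") auto
  ultimately have "3 \<le> card N" using card_M by linarith
  then obtain T where "T \<subseteq> N" "card T = 3" by (meson obtain_subset_with_card_n)
  then obtain x y z where xyz: "x \<in> N" "y \<in> N" "z \<in> N" "x \<noteq> y" "x \<noteq> z" "y \<noteq> z"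
    by (auto simp: card_3_iff)
  obtain u1 w1 u2 w2 u3 w3 where e: "x = (u1, w1)" "y = (u2, w2)" "z = (u3, w3)"
    by (cases x, cases y, cases z)
  have mem: "(u1, w1) \<in> M" "(u2, w2) \<in> M" "(u3, w3) \<in> M" using xyz e by (auto simp: N_def)
  have avoid: "u \<notin> set ds \<and> w \<notin> set ds" if "(u, w) \<in> N" for u w
  proof -
    have uw: "(u, w) \<in> M" "(u, w) \<noteq> P" "(u, w) \<noteq> P'" using that by (auto simp: N_def)
    then have "u \<in> matched_verts" "w \<in> matched_verts" by (force simp: matched_verts_def)+
    moreover have "{u, w} \<inter> {fst P, snd P} = {}" "{u, w} \<inter> {fst P', snd P'} = {}"
      using M_disjoint[of u w "fst P" "snd P"] M_disjoint[of u w "fst P'" "snd P'"] uw P by auto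
    ultimately show ?thesis using ds by blast
  qed
  have D: "{u1, w1} \<inter> {u2, w2} = {}" "{u1, w1} \<inter> {u3, w3} = {}" "{u2, w2} \<inter> {u3, w3} = {}"
    "c {u1, w1} \<noteq> c {u2, w2}" "c {u1, w1} \<noteq> c {u3, w3}" "c {u2, w2} \<noteq> c {u3, w3}"
    using M_disjoint[OF mem(1,2)] M_disjoint[OF mem(1,3)] M_disjoint[OF mem(2,3)] xyz e by auto
  have A: "u1 \<notin> set ds" "w1 \<notin> set ds" "u2 \<notin> set ds" "w2 \<notin> set ds" "u3 \<notin> set ds" "w3 \<notin> set ds"
    using avoid xyz e by auto
  have C: "c {u1, w1} \<notin> set cs" "c {u2, w2} \<notin> set cs" "c {u3, w3} \<notin> set cs"
    using xyz e by (auto simp: N_def col_def)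
  show ?thesis
    by (rule that[of u1 w1 u2 w2 u3 w3])
       (use D A C M_edge[OF mem(1)] M_edge[OF mem(2)] M_edge[OF mem(3)] in auto)
qed

lemma two_pairs:
  obtains P P' where "P \<in> M" "P' \<in> M" "P \<noteq> P'"
proof -
  obtain T where "T \<subseteq> M" "card T = 2" using card_M obtain_subset_with_card_n[of 2 M] by auto
  then show ?thesis using that by (auto simp: card_2_iff)
qed

lemma matched_further:
  assumes m: "matched u w" and ds: "set ds \<inter> matched_verts \<subseteq> {u, w}" and cs: "length cs \<le> 4"
  obtains u1 w1 u2 w2 u3 w3 where "distinct [u1, w1, u2, w2, u3, w3]"
    "set [u1, w1, u2, w2, u3, w3] \<inter> set ds = {}" "set [u1, w1, u2, w2, u3, w3] \<subseteq> {..<n}"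
    "distinct [c {u1, w1}, c {u2, w2}, c {u3, w3}]"
    "set [c {u1, w1}, c {u2, w2}, c {u3, w3}] \<inter> set cs = {}"
proof -
  have "\<exists>P\<in>M. {fst P, snd P} = {u, w}"
    using m unfolding matched_def by (metis fst_conv insert_commute snd_conv)
  then obtain P where "P \<in> M" "{fst P, snd P} = {u, w}" by (elim bexE)
  moreover from this have "set ds \<inter> matched_verts \<subseteq> {fst P, snd P, fst P, snd P}" using ds by auto
  ultimately show ?thesis using further_pairs[of P P ds cs] cs that by blast
qed

lemma rainbow_twoK2_K3: "rainbow_copy c n 7 twoK2_K3"
proof -
  obtain P P' where P: "P \<in> M" "P' \<in> M" "P \<noteq> P'" by (rule two_pairs)
  obtain p q s where 1: "distinct [p, q, s]" "set [p, q, s] \<inter> (matched_verts \<union> set []) = {}" "set [p, q, s] \<subseteq> {..<n}"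
    "c {p, q} = a" "c {q, s} = g" "c {p, s} = b"
    by (rule ex_base_triangle[of matched_verts "[]"]) (use matched_verts in auto)
  obtain u1 w1 u2 w2 u3 w3 where 2: "distinct [u1, w1, u2, w2, u3, w3]"
    "set [u1, w1, u2, w2, u3, w3] \<inter> set [p, q, s] = {}" "set [u1, w1, u2, w2, u3, w3] \<subseteq> {..<n}"
    "distinct [c {u1, w1}, c {u2, w2}, c {u3, w3}]"
    "set [c {u1, w1}, c {u2, w2}, c {u3, w3}] \<inter> set [a, b, g] = {}"
    by (rule further_pairs[OF P(1,2), of "[p, q, s]" "[a, b, g]"]) (use 1 in auto)
  show ?thesis
    by (rule rainbow_copyI[of "[u1, w1, u2, w2, p, q, s]"])
       (use 1 2 abg in \<open>auto simp: twoK2_K3_def\<close>)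
qed

lemma joined_pairs:
  obtains u1 w1 u2 w2 where "matched u1 w1" "matched u2 w2" "(u1, w1) \<in> M" "(u2, w2) \<in> M" "distinct [u1, w1, u2, w2]"
    "c {u1, w1} \<noteq> c {u2, w2}" "c {u1, w1} \<noteq> c {u1, u2}"
proof -
  obtain P P' where P: "P \<in> M" "P' \<in> M" "P \<noteq> P'" by (rule two_pairs)
  obtain u w u' w' where e: "P = (u, w)" "P' = (u', w')" by (cases P, cases P')
  have m: "matched u w" "matched u' w'" using P e by (auto simp: matched_def)
  have D: "{u, w} \<inter> {u', w'} = {}" "c {u, w} \<noteq> c {u', w'}" using M_disjoint[of u w u' w'] P e by auto
  have s: "c {u, u'} = c {u', u}" by (simp add: insert_commute)
  show ?thesis
  proof (cases "c {u, w} = c {u, u'}")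
    case False
    then show ?thesis by (intro that[of u w u' w']) (use m D P e matchedD[OF m(1)] matchedD[OF m(2)] in auto)
  next
    case True
    then show ?thesis by (intro that[of u' w' u w]) (use m D P e s matchedD[OF m(1)] matchedD[OF m(2)] in auto)
  qed
qed

lemma rainbow_K2_2P3: "rainbow_copy c n 8 K2_2P3"
proof -
  obtain u w u' w' where P: "matched u w" "matched u' w'" "(u, w) \<in> M" "(u', w') \<in> M" "distinct [u, w, u', w']"
    "c {u, w} \<noteq> c {u', w'}" "c {u, w} \<noteq> c {u, u'}" by (rule joined_pairs)
  obtain e1 e2 where e: "e1 \<in> base" "e2 \<in> base" "e1 \<noteq> e2" "e1 \<noteq> c {u, u'}" "e2 \<noteq> c {u, u'}"
    by (rule two_base_colours)
  obtain p q s where 1: "distinct [p, q, s]" "set [p, q, s] \<inter> (matched_verts \<union> set []) = {}" "set [p, q, s] \<subseteq> {..<n}"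
    "c {p, q} = e1" "c {q, s} = e2"
    by (rule ex_base_path[of matched_verts "[]" e1 e2]) (use e matched_verts in auto)
  obtain u1 w1 u2 w2 u3 w3 where 2: "distinct [u1, w1, u2, w2, u3, w3]"
    "set [u1, w1, u2, w2, u3, w3] \<inter> set [p, q, s, u, w, u', w'] = {}" "set [u1, w1, u2, w2, u3, w3] \<subseteq> {..<n}"
    "distinct [c {u1, w1}, c {u2, w2}, c {u3, w3}]"
    "set [c {u1, w1}, c {u2, w2}, c {u3, w3}] \<inter> set [e1, e2, c {u, w}, c {u, u'}] = {}"
    by (rule further_pairs[OF P(3,4), of "[p, q, s, u, w, u', w']" "[e1, e2, c {u, w}, c {u, u'}]"]) (use 1 in auto)
  have V: "p \<notin> matched_verts" "q \<notin> matched_verts" "s \<notin> matched_verts" using 1 by auto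
  have V': "{u, w, u', w'} \<inter> {p, q, s} = {}" using V matchedD[OF P(1)] matchedD[OF P(2)] by auto
  have "c {u, w} \<noteq> e1" "c {u, w} \<noteq> e2" using matchedD[OF P(1)] e by auto
  then show ?thesis
    by (intro rainbow_copyI[of "[u1, w1, p, q, s, w, u, u']"])
       (use 1 2 e P V' matchedD(2,3,7)[OF P(1)] matchedD(2,3,7)[OF P(2)] in \<open>auto simp: K2_2P3_def\<close>)
qed

text \<open>
  If the edge between the two matching edges has a windmill color, it joins them to a rainbow path
  on four vertices. Otherwise it forms with one of them a rainbow path that uses no windmill
  color, and a windmill contains the path on four vertices.
\<close>

lemma rainbow_P3_P4: "rainbow_copy c n 7 P3_P4"
proof -
  obtain u w u' w' where P: "matched u w" "matched u' w'" "(u, w) \<in> M" "(u', w') \<in> M" "distinct [u, w, u', w']"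
    "c {u, w} \<noteq> c {u', w'}" "c {u, w} \<noteq> c {u, u'}" by (rule joined_pairs)
  note m = matchedD[OF P(1)] matchedD[OF P(2)]
  show ?thesis
  proof (cases "c {u, u'} \<in> base")
    case True
    obtain e1 e2 where e: "e1 \<in> base" "e2 \<in> base" "e1 \<noteq> e2" "e1 \<noteq> c {u, u'}" "e2 \<noteq> c {u, u'}"
      by (rule two_base_colours)
    obtain p q s where 1: "distinct [p, q, s]" "set [p, q, s] \<inter> (matched_verts \<union> set []) = {}" "set [p, q, s] \<subseteq> {..<n}"
      "c {p, q} = e1" "c {q, s} = e2"
      by (rule ex_base_path[of matched_verts "[]" e1 e2]) (use e matched_verts in auto)
    have "c {u, w} \<noteq> e1" "c {u, w} \<noteq> e2" "c {u', w'} \<noteq> e1" "c {u', w'} \<noteq> e2" "c {u', w'} \<noteq> c {u, u'}"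
      using m e True by auto
    then show ?thesis
      by (intro rainbow_copyI[of "[p, q, s, w, u, u', w']"]) (use 1 P m e in \<open>auto simp: P3_P4_def\<close>)
  next
    case False
    obtain p q s t where 1: "distinct [p, q, s, t]" "set [p, q, s, t] \<inter> (matched_verts \<union> set []) = {}" "set [p, q, s, t] \<subseteq> {..<n}"
      "c {p, q} = a" "c {q, s} = g" "c {s, t} = b"
      by (rule ex_base_P4[of matched_verts "[]"]) (use matched_verts in auto)
    have V: "p \<notin> matched_verts" "q \<notin> matched_verts" "s \<notin> matched_verts" "t \<notin> matched_verts" using 1 by auto
    have V': "{u, w, u'} \<inter> {p, q, s, t} = {}" using V m by auto
    have "{c {u, w}, c {u, u'}} \<inter> {a, b, g} = {}" using m False by (auto simp: base_def)
    then show ?thesis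
      by (intro rainbow_copyI[of "[w, u, u', p, q, s, t]"])
         (use 1 P V' m(2,3,7,8) m(9) abg in \<open>auto simp: P3_P4_def\<close>)
  qed
qed

definition windmill_at :: "nat \<Rightarrow> nat \<Rightarrow> nat \<Rightarrow> nat \<Rightarrow> nat \<Rightarrow> bool" where
  "windmill_at r x1 y1 x2 y2 \<longleftrightarrow> distinct [r, x1, y1, x2, y2] \<and> set [r, x1, y1, x2, y2] \<inter> matched_verts = {} \<and>
     set [r, x1, y1, x2, y2] \<subseteq> {..<n} \<and> c {x1, y1} = a \<and> c {r, x1} = b \<and> c {r, y1} = g \<and>
     c {x2, y2} = a \<and> c {r, x2} = b \<and> c {r, y2} = g"

lemma ex_windmill_at: obtains r x1 y1 x2 y2 where "windmill_at r x1 y1 x2 y2"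
proof -
  obtain r x1 y1 x2 y2 where
    "distinct [r, x1, y1, x2, y2]" "set [r, x1, y1, x2, y2] \<inter> (matched_verts \<union> set []) = {}"
    "set [r, x1, y1, x2, y2] \<subseteq> {..<n}"
    "c {x1, y1} = a" "c {r, x1} = b" "c {r, y1} = g" "c {x2, y2} = a" "c {r, x2} = b" "c {r, y2} = g"
    by (rule ex_windmill[of matched_verts "[]"]) (use matched_verts in auto)
  then show ?thesis by (intro that[of r x1 y1 x2 y2]) (simp add: windmill_at_def)
qed

lemma windmill_at_swap: "windmill_at r x1 y1 x2 y2 \<Longrightarrow> windmill_at r x2 y2 x1 y1"
  by (auto simp: windmill_at_def)

lemma windmill_at_facts:
  assumes "windmill_at r x1 y1 x2 y2" "matched u w"
  shows "distinct [r, x1, y1, x2, y2, u, w]" "distinct [w, u, y2, x2, y1, x1, r]" "set [r, x1, y1, x2, y2] \<inter> matched_verts = {}"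
    "r < n" "x1 < n" "y1 < n" "x2 < n" "y2 < n" "u < n" "w < n"
    "c {x1, y1} = a" "c {y1, x1} = a" "c {x2, y2} = a" "c {y2, x2} = a"
    "c {r, x1} = b" "c {x1, r} = b" "c {r, x2} = b" "c {x2, r} = b"
    "c {r, y1} = g" "c {y1, r} = g" "c {r, y2} = g" "c {y2, r} = g"
    "c {u, w} \<noteq> a" "c {u, w} \<noteq> b" "c {u, w} \<noteq> g" "a \<noteq> c {u, w}" "b \<noteq> c {u, w}" "g \<noteq> c {u, w}"
    "c {w, u} = c {u, w}" "c {r, u} = c {u, r}" "c {x1, u} = c {u, x1}" "c {y1, u} = c {u, y1}"
    "c {x2, u} = c {u, x2}" "c {y2, u} = c {u, y2}"
proof -
  show "distinct [r, x1, y1, x2, y2, u, w]" "distinct [w, u, y2, x2, y1, x1, r]" "set [r, x1, y1, x2, y2] \<inter> matched_verts = {}"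
    using assms(1) matchedD[OF assms(2)] unfolding windmill_at_def by auto
  show "c {u, w} \<noteq> a" "c {u, w} \<noteq> b" "c {u, w} \<noteq> g" "a \<noteq> c {u, w}" "b \<noteq> c {u, w}" "g \<noteq> c {u, w}"
    using matchedD(6)[OF assms(2)] by (auto simp: base_def)
qed (use assms(1) matchedD[OF assms(2)] in \<open>simp_all add: windmill_at_def insert_commute\<close>)

lemma K2_P5I:
  assumes m: "matched u w" and d: "distinct [p, q, s, t, z]" "\<forall>v\<in>set [p, q, s, t, z]. v \<in> matched_verts \<longrightarrow> v = u \<or> v = w" "set [p, q, s, t, z] \<subseteq> {..<n}"
    and col: "distinct [c {p, q}, c {q, s}, c {s, t}, c {t, z}]"
  shows "rainbow_copy c n 7 K2_P5"
proof -
  obtain u1 w1 u2 w2 u3 w3 where 2: "distinct [u1, w1, u2, w2, u3, w3]"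
    "set [u1, w1, u2, w2, u3, w3] \<inter> set [p, q, s, t, z] = {}" "set [u1, w1, u2, w2, u3, w3] \<subseteq> {..<n}"
    "distinct [c {u1, w1}, c {u2, w2}, c {u3, w3}]"
    "set [c {u1, w1}, c {u2, w2}, c {u3, w3}] \<inter> set [c {p, q}, c {q, s}, c {s, t}, c {t, z}] = {}"
    by (rule matched_further[OF m, of "[p, q, s, t, z]" "[c {p, q}, c {q, s}, c {s, t}, c {t, z}]"]) (use d(2) in auto)
  show ?thesis
    by (rule rainbow_copyI[of "[u1, w1, p, q, s, t, z]"])
       (use d(1,3) col 2 in \<open>auto simp: K2_P5_def\<close>)
qed

text \<open>
  A path can enter the windmill from \<open>u\<close> at \<open>x1\<close> or \<open>y1\<close> and continue inside it, where a path on four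
  vertices in the three colors starts at every vertex other than the centre. This excludes all
  colors but one for the entering edge.
\<close>

lemma P5_forced:
  assumes no: "\<not> rainbow_copy c n 7 K2_P5" and w: "windmill_at r x1 y1 x2 y2" and m: "matched u w"
  shows "c {u, x1} = g" "c {u, y1} = b"
proof -
  note W = windmill_at_facts(1-3)[OF w m, simplified] windmill_at_facts(4-)[OF w m]
  note I = K2_P5I[OF m]
  have "c {u, x1} \<in> {a, b, g}"
  proof (rule ccontr)
    assume "c {u, x1} \<notin> {a, b, g}"
    then have ne: "c {u, x1} \<noteq> a" "c {u, x1} \<noteq> b" "c {u, x1} \<noteq> g" "a \<noteq> c {u, x1}" "b \<noteq> c {u, x1}" "g \<noteq> c {u, x1}" by auto
    show False using no I[of u x1 y1 r x2] by (simp add: W abg abg[symmetric] ne)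
  qed
  moreover have "c {u, x1} \<noteq> a"
    using no I[of w u x1 r y2] by (intro notI) (simp add: W abg abg[symmetric])
  moreover have "c {u, x1} \<noteq> b"
    using no I[of w u x1 y1 r] by (intro notI) (simp add: W abg abg[symmetric])
  ultimately show "c {u, x1} = g" by blast
  have "c {u, y1} \<in> {a, b, g}"
  proof (rule ccontr)
    assume "c {u, y1} \<notin> {a, b, g}"
    then have ne: "c {u, y1} \<noteq> a" "c {u, y1} \<noteq> b" "c {u, y1} \<noteq> g" "a \<noteq> c {u, y1}" "b \<noteq> c {u, y1}" "g \<noteq> c {u, y1}" by auto
    show False using no I[of u y1 x1 r y2] by (simp add: W abg abg[symmetric] ne)
  qed
  moreover have "c {u, y1} \<noteq> a"
    using no I[of w u y1 r x2] by (intro notI) (simp add: W abg abg[symmetric])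
  moreover have "c {u, y1} \<noteq> g"
    using no I[of w u y1 x1 r] by (intro notI) (simp add: W abg abg[symmetric])
  ultimately show "c {u, y1} = b" by blast
qed

text \<open>
  Once the colors are forced at both ends of a matching edge, a path through this edge is rainbow.
\<close>

lemma rainbow_K2_P5: "rainbow_copy c n 7 K2_P5"
proof (rule ccontr)
  assume no: "\<not> ?thesis"
  obtain r x1 y1 x2 y2 where w: "windmill_at r x1 y1 x2 y2" by (rule ex_windmill_at)
  obtain u v where m: "matched u v" by (rule joined_pairs)
  have "c {u, x2} = g" using P5_forced(1)[OF no windmill_at_swap[OF w] m] .
  moreover have "c {v, y1} = b" using P5_forced(2)[OF no w matched_sym[OF m]] .
  ultimately show False
    using no K2_P5I[OF m, of x2 u v y1 x1] by (simp add: windmill_at_facts(1-3)[OF w m, simplified] windmill_at_facts(4-)[OF w m] abg abg[symmetric])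
qed

text \<open>
  Both graphs arise from a rainbow copy of the tree \<open>P4_plus\<close>, which contains \<open>star_graph 3\<close>,
  by adding matching edges.
\<close>

definition spider_copies :: bool where
  "spider_copies \<longleftrightarrow> rainbow_copy c n 9 twoK2_P4plus \<and> rainbow_copy c n 10 threeK2_K13"

lemma spider_copiesI:
  assumes m: "matched u w" and d: "distinct [z, p, q, s, t]" "\<forall>v\<in>set [z, p, q, s, t]. v \<in> matched_verts \<longrightarrow> v = u \<or> v = w" "set [z, p, q, s, t] \<subseteq> {..<n}"
    and col: "distinct [c {z, p}, c {z, q}, c {z, s}, c {s, t}]"
  shows "spider_copies"
proof -
  obtain u1 w1 u2 w2 u3 w3 where 2: "distinct [u1, w1, u2, w2, u3, w3]"
    "set [u1, w1, u2, w2, u3, w3] \<inter> set [z, p, q, s, t] = {}" "set [u1, w1, u2, w2, u3, w3] \<subseteq> {..<n}"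
    "distinct [c {u1, w1}, c {u2, w2}, c {u3, w3}]"
    "set [c {u1, w1}, c {u2, w2}, c {u3, w3}] \<inter> set [c {z, p}, c {z, q}, c {z, s}, c {s, t}] = {}"
    by (rule matched_further[OF m, of "[z, p, q, s, t]" "[c {z, p}, c {z, q}, c {z, s}, c {s, t}]"]) (use d(2) in auto)
  have sym: "c {p, z} = c {z, p}" by (simp add: insert_commute)
  have "rainbow_copy c n 9 twoK2_P4plus"
    by (rule rainbow_copyI[of "[u1, w1, u2, w2, p, z, s, t, q]"])
       (use d(1,3) col 2 sym in \<open>auto simp: twoK2_P4plus_def\<close>)
  moreover have "rainbow_copy c n 10 threeK2_K13"
    by (rule rainbow_copyI[of "[u1, w1, u2, w2, u3, w3, z, p, q, s]"])
       (use d(1,3) col 2 in \<open>auto simp: threeK2_K13_def\<close>)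
  ultimately show ?thesis by (simp add: spider_copies_def)
qed

text \<open>
  Most colors for the edges from \<open>u\<close> to a windmill complete a star in the windmill to a copy of
  \<open>P4_plus\<close>, using the matching edge \<open>uw\<close> or the second triangle for the longest leg.
\<close>

lemma spider_forced:
  assumes no: "\<not> spider_copies" and w: "windmill_at r x1 y1 x2 y2" and m: "matched u w"
  shows "c {u, x1} \<in> {a, b}" "c {u, y1} \<in> {a, g}" "c {u, r} \<in> {b, g}"
proof -
  note W = windmill_at_facts(1-3)[OF w m, simplified] windmill_at_facts(4-)[OF w m]
  note I = spider_copiesI[OF m]
  have "c {u, x1} \<in> {a, b, g}"
  proof (rule ccontr)
    assume "c {u, x1} \<notin> {a, b, g}"
    then have ne: "c {u, x1} \<noteq> a" "c {u, x1} \<noteq> b" "c {u, x1} \<noteq> g" "a \<noteq> c {u, x1}" "b \<noteq> c {u, x1}" "g \<noteq> c {u, x1}" by auto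
    show False using no I[of x1 y1 u r y2] by (simp add: W abg abg[symmetric] ne)
  qed
  moreover have "c {u, x1} \<noteq> g"
    using no I[of x1 y1 r u w] by (intro notI) (simp add: W abg abg[symmetric])
  ultimately show "c {u, x1} \<in> {a, b}" by blast
  have "c {u, y1} \<in> {a, b, g}"
  proof (rule ccontr)
    assume "c {u, y1} \<notin> {a, b, g}"
    then have ne: "c {u, y1} \<noteq> a" "c {u, y1} \<noteq> b" "c {u, y1} \<noteq> g" "a \<noteq> c {u, y1}" "b \<noteq> c {u, y1}" "g \<noteq> c {u, y1}" by auto
    show False using no I[of y1 x1 u r x2] by (simp add: W abg abg[symmetric] ne)
  qed
  moreover have "c {u, y1} \<noteq> b"
    using no I[of y1 x1 r u w] by (intro notI) (simp add: W abg abg[symmetric])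
  ultimately show "c {u, y1} \<in> {a, g}" by blast
  have "c {u, r} \<in> {a, b, g}"
  proof (rule ccontr)
    assume "c {u, r} \<notin> {a, b, g}"
    then have ne: "c {u, r} \<noteq> a" "c {u, r} \<noteq> b" "c {u, r} \<noteq> g" "a \<noteq> c {u, r}" "b \<noteq> c {u, r}" "g \<noteq> c {u, r}" by auto
    show False using no I[of r y2 u x1 y1] by (simp add: W abg abg[symmetric] ne)
  qed
  moreover have "c {u, r} \<noteq> a"
    using no I[of r x1 y2 u w] by (intro notI) (simp add: W abg abg[symmetric])
  ultimately show "c {u, r} \<in> {b, g}" by blast
qed

lemma spider_copies: "spider_copies"
proof (rule ccontr)
  assume no: "\<not> ?thesis"
  obtain r x1 y1 x2 y2 where w: "windmill_at r x1 y1 x2 y2" by (rule ex_windmill_at)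
  obtain u v where m: "matched u v" by (rule joined_pairs)
  note W = windmill_at_facts(1-3)[OF w m, simplified] windmill_at_facts(4-)[OF w m]
  note I = spider_copiesI[OF m]
  have x: "c {u, x1} \<in> {a, b}" "c {u, r} \<in> {b, g}" using spider_forced[OF no w m] by auto
  have y: "c {u, y2} \<in> {a, g}" using spider_forced[OF no windmill_at_swap[OF w] m] by auto
  \<comment> \<open>The vertices \<open>x1\<close> and \<open>y2\<close> belong to different triangles, so both are available as neighbours of \<open>u\<close>
    next to the third windmill color.\<close>
  have "\<not> (c {u, x1} = a \<and> c {u, y2} = g)"
    using no I[of u v y2 x1 r] by (intro notI) (simp add: W abg abg[symmetric])
  moreover have "\<not> (c {u, x1} = b \<and> c {u, y2} = g)"
    using no I[of u v y2 x1 y1] by (intro notI) (simp add: W abg abg[symmetric])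
  moreover have "\<not> (c {u, x1} = b \<and> c {u, y2} = a)"
    using no I[of u v x1 y2 r] by (intro notI) (simp add: W abg abg[symmetric])
  ultimately have a: "c {u, x1} = a" using x(1) y by auto
  have "c {u, r} \<noteq> b"
    using no I[of u v x1 r y2] by (intro notI) (simp add: W abg abg[symmetric] a)
  moreover have "c {u, r} \<noteq> g"
    using no I[of u v x1 r x2] by (intro notI) (simp add: W abg abg[symmetric] a)
  ultimately show False using x(2) by blast
qed

end

section \<open>Star or matching\<close>

text \<open>
  Greedy choice: an edge meets at most \<open>2d\<close> edges, itself included.
\<close>

lemma disjoint_edges_of_bounded_degree:
  assumes "finite E" "\<And>e. e \<in> E \<Longrightarrow> card e = 2" "\<And>v. card {e \<in> E. v \<in> e} \<le> d" "2 * d * k \<le> card E" "0 < d"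
  shows "\<exists>F\<subseteq>E. card F = k \<and> (\<forall>e\<in>F. \<forall>e'\<in>F. e \<noteq> e' \<longrightarrow> e \<inter> e' = {})"
  using assms
proof (induction k arbitrary: E)
  case 0
  then show ?case by (intro exI[of _ "{}"]) auto
next
  case (Suc k)
  then have "E \<noteq> {}" by auto
  then obtain e where e: "e \<in> E" by blast
  then obtain x y where xy: "e = {x, y}" using Suc.prems(2) by (metis card_2_iff)
  define E' where "E' = E - {e' \<in> E. e' \<inter> e \<noteq> {}}"
  have "{e' \<in> E. e' \<inter> e \<noteq> {}} \<subseteq> {e' \<in> E. x \<in> e'} \<union> {e' \<in> E. y \<in> e'}" using xy by auto
  then have "card {e' \<in> E. e' \<inter> e \<noteq> {}} \<le> card ({e' \<in> E. x \<in> e'} \<union> {e' \<in> E. y \<in> e'})"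
    using Suc.prems(1) by (intro card_mono) auto
  also have "\<dots> \<le> card {e' \<in> E. x \<in> e'} + card {e' \<in> E. y \<in> e'}" by (rule card_Un_le)
  also have "\<dots> \<le> d + d" using Suc.prems(3) by (intro add_mono)
  finally have removed: "card {e' \<in> E. e' \<inter> e \<noteq> {}} \<le> 2 * d" by simp
  have "card E' = card E - card {e' \<in> E. e' \<inter> e \<noteq> {}}"
    unfolding E'_def using Suc.prems(1) by (intro card_Diff_subset) auto
  then have "2 * d * k \<le> card E'" using removed Suc.prems(4) by (simp add: algebra_simps)
  moreover have "card {e \<in> E'. v \<in> e} \<le> d" for v
  proof -
    have "card {e \<in> E'. v \<in> e} \<le> card {e \<in> E. v \<in> e}"
      using Suc.prems(1) by (intro card_mono) (auto simp: E'_def)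
    then show ?thesis using Suc.prems(3)[of v] by linarith
  qed
  moreover have "finite E'" "\<And>e. e \<in> E' \<Longrightarrow> card e = 2" using Suc.prems(1,2) by (auto simp: E'_def)
  ultimately obtain F where F: "F \<subseteq> E'" "card F = k" "\<forall>e\<in>F. \<forall>e'\<in>F. e \<noteq> e' \<longrightarrow> e \<inter> e' = {}"
    using Suc.IH[of E'] Suc.prems(5) by blast
  have eF: "e \<notin> F" "\<forall>e'\<in>F. e' \<inter> e = {}" using F(1) e xy by (auto simp: E'_def)
  have "finite F" using F(1) \<open>finite E'\<close> finite_subset by blast
  then have "card (insert e F) = Suc k" using eF F(2) by simp
  moreover have "\<forall>f\<in>insert e F. \<forall>f'\<in>insert e F. f \<noteq> f' \<longrightarrow> f \<inter> f' = {}" using F(3) eF by blast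
  moreover have "insert e F \<subseteq> E" using F(1) e by (auto simp: E'_def)
  ultimately show ?case by blast
qed

lemma list_of_card:
  assumes "card A = k" "0 < k"
  obtains xs where "distinct xs" "set xs = A" "length xs = k"
proof -
  have "finite A" using assms card_gt_0_iff by metis
  then obtain xs where "distinct xs" "set xs = A" using finite_distinct_list by blast
  then show ?thesis using that assms(1) distinct_card by metis
qed

text \<open>
  One edge is chosen for each color outside the windmill colors. With 72 edges, degrees at most 4
  leave nine disjoint ones, as \<open>72 = 2 * 4 * 9\<close>; otherwise there is a star with five edges.
\<close>

lemma (in windmill_coloring) rainbow_copies_of_maximal:
  assumes all: "coloring_using_all n m c" and m: "75 \<le> m"
  shows "rainbow_copy c n 7 P3_P4 \<and> rainbow_copy c n 7 K2_P5 \<and> rainbow_copy c n 8 K2_2P3 \<and>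
    rainbow_copy c n 7 twoK2_K3 \<and> rainbow_copy c n 9 twoK2_P4plus \<and> rainbow_copy c n 10 threeK2_K13"
proof -
  define K where "K = {1..m} - base"
  have "card base = 3" using abg by (simp add: base_def)
  then have cK: "72 \<le> card K" using m diff_card_le_card_Diff[of base "{1..m}"] by (simp add: K_def base_def)
  have "\<forall>k. \<exists>e. k \<in> K \<longrightarrow> e \<in> edges (complete_graph n) \<and> c e = k"
    using all unfolding coloring_using_all_def K_def by (metis DiffD1 imageE)
  then obtain h where h: "\<And>k. k \<in> K \<Longrightarrow> h k \<in> edges (complete_graph n) \<and> c (h k) = k" by metis
  define E where "E = h ` K"
  have inj: "inj_on c E" using h by (auto simp: E_def inj_on_def)
  have cE: "card E = card K" unfolding E_def by (rule card_image, rule inj_onI) (metis h)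
  have finE: "finite E" by (simp add: E_def K_def)
  have edge: "card e = 2 \<and> e \<subseteq> {..<n}" if "e \<in> E" for e
    using that h by (auto simp: E_def complete_graph_def)
  have new: "c e \<notin> base" if "e \<in> E" for e using that h by (auto simp: E_def K_def)
  show ?thesis
  proof (cases "\<exists>v. 4 < card {e \<in> E. v \<in> e}")
    case True
    then obtain v where v: "4 < card {e \<in> E. v \<in> e}" by blast
    then have "5 \<le> card {e \<in> E. v \<in> e}" by simp
    then obtain F where F: "F \<subseteq> {e \<in> E. v \<in> e}" "card F = 5"
      by (meson obtain_subset_with_card_n)
    then obtain fs where fs: "distinct fs" "set fs = F" "length fs = 5" using list_of_card[of F 5] by auto
    have "\<exists>x. f = {v, x} \<and> x \<noteq> v" if "f \<in> F" for f
    proof -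
      have "card f = 2" "v \<in> f" using that F(1) edge by auto
      then show ?thesis by (auto simp: card_2_iff doubleton_eq_iff)
    qed
    then obtain l where l: "\<And>f. f \<in> F \<Longrightarrow> f = {v, l f} \<and> l f \<noteq> v" by metis
    obtain f1 f2 f3 f4 f5 where fl: "fs = [f1, f2, f3, f4, f5]"
      using fs(3) by (auto simp: length_Suc_conv eval_nat_numeral)
    have inF: "f1 \<in> F" "f2 \<in> F" "f3 \<in> F" "f4 \<in> F" "f5 \<in> F" using fs(2) fl by auto
    have col: "distinct (map c fs)" using fs(1,2) F(1) inj by (auto simp: distinct_map intro: inj_on_subset)
    have dl: "distinct (map l fs)"
    proof -
      have "inj_on l F" by (rule inj_onI) (metis l)
      then show ?thesis using fs(1,2) by (simp add: distinct_map)
    qed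
    have cv: "c {v, l f} = c f" if "f \<in> F" for f using l[OF that] by metis
    interpret star_coloring c n a b g v "l f1" "l f2" "l f3" "l f4" "l f5"
    proof unfold_locales
      show "distinct [v, l f1, l f2, l f3, l f4, l f5]" using dl l inF by (auto simp: fl)
      have "{v, l f} \<subseteq> {..<n}" if "f \<in> F" for f using l[OF that] edge F(1) that by (metis (no_types, lifting) mem_Collect_eq subsetD)
      then show "set [v, l f1, l f2, l f3, l f4, l f5] \<subseteq> {..<n}" using inF by auto
      show "distinct [c {v, l f1}, c {v, l f2}, c {v, l f3}, c {v, l f4}, c {v, l f5}]"
        using col inF by (simp add: fl cv)
      show "set [c {v, l f1}, c {v, l f2}, c {v, l f3}, c {v, l f4}, c {v, l f5}] \<inter> base = {}"
        using inF F(1) new by (auto simp: cv)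
    qed
    show ?thesis using rainbow_P3_P4 rainbow_K2_P5 rainbow_K2_2P3 rainbow_twoK2_K3 rainbow_twoK2_P4plus rainbow_threeK2_K13 by blast
  next
    case False
    then have "\<exists>F\<subseteq>E. card F = 9 \<and> (\<forall>e\<in>F. \<forall>e'\<in>F. e \<noteq> e' \<longrightarrow> e \<inter> e' = {})"
      using edge cE cK by (intro disjoint_edges_of_bounded_degree[of E 4]) (auto simp: finE not_less)
    then obtain F where F: "F \<subseteq> E" "card F = 9" "\<forall>e\<in>F. \<forall>e'\<in>F. e \<noteq> e' \<longrightarrow> e \<inter> e' = {}" by blast
    have "\<forall>f. \<exists>p. f \<in> F \<longrightarrow> f = {fst p, snd p} \<and> fst p \<noteq> snd p"
    proof
      fix f show "\<exists>p. f \<in> F \<longrightarrow> f = {fst p, snd p} \<and> fst p \<noteq> snd p"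
      proof (cases "f \<in> F")
        case True
        then obtain x y where "f = {x, y}" "x \<noteq> y" using edge F(1) by (metis card_2_iff subsetD)
        then show ?thesis by (intro exI[of _ "(x, y)"]) auto
      qed simp
    qed
    then obtain h' where h': "\<And>f. f \<in> F \<Longrightarrow> f = {fst (h' f), snd (h' f)} \<and> fst (h' f) \<noteq> snd (h' f)" by metis
    have finF: "finite F" using F(1) finE finite_subset by blast
    interpret matching_coloring c n a b g "h' ` F"
    proof unfold_locales
      have "inj_on h' F" by (rule inj_onI) (metis h')
      then show "card (h' ` F) = 9" using F(2) by (simp add: card_image)
      show "finite (h' ` F)" using finF by simp
      have *: "{u, w} \<in> F \<and> u \<noteq> w \<and> h' {u, w} = (u, w)" if uw: "(u, w) \<in> h' ` F" for u w
      proof -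
        obtain f where f: "f \<in> F" "(u, w) = h' f" using uw by blast
        then have "f = {u, w}" "u \<noteq> w" using h'[OF f(1)] by (metis fst_conv snd_conv)+
        then show ?thesis using f by simp
      qed
      show "u \<noteq> w \<and> u < n \<and> w < n \<and> c {u, w} \<notin> base" if "(u, w) \<in> h' ` F" for u w
      proof -
        have "{u, w} \<in> E" "u \<noteq> w" using *[OF that] F(1) by auto
        then show ?thesis using edge[of "{u, w}"] new[of "{u, w}"] by auto
      qed
      show "{u, w} \<inter> {u', w'} = {} \<and> c {u, w} \<noteq> c {u', w'}"
        if "(u, w) \<in> h' ` F" "(u', w') \<in> h' ` F" "(u, w) \<noteq> (u', w')" for u w u' w'
      proof -
        have mem: "{u, w} \<in> F" "{u', w'} \<in> F" using *[OF that(1)] *[OF that(2)] by simp_all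
        have ne: "{u, w} \<noteq> {u', w'}"
        proof
          assume eq: "{u, w} = {u', w'}"
          have "h' {u, w} = (u, w)" "h' {u', w'} = (u', w')" using *[OF that(1)] *[OF that(2)] by simp_all
          then show False using that(3) unfolding eq by simp
        qed
        have "{u, w} \<inter> {u', w'} = {}" using F(3)[rule_format, OF mem ne] .
        moreover have "{u, w} \<in> E" "{u', w'} \<in> E" using mem F(1) by auto
        then have "c {u, w} \<noteq> c {u', w'}" using inj_onD[OF inj, of "{u, w}" "{u', w'}"] ne by argo
        ultimately show ?thesis by (rule conjI)
      qed
    qed
    show ?thesis using rainbow_P3_P4 rainbow_K2_P5 rainbow_K2_2P3 rainbow_twoK2_K3 spider_copies unfolding spider_copies_def by blast
  qed
qed

section \<open>Sufficiency\<close>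

lemma rainbow_copy_imp_not_free:
  assumes H: "simple_graph H" and emb: "isomorphic_to_subgraph H (list_graph r L)"
    and L: "list_edges r L" and copy: "rainbow_copy c n r L"
  shows "\<not> rainbow_free n c H"
proof -
  obtain \<phi> where \<phi>: "inj_on \<phi> (verts H)" "\<phi> ` verts H \<subseteq> {..<r}"
      "\<And>e. e \<in> edges H \<Longrightarrow> \<phi> ` e \<in> (\<lambda>(i, j). {i, j}) ` set L"
    using emb unfolding isomorphic_to_subgraph_iff[OF H] list_graph_def by auto
  obtain xs where xs: "length xs = r" "distinct xs" "set xs \<subseteq> {..<n}"
      "distinct (map (\<lambda>(i, j). c {xs ! i, xs ! j}) L)"
    using copy unfolding rainbow_copy_def by blast
  define \<psi> where "\<psi> v = xs ! \<phi> v" for v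
  have inj: "inj_on \<psi> (verts H)"
    unfolding \<psi>_def using \<phi>(1,2) xs(1,2)
    by (auto simp: inj_on_def nth_eq_iff_index_eq image_subset_iff)
  have sub: "\<psi> ` verts H \<subseteq> {..<n}"
    unfolding \<psi>_def using \<phi>(2) xs(1,3) by (auto simp: image_subset_iff subset_iff)
  define G where "G = Graph (\<psi> ` verts H) ((`) \<psi> ` edges H)"
  have e2: "card (\<psi> ` e) = 2 \<and> \<psi> ` e \<subseteq> \<psi> ` verts H" if "e \<in> edges H" for e
  proof -
    have "card e = 2" "e \<subseteq> verts H" using H that by (auto simp: simple_graph_def)
    then show ?thesis using inj by (metis card_image image_mono inj_on_subset)
  qed
  have "subgraph G (complete_graph n)"
    using H sub e2 by (auto simp: G_def subgraph_def simple_graph_def complete_graph_def) blast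
  moreover have "isomorphic H G" using inj by (auto simp: G_def isomorphic_def bij_betw_def)
  moreover have "rainbow c G"
    unfolding rainbow_def
  proof (rule inj_onI)
    fix f f' assume f: "f \<in> edges G" "f' \<in> edges G" "c f = c f'"
    have form: "\<exists>p\<in>set L. f = {xs ! fst p, xs ! snd p}" if "f \<in> edges G" for f
    proof -
      have "f \<in> (`) \<psi> ` edges H" using that by (simp add: G_def)
      then obtain e where e: "f = \<psi> ` e" "e \<in> edges H" by (rule imageE)
      obtain p where p: "p \<in> set L" "\<phi> ` e = {fst p, snd p}" using \<phi>(3)[OF e(2)] by auto
      have "f = (!) xs ` (\<phi> ` e)" using e(1) by (auto simp: \<psi>_def)
      then have "f = {xs ! fst p, xs ! snd p}" using p(2) by simp
      then show ?thesis using p(1) by (intro bexI)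
    qed
    obtain p where p: "p \<in> set L" "f = {xs ! fst p, xs ! snd p}" using form[OF f(1)] by (elim bexE)
    obtain p' where p': "p' \<in> set L" "f' = {xs ! fst p', xs ! snd p'}" using form[OF f(2)] by (elim bexE)
    have I: "inj_on (\<lambda>(i, j). c {xs ! i, xs ! j}) (set L)" using xs(4) by (simp add: distinct_map)
    have "p = p'" by (rule inj_onD[OF I _ p(1) p'(1)]) (use f(3) p(2) p'(2) in \<open>simp add: case_prod_beta\<close>)
    then show "f = f'" using p(2) p'(2) by simp
  qed
  ultimately show ?thesis unfolding rainbow_free_def by blast
qed

definition maximal_lists :: "(nat \<times> (nat \<times> nat) list) set" where
  "maximal_lists = {(7, P3_P4), (7, K2_P5), (8, K2_2P3), (7, twoK2_K3), (9, twoK2_P4plus), (10, threeK2_K13)}"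

lemma maximal_lists_edges: "(r, L) \<in> maximal_lists \<Longrightarrow> list_edges r L"
  by (auto simp: maximal_lists_def list_edges_def maximal_defs)

text \<open>
  The bound on \<open>m\<close> does not depend on \<open>k\<close>; only \<open>f\<close> and the bound on \<open>n\<close> do.
\<close>

theorem maximal_lists_sufficient:
  assumes H: "simple_graph H" "\<not> connected_graph H" "graph_order H \<ge> 3" "no_isolated_vertices H"
    and rL: "(r, L) \<in> maximal_lists" and emb: "isomorphic_to_subgraph H (list_graph r L)"
  shows "H \<in> ASMS_graphs"
proof -
  have "\<exists>n0 f. \<forall>n\<ge>n0. \<forall>c. coloring_using_all n m c \<and> rainbow_free n c H \<longrightarrow> has_ASMS k f n c"
    if m: "75 \<le> m" for m k
  proof -
    obtain f N where fN: "\<And>n (c :: coloring). \<lbrakk>n \<ge> N; \<forall>u<n. \<forall>v<n. u \<noteq> v \<longrightarrow> c {u, v} \<in> {1..m};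
        \<not> has_ASMS k f n c\<rbrakk> \<Longrightarrow> \<exists>a b g. a \<noteq> b \<and> a \<noteq> g \<and> b \<noteq> g \<and> windmills c {..<n} a b g 40"
      using no_ASMS_imp_windmills[of m k 40] by blast
    have "has_ASMS k f n c" if n: "n \<ge> N" and c: "coloring_using_all n m c" "rainbow_free n c H" for n c
    proof (rule ccontr)
      assume no: "\<not> has_ASMS k f n c"
      have "c {u, v} \<in> {1..m}" if "u < n" "v < n" "u \<noteq> v" for u v
      proof -
        have "{u, v} \<in> edges (complete_graph n)" using that by (simp add: complete_graph_def)
        then show ?thesis using c(1) unfolding coloring_using_all_def by blast
      qed
      then obtain a b g where "a \<noteq> b" "a \<noteq> g" "b \<noteq> g" "windmills c {..<n} a b g 40"
        using fN[OF n _ no] by blast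
      then interpret windmill_coloring c n a b g by unfold_locales
      have "rainbow_copy c n r L" using rainbow_copies_of_maximal[OF c(1) m] rL by (auto simp: maximal_lists_def)
      then show False
        using rainbow_copy_imp_not_free[OF H(1) emb maximal_lists_edges[OF rL]] c(2) by blast
    qed
    then show ?thesis by blast
  qed
  then have "\<forall>k\<ge>1. \<exists>m0. \<forall>m\<ge>max m0 (card (edges H)). \<exists>n0 f. \<forall>n\<ge>n0. \<forall>c.
      coloring_using_all n m c \<and> rainbow_free n c H \<longrightarrow> has_ASMS k f n c"
    by (intro allI impI, intro exI[of _ 75]) simp
  then show ?thesis using H by (simp add: ASMS_graphs_def)
qed

section \<open>Colorings without almost spanning connected color classes\<close>

lemma connected_edge_exists:
  assumes "connected_graph G" "u \<in> verts G" "v \<in> verts G" "u \<noteq> v"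
  obtains x y where "{x, y} \<in> edges G"
proof -
  have "(u, v) \<in> {(x, y). {x, y} \<in> edges G}\<^sup>*" using assms by (auto simp: connected_graph_def)
  then show ?thesis using assms(4) that by (cases rule: converse_rtranclE) auto
qed

text \<open>
  The vertices of a connected monochromatic subgraph lie on one side of the partition belonging
  to its color, and each side misses more than \<open>f\<close> vertices.
\<close>

lemma no_ASMS_if_split:
  assumes split: "\<And>j. \<exists>P. (\<forall>u<n. \<forall>v<n. u \<noteq> v \<longrightarrow> c {u, v} = j \<longrightarrow> P u = P v) \<and>
      f < card {u. u < n \<and> P u} \<and> f < card {u. u < n \<and> \<not> P u}"
  shows "\<not> has_ASMS 1 f n c"
proof
  assume "has_ASMS 1 f n c"
  then obtain G where G: "subgraph G (complete_graph n)" "Defs.monochromatic c G" "k_connected 1 G"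
      "n \<le> graph_order G + f" unfolding has_ASMS_def by blast
  have V: "verts G \<subseteq> {..<n}" "simple_graph G" using G(1) by (auto simp: subgraph_def complete_graph_def)
  have fin: "finite (verts G)" using V(2) by (simp add: simple_graph_def)
  have "delete_verts G {} = G" by (cases G) (simp add: delete_verts_def)
  then have con: "connected_graph G" and ord: "1 < card (verts G)"
    using G(3) by (auto simp: k_connected_def graph_order_def dest: spec[of _ "{}"])
  obtain u where u: "u \<in> verts G" using ord by fastforce
  obtain w where w: "w \<in> verts G" "u \<noteq> w"
    using ord u by (metis One_nat_def card_le_Suc0_iff_eq fin not_le)
  obtain x0 y0 where e0: "{x0, y0} \<in> edges G" using connected_edge_exists[OF con u w] by blast
  define j where "j = c {x0, y0}"
  obtain P where P: "\<forall>u<n. \<forall>v<n. u \<noteq> v \<longrightarrow> c {u, v} = j \<longrightarrow> P u = P v"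
      "f < card {u. u < n \<and> P u}" "f < card {u. u < n \<and> \<not> P u}" using split[of j] by blast
  have edge: "P x = P y" if "{x, y} \<in> edges G" for x y
  proof -
    have "c {x, y} = j" using G(2) e0 that unfolding Defs.monochromatic_def j_def by blast
    moreover have "{x, y} \<subseteq> verts G" using that V(2) unfolding simple_graph_def by blast
    then have "x < n" "y < n" using V(1) by auto
    ultimately show ?thesis using P(1) by (cases "x = y") auto
  qed
  have "P v = P u" if "v \<in> verts G" for v
  proof -
    have "(u, v) \<in> {(x, y). {x, y} \<in> edges G}\<^sup>*" using con u that by (auto simp: connected_graph_def)
    then show ?thesis by (induction rule: rtrancl_induct) (auto dest: edge)
  qed
  then have side: "verts G \<subseteq> {v. v < n \<and> P v} \<or> verts G \<subseteq> {v. v < n \<and> \<not> P v}" using V(1) by auto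
  have "card {v. v < n \<and> P v} + card {v. v < n \<and> \<not> P v} = n"
  proof -
    have "card ({v. v < n \<and> P v} \<union> {v. v < n \<and> \<not> P v}) = card {v. v < n \<and> P v} + card {v. v < n \<and> \<not> P v}"
      by (rule card_Un_disjoint) auto
    moreover have "{v. v < n \<and> P v} \<union> {v. v < n \<and> \<not> P v} = {..<n}" by auto
    ultimately show ?thesis by simp
  qed
  moreover have "card (verts G) \<le> card {v. v < n \<and> P v} \<or> card (verts G) \<le> card {v. v < n \<and> \<not> P v}"
    using side by (auto intro: card_mono)
  ultimately show False using G(4) P(2,3) by (auto simp: graph_order_def)
qed

lemma card_gtI:
  fixes h :: "nat \<Rightarrow> nat"
  assumes "inj h" "\<And>i. i \<le> f \<Longrightarrow> h i < n \<and> P (h i)"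
  shows "f < card {u. u < n \<and> P u}"
proof -
  have "card (h ` {..f}) \<le> card {u. u < n \<and> P u}"
    using assms(2) by (intro card_mono) auto
  moreover have "card (h ` {..f}) = Suc f" using assms(1) by (simp add: card_image inj_on_subset)
  ultimately show ?thesis by simp
qed

text \<open>
  For a symmetric function this is the coloring of the edge \<open>{u, v}\<close> by \<open>F u v\<close>.
\<close>

definition pair_coloring :: "(nat \<Rightarrow> nat \<Rightarrow> nat) \<Rightarrow> coloring" where
  "pair_coloring F e = F (Min e) (Max e)"

lemma pair_coloring_apply:
  assumes "\<And>u v. F u v = F v u"
  shows "pair_coloring F {u, v} = F u v"
  using assms by (cases "u \<le> v") (auto simp: pair_coloring_def min_def max_def)

definition has_copy :: "nat \<Rightarrow> (nat \<times> nat) list \<Rightarrow> 'a graph \<Rightarrow> bool" where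
  "has_copy r L H \<longleftrightarrow> (\<exists>xs. length xs = r \<and> distinct xs \<and> (\<forall>(i, j)\<in>set L. {xs ! i, xs ! j} \<in> edges H))"

text \<open>
  Families that witness the failure of the condition for \<open>k = 1\<close>, for all large \<open>m\<close>. Each coloring
  is defined on all pairs of natural numbers, so that it does not depend on \<open>n\<close>.
\<close>

definition bad_colorings :: "(nat \<Rightarrow> coloring) \<Rightarrow> bool" where
  "bad_colorings C \<longleftrightarrow> (\<forall>m\<ge>10. \<forall>f. \<exists>N. \<forall>n\<ge>N. coloring_using_all n m (C m) \<and> \<not> has_ASMS 1 f n (C m))"

lemma ASMS_rainbow_in_bad_coloring:
  assumes H: "H \<in> ASMS_graphs" and C: "bad_colorings C"
  obtains m n where "10 \<le> m" "\<not> rainbow_free n (C m) H"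
proof -
  obtain m0 where m0: "\<forall>m\<ge>max m0 (card (edges H)). \<exists>n0 f. \<forall>n\<ge>n0. \<forall>c.
      coloring_using_all n m c \<and> rainbow_free n c H \<longrightarrow> has_ASMS 1 f n c"
    using H unfolding ASMS_graphs_def by auto
  define m where "m = max 10 (max m0 (card (edges H)))"
  obtain n0 f where nf: "\<forall>n\<ge>n0. \<forall>c. coloring_using_all n m c \<and> rainbow_free n c H \<longrightarrow> has_ASMS 1 f n c"
    using m0[rule_format, of m] by (auto simp: m_def)
  obtain N where N: "\<forall>n\<ge>N. coloring_using_all n m (C m) \<and> \<not> has_ASMS 1 f n (C m)"
    using C[unfolded bad_colorings_def, rule_format, of m f] by (auto simp: m_def)
  have "\<not> rainbow_free (max N n0) (C m) H" using nf N by (meson max.cobounded1 max.cobounded2)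
  then show ?thesis using that[of m "max N n0"] by (simp add: m_def)
qed

text \<open>
  The last assumption on \<open>L\<close> excludes positions without an edge: the list entry there could lie
  outside the graph.
\<close>

lemma copy_in_rainbow:
  assumes H: "simple_graph H" and nf: "\<not> rainbow_free n c H" and copy: "has_copy r L H"
    and L: "distinct (map (\<lambda>(i, j). {i, j}) L)" "\<forall>(i, j)\<in>set L. i < r \<and> j < r"
      "\<forall>i\<in>{..<r}. \<exists>p\<in>set L. i = fst p \<or> i = snd p"
  shows "rainbow_copy c n r L"
proof -
  obtain G where G: "subgraph G (complete_graph n)" "isomorphic H G" "rainbow c G"
    using nf unfolding rainbow_free_def by blast
  obtain \<phi> where \<phi>: "bij_betw \<phi> (verts H) (verts G)" "(\<lambda>e. \<phi> ` e) ` edges H = edges G"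
    using G(2) unfolding isomorphic_def by blast
  obtain xs where xs: "length xs = r" "distinct xs" and
    xsL: "\<forall>p\<in>set L. {xs ! fst p, xs ! snd p} \<in> edges H"
    using copy unfolding has_copy_def case_prod_beta by (elim exE conjE)
  have inj: "inj_on \<phi> (verts H)" and img: "\<phi> ` verts H = verts G" using \<phi>(1) by (auto simp: bij_betw_def)
  have V: "verts G \<subseteq> {..<n}" using G(1) by (auto simp: subgraph_def complete_graph_def)
  have HV: "e \<subseteq> verts H" if "e \<in> edges H" for e using H that by (auto simp: simple_graph_def)
  have mem: "xs ! i \<in> verts H" if i: "i < r" for i
  proof -
    obtain p where p: "p \<in> set L" "i = fst p \<or> i = snd p" using L(3) i by blast
    show ?thesis using HV[OF xsL[rule_format, OF p(1)]] p(2) by auto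
  qed
  then have sub: "set xs \<subseteq> verts H" using xs(1) by (auto simp: in_set_conv_nth)
  have lt: "fst p < r" "snd p < r" if "p \<in> set L" for p using L(2) that by auto
  have "distinct (map (\<lambda>(i, j). c {map \<phi> xs ! i, map \<phi> xs ! j}) L)"
    unfolding distinct_map
  proof
    show "distinct L" using L(1) by (simp add: distinct_map)
    show "inj_on (\<lambda>(i, j). c {map \<phi> xs ! i, map \<phi> xs ! j}) (set L)"
    proof (rule inj_onI)
      fix p q assume pq: "p \<in> set L" "q \<in> set L"
        "(case p of (i, j) \<Rightarrow> c {map \<phi> xs ! i, map \<phi> xs ! j}) = (case q of (i, j) \<Rightarrow> c {map \<phi> xs ! i, map \<phi> xs ! j})"
      define ep where "ep = {xs ! fst p, xs ! snd p}"
      define eq where "eq = {xs ! fst q, xs ! snd q}"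
      have e: "ep \<in> edges H" "eq \<in> edges H" using xsL pq(1,2) by (auto simp: ep_def eq_def)
      have "c (\<phi> ` ep) = c (\<phi> ` eq)"
        using pq(3) lt[OF pq(1)] lt[OF pq(2)] xs(1) by (simp add: ep_def eq_def case_prod_beta)
      then have "\<phi> ` ep = \<phi> ` eq" using G(3) e \<phi>(2) unfolding rainbow_def by (metis image_eqI inj_onD)
      then have "ep = eq" using inj HV[OF e(1)] HV[OF e(2)] by (metis inj_on_image_eq_iff)
      moreover have "inj_on ((!) xs) {..<r}" using xs(1,2) by (simp add: inj_on_nth)
      ultimately have "{fst p, snd p} = {fst q, snd q}"
        using lt[OF pq(1)] lt[OF pq(2)] inj_on_image_eq_iff[of "(!) xs" "{..<r}" "{fst p, snd p}" "{fst q, snd q}"]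
        by (simp add: ep_def eq_def)
      then have E: "(case p of (i, j) \<Rightarrow> {i, j}) = (case q of (i, j) \<Rightarrow> {i, j})" by (simp add: case_prod_beta)
      have I: "inj_on (\<lambda>(i, j). {i, j}) (set L)" using L(1) by (simp add: distinct_map)
      show "p = q" by (rule inj_onD[OF I E pq(1,2)])
    qed
  qed
  moreover have "distinct (map \<phi> xs)" using xs(2) sub inj by (auto simp: distinct_map intro: inj_on_subset)
  moreover have "set (map \<phi> xs) \<subseteq> {..<n}" using sub img V by auto
  ultimately show ?thesis using xs(1) by (intro rainbow_copyI[of "map \<phi> xs"]) simp_all
qed

lemma no_copy_if_bad_coloring:
  assumes H: "H \<in> ASMS_graphs" and C: "bad_colorings C" "\<And>m n. 10 \<le> m \<Longrightarrow> \<not> rainbow_copy (C m) n r L"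
    and L: "distinct (map (\<lambda>(i, j). {i, j}) L)" "\<forall>(i, j)\<in>set L. i < r \<and> j < r"
      "\<forall>i\<in>{..<r}. \<exists>p\<in>set L. i = fst p \<or> i = snd p"
  shows "\<not> has_copy r L H"
proof
  assume copy: "has_copy r L H"
  have "simple_graph H" using H by (simp add: ASMS_graphs_def)
  obtain m n where "10 \<le> m" "\<not> rainbow_free n (C m) H"
    using ASMS_rainbow_in_bad_coloring[OF H C(1)] by blast
  then show False using copy_in_rainbow[OF \<open>simple_graph H\<close> _ copy L] C(2) by blast
qed

section \<open>Four families of colorings\<close>

lemma coloring_using_allI:
  assumes sym: "\<And>u v. F u v = F v u" and range: "\<And>u v. u \<noteq> v \<Longrightarrow> F u v \<in> {1..m}"
    and surj: "\<And>j. j \<in> {1..m} \<Longrightarrow> \<exists>u<n. \<exists>v<n. u \<noteq> v \<and> F u v = j"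
  shows "coloring_using_all n m (pair_coloring F)"
  unfolding coloring_using_all_def
proof (intro subset_antisym subsetI)
  fix j assume "j \<in> pair_coloring F ` edges (complete_graph n)"
  then obtain e where e: "j = pair_coloring F e" "e \<subseteq> {..<n}" "card e = 2"
    by (auto simp: complete_graph_def)
  obtain u v where "e = {u, v}" "u \<noteq> v" using e(3) by (auto simp: card_2_iff)
  then show "j \<in> {1..m}" using e(1) range pair_coloring_apply[of F u v, OF sym] by simp
next
  fix j assume "j \<in> {1..m}"
  then obtain u v where uv: "u < n" "v < n" "u \<noteq> v" "F u v = j" using surj by blast
  then have "{u, v} \<in> edges (complete_graph n)" by (simp add: complete_graph_def)
  moreover have "pair_coloring F {u, v} = j" using uv(4) pair_coloring_apply[of F u v, OF sym] by simp
  ultimately show "j \<in> pair_coloring F ` edges (complete_graph n)" by (metis image_eqI)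
qed

text \<open>
  Arithmetic progressions with difference at most 4 witness that both sides of a partition are large.
\<close>

lemma bad_coloringsI:
  assumes sym: "\<And>m u v. F m u v = F m v u"
    and range: "\<And>m u v. \<lbrakk>10 \<le> m; u \<noteq> v\<rbrakk> \<Longrightarrow> F m u v \<in> {1..m}"
    and surj: "\<And>m j. \<lbrakk>10 \<le> m; j \<in> {1..m}\<rbrakk> \<Longrightarrow> \<exists>u<8 * m + 20. \<exists>v<8 * m + 20. u \<noteq> v \<and> F m u v = j"
    and split: "\<And>m j. 10 \<le> m \<Longrightarrow> \<exists>P p q q'. (\<forall>u v. u \<noteq> v \<longrightarrow> F m u v = j \<longrightarrow> P u = P v) \<and>
        0 < p \<and> p \<le> 4 \<and> q \<le> 8 * m + 19 \<and> q' \<le> 8 * m + 19 \<and> (\<forall>i. P (p * i + q)) \<and> (\<forall>i. \<not> P (p * i + q'))"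
  shows "bad_colorings (\<lambda>m. pair_coloring (F m))"
  unfolding bad_colorings_def
proof (intro allI impI)
  fix m f :: nat assume m: "10 \<le> m"
  show "\<exists>N. \<forall>n\<ge>N. coloring_using_all n m (pair_coloring (F m)) \<and> \<not> has_ASMS 1 f n (pair_coloring (F m))"
  proof (intro exI[of _ "4 * f + 8 * m + 20"] allI impI conjI)
    fix n assume n: "4 * f + 8 * m + 20 \<le> n"
    show "coloring_using_all n m (pair_coloring (F m))"
    proof (rule coloring_using_allI)
      fix j assume "j \<in> {1..m}"
      then obtain u v where "u < 8 * m + 20" "v < 8 * m + 20" "u \<noteq> v" "F m u v = j" using surj[OF m] by blast
      moreover have "8 * m + 20 \<le> n" using n by simp
      ultimately show "\<exists>u<n. \<exists>v<n. u \<noteq> v \<and> F m u v = j"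
        by (intro exI[of _ u] conjI exI[of _ v]) simp_all
    qed (use sym range[OF m] in auto)
    show "\<not> has_ASMS 1 f n (pair_coloring (F m))"
    proof (rule no_ASMS_if_split)
      fix j
      obtain P p q q' where P: "\<forall>u v. u \<noteq> v \<longrightarrow> F m u v = j \<longrightarrow> P u = P v"
        "0 < p" "p \<le> 4" "q \<le> 8 * m + 19" "q' \<le> 8 * m + 19" "\<forall>i. P (p * i + q)" "\<forall>i. \<not> P (p * i + q')"
        using split[OF m, of j] by (elim exE conjE)
      have lin: "inj (\<lambda>i. p * i + s)" for s using P(2) by (auto simp: inj_def)
      have lt: "p * i + s < n" if "i \<le> f" "s \<le> 8 * m + 19" for i s
      proof -
        have "p * i \<le> 4 * f" using P(3) that(1) by (rule mult_le_mono)
        then show ?thesis using that(2) n by linarith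
      qed
      show "\<exists>P. (\<forall>u<n. \<forall>v<n. u \<noteq> v \<longrightarrow> pair_coloring (F m) {u, v} = j \<longrightarrow> P u = P v) \<and>
          f < card {u. u < n \<and> P u} \<and> f < card {u. u < n \<and> \<not> P u}"
      proof (intro exI[of _ P] conjI)
        show "\<forall>u<n. \<forall>v<n. u \<noteq> v \<longrightarrow> pair_coloring (F m) {u, v} = j \<longrightarrow> P u = P v"
          using P(1) pair_coloring_apply[of "F m", OF sym] by simp
        show "f < card {u. u < n \<and> P u}"
          by (rule card_gtI[OF lin[of q]]) (use lt P(4,6) in auto)
        show "f < card {u. u < n \<and> \<not> P u}"
          by (rule card_gtI[OF lin[of q']]) (use lt P(5,7) in auto)
      qed
    qed
  qed
qed

text \<open>
  The triangle of colors on three classes: 1 between the classes 0 and 1, 2 between 1 and 2, and 3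
  between 0 and 2. The colors inside the classes are chosen so that every vertex sees only two of
  the three colors.
\<close>

definition base3 :: "nat \<Rightarrow> nat \<Rightarrow> nat" where
  "base3 p q = (if p \<noteq> 2 \<and> q \<noteq> 2 then 1 else if p \<noteq> 0 \<and> q \<noteq> 0 then 2 else 3)"

text \<open>
  All further colors form a star with centre 0 inside the class 0.
\<close>

definition star_col :: "nat \<Rightarrow> nat \<Rightarrow> nat \<Rightarrow> nat" where
  "star_col m u v =
    (if u = 0 \<and> 0 < v \<and> v mod 3 = 0 \<and> v div 3 \<le> m - 3 then 3 + v div 3
     else if v = 0 \<and> 0 < u \<and> u mod 3 = 0 \<and> u div 3 \<le> m - 3 then 3 + u div 3
     else base3 (u mod 3) (v mod 3))"

text \<open>
  All further colors form a matching of pairs \<open>6q\<close>, \<open>6q + 3\<close> inside the class 0.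
\<close>

definition match_col :: "nat \<Rightarrow> nat \<Rightarrow> nat \<Rightarrow> nat" where
  "match_col m u v =
    (if u mod 3 = 0 \<and> v mod 3 = 0 \<and> u div 6 = v div 6 \<and> u div 6 < m - 3 then 4 + u div 6
     else base3 (u mod 3) (v mod 3))"

text \<open>
  Four classes. The classes 1, 2 and 3 form a rainbow triangle, and a vertex of the class 0 is in no
  rainbow triangle.
\<close>

definition base4 :: "nat \<Rightarrow> nat \<Rightarrow> nat" where
  "base4 p q = (if p = q \<or> (p \<noteq> 3 \<and> q \<noteq> 3 \<and> (p = 1 \<or> q = 1)) then 1
     else if p \<noteq> 2 \<and> q \<noteq> 2 then 2 else 3)"

lemma less_4: "(p::nat) < 4 \<longleftrightarrow> p = 0 \<or> p = 1 \<or> p = 2 \<or> p = 3"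
  by auto

text \<open>
  All further colors form a matching of pairs \<open>8q\<close>, \<open>8q + 4\<close> inside the class 0, away from the rainbow
  triangles.
\<close>

definition four_col :: "nat \<Rightarrow> nat \<Rightarrow> nat \<Rightarrow> nat" where
  "four_col m u v =
    (if u mod 4 = 0 \<and> v mod 4 = 0 \<and> u div 8 = v div 8 \<and> u div 8 < m - 3 then 4 + u div 8
     else base4 (u mod 4) (v mod 4))"

text \<open>
  Two of the colors, 2 and 3, occur at infinitely many odd vertices, so that no color reaches almost
  all of them.
\<close>

definition odd_col :: "nat \<Rightarrow> nat \<Rightarrow> nat" where
  "odd_col m w = (if w div 2 < m - 3 then 4 + w div 2 else if even (w div 2) then 2 else 3)"

text \<open>
  Color 1 inside the even and inside the odd vertices; an edge between them has the color of its odd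
  end. So a rainbow subgraph is a forest of stars with even centres, plus at most one edge.
\<close>

definition cross_col :: "nat \<Rightarrow> nat \<Rightarrow> nat \<Rightarrow> nat" where
  "cross_col m u v = (if even u = even v then 1 else odd_col m (if odd u then u else v))"

lemma col_sym:
  "star_col m u v = star_col m v u" "match_col m u v = match_col m v u"
  "four_col m u v = four_col m v u" "cross_col m u v = cross_col m v u"
  by (auto simp: star_col_def match_col_def four_col_def cross_col_def base3_def base4_def)

lemma bad_star: "bad_colorings (\<lambda>m. pair_coloring (star_col m))"
proof (rule bad_coloringsI)
  show "star_col m u v = star_col m v u" for m u v by (rule col_sym)
  show "star_col m u v \<in> {1..m}" if "10 \<le> m" "u \<noteq> v" for m u v
    using that by (auto simp: star_col_def base3_def)
  show "\<exists>u<8 * m + 20. \<exists>v<8 * m + 20. u \<noteq> v \<and> star_col m u v = j" if m: "10 \<le> m" "j \<in> {1..m}" for m j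
  proof -
    consider "j = 1" | "j = 2" | "j = 3" | "4 \<le> j" using m(2) by force
    then show ?thesis
    proof cases
      case 1 show ?thesis by (rule exI[of _ 1], simp, rule exI[of _ 4]) (simp add: 1 star_col_def base3_def)
    next
      case 2 show ?thesis by (rule exI[of _ 1], simp, rule exI[of _ 2]) (simp add: 2 star_col_def base3_def)
    next
      case 3 show ?thesis by (rule exI[of _ 2], simp, rule exI[of _ 3]) (simp add: 3 star_col_def base3_def)
    next
      case 4
      then show ?thesis using m by (intro exI[of _ 0] conjI exI[of _ "3 * (j - 3)"]) (auto simp: star_col_def)
    qed
  qed
  fix m j :: nat
  define r where "r = (if j = 1 then 2 else if j = 2 then 0 else if j = 3 then 1 else 0 :: nat)"
  define r' where "r' = (if r = 0 then 1 else 0 :: nat)"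
  have "u mod 3 = r \<longleftrightarrow> v mod 3 = r" if "star_col m u v = j" for u v
    using that by (auto simp: star_col_def r_def base3_def split: if_splits)
  moreover have "r < 3" "r' < 3" "r \<noteq> r'" by (auto simp: r_def r'_def)
  ultimately show "\<exists>P p q q'. (\<forall>u v. u \<noteq> v \<longrightarrow> star_col m u v = j \<longrightarrow> P u = P v) \<and>
        0 < p \<and> p \<le> 4 \<and> q \<le> 8 * m + 19 \<and> q' \<le> 8 * m + 19 \<and> (\<forall>i. P (p * i + q)) \<and> (\<forall>i. \<not> P (p * i + q'))"
    by (intro exI[of _ "\<lambda>u. u mod 3 = r"] exI[of _ 3] exI[of _ r] exI[of _ r']) auto
qed

lemma bad_match: "bad_colorings (\<lambda>m. pair_coloring (match_col m))"
proof (rule bad_coloringsI)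
  show "match_col m u v = match_col m v u" for m u v by (rule col_sym)
  show "match_col m u v \<in> {1..m}" if "10 \<le> m" "u \<noteq> v" for m u v
    using that by (auto simp: match_col_def base3_def)
  show "\<exists>u<8 * m + 20. \<exists>v<8 * m + 20. u \<noteq> v \<and> match_col m u v = j" if m: "10 \<le> m" "j \<in> {1..m}" for m j
  proof -
    consider "j = 1" | "j = 2" | "j = 3" | "4 \<le> j" using m(2) by force
    then show ?thesis
    proof cases
      case 1 show ?thesis by (rule exI[of _ 1], simp, rule exI[of _ 4]) (simp add: 1 match_col_def base3_def)
    next
      case 2 show ?thesis by (rule exI[of _ 1], simp, rule exI[of _ 2]) (simp add: 2 match_col_def base3_def)
    next
      case 3 show ?thesis by (rule exI[of _ 2], simp, rule exI[of _ 3]) (simp add: 3 match_col_def base3_def)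
    next
      case 4
      have "6 * (j - 4) mod 3 = 0" "(6 * (j - 4) + 3) mod 3 = 0" by presburger+
      then show ?thesis using m 4
        by (intro exI[of _ "6 * (j - 4)"] conjI exI[of _ "6 * (j - 4) + 3"]) (auto simp: match_col_def)
    qed
  qed
  fix m j :: nat
  define r where "r = (if j = 1 then 2 else if j = 2 then 0 else if j = 3 then 1 else 0 :: nat)"
  define r' where "r' = (if r = 0 then 1 else 0 :: nat)"
  have "u mod 3 = r \<longleftrightarrow> v mod 3 = r" if "match_col m u v = j" for u v
    using that by (auto simp: match_col_def r_def base3_def split: if_splits)
  moreover have "r < 3" "r' < 3" "r \<noteq> r'" by (auto simp: r_def r'_def)
  ultimately show "\<exists>P p q q'. (\<forall>u v. u \<noteq> v \<longrightarrow> match_col m u v = j \<longrightarrow> P u = P v) \<and>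
        0 < p \<and> p \<le> 4 \<and> q \<le> 8 * m + 19 \<and> q' \<le> 8 * m + 19 \<and> (\<forall>i. P (p * i + q)) \<and> (\<forall>i. \<not> P (p * i + q'))"
    by (intro exI[of _ "\<lambda>u. u mod 3 = r"] exI[of _ 3] exI[of _ r] exI[of _ r']) auto
qed

lemma bad_four: "bad_colorings (\<lambda>m. pair_coloring (four_col m))"
proof (rule bad_coloringsI)
  show "four_col m u v = four_col m v u" for m u v by (rule col_sym)
  show "four_col m u v \<in> {1..m}" if "10 \<le> m" "u \<noteq> v" for m u v
    using that by (auto simp: four_col_def base4_def)
  show "\<exists>u<8 * m + 20. \<exists>v<8 * m + 20. u \<noteq> v \<and> four_col m u v = j" if m: "10 \<le> m" "j \<in> {1..m}" for m j
  proof -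
    consider "j = 1" | "j = 2" | "j = 3" | "4 \<le> j" using m(2) by force
    then show ?thesis
    proof cases
      case 1 show ?thesis by (rule exI[of _ 1], simp, rule exI[of _ 5]) (simp add: 1 four_col_def base4_def)
    next
      case 2 show ?thesis by (rule exI[of _ 1], simp, rule exI[of _ 3]) (simp add: 2 four_col_def base4_def)
    next
      case 3 show ?thesis by (rule exI[of _ 2], simp, rule exI[of _ 3]) (simp add: 3 four_col_def base4_def)
    next
      case 4
      have "8 * (j - 4) mod 4 = 0" "(8 * (j - 4) + 4) mod 4 = 0" by presburger+
      then show ?thesis using m 4
        by (intro exI[of _ "8 * (j - 4)"] conjI exI[of _ "8 * (j - 4) + 4"]) (auto simp: four_col_def)
    qed
  qed
  fix m j :: nat
  define r where "r = (if j = 1 then 3 else if j = 2 then 2 else if j = 3 then 1 else 0 :: nat)"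
  define r' where "r' = (if r = 0 then 1 else 0 :: nat)"
  have "u mod 4 = r \<longleftrightarrow> v mod 4 = r" if "four_col m u v = j" for u v
  proof -
    have "u mod 4 < 4" "v mod 4 < 4" by auto
    then show ?thesis using that
      unfolding less_4 by (elim disjE) (auto simp: four_col_def r_def base4_def split: if_splits)
  qed
  moreover have "r < 4" "r' < 4" "r \<noteq> r'" by (auto simp: r_def r'_def)
  ultimately show "\<exists>P p q q'. (\<forall>u v. u \<noteq> v \<longrightarrow> four_col m u v = j \<longrightarrow> P u = P v) \<and>
        0 < p \<and> p \<le> 4 \<and> q \<le> 8 * m + 19 \<and> q' \<le> 8 * m + 19 \<and> (\<forall>i. P (p * i + q)) \<and> (\<forall>i. \<not> P (p * i + q'))"
    by (intro exI[of _ "\<lambda>u. u mod 4 = r"] exI[of _ 4] exI[of _ r] exI[of _ r']) auto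
qed

lemma bad_cross: "bad_colorings (\<lambda>m. pair_coloring (cross_col m))"
proof (rule bad_coloringsI)
  show "cross_col m u v = cross_col m v u" for m u v by (rule col_sym)
  show "cross_col m u v \<in> {1..m}" if "10 \<le> m" "u \<noteq> v" for m u v
    using that by (auto simp: cross_col_def odd_col_def)
  show "\<exists>u<8 * m + 20. \<exists>v<8 * m + 20. u \<noteq> v \<and> cross_col m u v = j" if m: "10 \<le> m" "j \<in> {1..m}" for m j
  proof -
    consider "j = 1" | "j = 2" | "j = 3" | "4 \<le> j" using m(2) by force
    then show ?thesis
    proof cases
      case 1 show ?thesis by (rule exI[of _ 0], simp, rule exI[of _ 2]) (simp add: 1 cross_col_def)
    next
      case 2 show ?thesis
        by (rule exI[of _ 0], simp, rule exI[of _ "4 * m + 1"]) (simp add: 2 cross_col_def odd_col_def)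
    next
      case 3
      have "(4 * m + 3) div 2 = 2 * m + 1" by presburger
      then show ?thesis
        by (intro exI[of _ 0] conjI exI[of _ "4 * m + 3"]) (simp_all add: 3 cross_col_def odd_col_def)
    next
      case 4
      then show ?thesis using m
        by (intro exI[of _ 0] conjI exI[of _ "2 * (j - 4) + 1"]) (auto simp: cross_col_def odd_col_def)
    qed
  qed
  fix m j :: nat
  show "\<exists>P p q q'. (\<forall>u v. u \<noteq> v \<longrightarrow> cross_col m u v = j \<longrightarrow> P u = P v) \<and>
        0 < p \<and> p \<le> 4 \<and> q \<le> 8 * m + 19 \<and> q' \<le> 8 * m + 19 \<and> (\<forall>i. P (p * i + q)) \<and> (\<forall>i. \<not> P (p * i + q'))"
  proof (cases "j = 1")
    case True
    have "even u = even v" if "cross_col m u v = 1" for u v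
      using that by (auto simp: cross_col_def odd_col_def split: if_splits)
    then show ?thesis using True
      by (intro exI[of _ even] exI[of _ 2] exI[of _ 0] exI[of _ 1]) auto
  next
    case False
    define q where "q = (if j = 2 then 4 * m + 3 else 4 * m + 1)"
    \<comment> \<open>Odd vertices beyond \<open>4m\<close> have the colors 2 and 3 alternately. The side with color other than \<open>j\<close> thus
      contains one of these two progressions.\<close>
    have div: "(4 * i + (4 * m + 3)) div 2 = 2 * i + 2 * m + 1" "(4 * i + (4 * m + 1)) div 2 = 2 * i + 2 * m" for i
      by presburger+
    have "odd (4 * i + q) \<and> odd_col m (4 * i + q) \<noteq> j" for i
      by (auto simp: q_def odd_col_def div)
    moreover have "(odd u \<and> odd_col m u \<noteq> j) = (odd v \<and> odd_col m v \<noteq> j)" if "cross_col m u v = j" for u v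
      using that False by (auto simp: cross_col_def split: if_splits)
    ultimately show ?thesis
      by (intro exI[of _ "\<lambda>u. odd u \<and> odd_col m u \<noteq> j"] exI[of _ 4] exI[of _ q] exI[of _ 0])
        (auto simp: q_def)
  qed
qed

section \<open>Subgraphs excluded by the four families\<close>

text \<open>
  The excluded graphs: a cycle on four vertices; the trees with one vertex of degree three and legs of
  lengths 2, 2, 1 or 1, 1, 3; a triangle with a pendant edge; the star with four edges; the tree with
  two adjacent vertices of degree three; a star with three edges, or a triangle, together with a
  disjoint path on three vertices.
\<close>

definition "C4_list = [(0::nat,1::nat),(1,2),(2,3),(0,3)]"

definition "S221_list = [(0::nat,1::nat),(0,2),(0,3),(1,4),(2,5)]"

definition "paw_list = [(0::nat,1::nat),(0,2),(1,2),(0,3)]"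

definition "K14_list = [(0::nat,1::nat),(0,2),(0,3),(0,4)]"

definition "S22_list = [(0::nat,1::nat),(0,2),(0,3),(1,4),(1,5)]"

definition "S113_list = [(0::nat,1::nat),(0,2),(0,3),(3,4),(4,5)]"

definition "K13_P3_list = [(0::nat,1::nat),(0,2),(0,3),(4,5),(5,6)]"

definition "K3_P3_list = [(0::nat,1::nat),(0,2),(1,2),(3,4),(4,5)]"

lemma rainbow_copy_4D:
  assumes "rainbow_copy c n 4 L"
  shows "\<exists>x0 x1 x2 x3. distinct [x0, x1, x2, x3] \<and> distinct (map (\<lambda>(i, j). c {[x0, x1, x2, x3] ! i, [x0, x1, x2, x3] ! j}) L)"
proof -
  obtain xs where xs: "length xs = 4" "distinct xs" "distinct (map (\<lambda>(i, j). c {xs ! i, xs ! j}) L)"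
    using assms unfolding rainbow_copy_def by (elim exE conjE)
  obtain x0 x1 x2 x3 where "xs = [x0, x1, x2, x3]"
    using xs(1) by (auto simp: numeral_eq_Suc length_Suc_conv)
  then have "distinct [x0, x1, x2, x3] \<and> distinct (map (\<lambda>(i, j). c {[x0, x1, x2, x3] ! i, [x0, x1, x2, x3] ! j}) L)"
    using xs(2,3) by simp
  then show ?thesis by - (rule exI[of _ x0], rule exI[of _ x1], rule exI[of _ x2], rule exI[of _ x3])
qed

lemma rainbow_copy_5D:
  assumes "rainbow_copy c n 5 L"
  shows "\<exists>x0 x1 x2 x3 x4. distinct [x0, x1, x2, x3, x4] \<and> distinct (map (\<lambda>(i, j). c {[x0, x1, x2, x3, x4] ! i, [x0, x1, x2, x3, x4] ! j}) L)"
proof -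
  obtain xs where xs: "length xs = 5" "distinct xs" "distinct (map (\<lambda>(i, j). c {xs ! i, xs ! j}) L)"
    using assms unfolding rainbow_copy_def by (elim exE conjE)
  obtain x0 x1 x2 x3 x4 where "xs = [x0, x1, x2, x3, x4]"
    using xs(1) by (auto simp: numeral_eq_Suc length_Suc_conv)
  then have "distinct [x0, x1, x2, x3, x4] \<and> distinct (map (\<lambda>(i, j). c {[x0, x1, x2, x3, x4] ! i, [x0, x1, x2, x3, x4] ! j}) L)"
    using xs(2,3) by simp
  then show ?thesis by - (rule exI[of _ x0], rule exI[of _ x1], rule exI[of _ x2], rule exI[of _ x3], rule exI[of _ x4])
qed

lemma rainbow_copy_6D:
  assumes "rainbow_copy c n 6 L"
  shows "\<exists>x0 x1 x2 x3 x4 x5. distinct [x0, x1, x2, x3, x4, x5] \<and> distinct (map (\<lambda>(i, j). c {[x0, x1, x2, x3, x4, x5] ! i, [x0, x1, x2, x3, x4, x5] ! j}) L)"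
proof -
  obtain xs where xs: "length xs = 6" "distinct xs" "distinct (map (\<lambda>(i, j). c {xs ! i, xs ! j}) L)"
    using assms unfolding rainbow_copy_def by (elim exE conjE)
  obtain x0 x1 x2 x3 x4 x5 where "xs = [x0, x1, x2, x3, x4, x5]"
    using xs(1) by (auto simp: numeral_eq_Suc length_Suc_conv)
  then have "distinct [x0, x1, x2, x3, x4, x5] \<and> distinct (map (\<lambda>(i, j). c {[x0, x1, x2, x3, x4, x5] ! i, [x0, x1, x2, x3, x4, x5] ! j}) L)"
    using xs(2,3) by simp
  then show ?thesis by - (rule exI[of _ x0], rule exI[of _ x1], rule exI[of _ x2], rule exI[of _ x3], rule exI[of _ x4], rule exI[of _ x5])
qed

lemma rainbow_copy_7D:
  assumes "rainbow_copy c n 7 L"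
  shows "\<exists>x0 x1 x2 x3 x4 x5 x6. distinct [x0, x1, x2, x3, x4, x5, x6] \<and> distinct (map (\<lambda>(i, j). c {[x0, x1, x2, x3, x4, x5, x6] ! i, [x0, x1, x2, x3, x4, x5, x6] ! j}) L)"
proof -
  obtain xs where xs: "length xs = 7" "distinct xs" "distinct (map (\<lambda>(i, j). c {xs ! i, xs ! j}) L)"
    using assms unfolding rainbow_copy_def by (elim exE conjE)
  obtain x0 x1 x2 x3 x4 x5 x6 where "xs = [x0, x1, x2, x3, x4, x5, x6]"
    using xs(1) by (auto simp: numeral_eq_Suc length_Suc_conv)
  then have "distinct [x0, x1, x2, x3, x4, x5, x6] \<and> distinct (map (\<lambda>(i, j). c {[x0, x1, x2, x3, x4, x5, x6] ! i, [x0, x1, x2, x3, x4, x5, x6] ! j}) L)"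
    using xs(2,3) by simp
  then show ?thesis by - (rule exI[of _ x0], rule exI[of _ x1], rule exI[of _ x2], rule exI[of _ x3], rule exI[of _ x4], rule exI[of _ x5], rule exI[of _ x6])
qed

lemma cross_same: "cross_col m u v = 1 \<longleftrightarrow> even u = even v"
  by (auto simp: cross_col_def odd_col_def)

lemma cross_at_odd: "odd u \<Longrightarrow> even v \<Longrightarrow> even w \<Longrightarrow> cross_col m u v = cross_col m u w"
  by (auto simp: cross_col_def)

lemma cross_path:
  assumes "cross_col m v u \<noteq> cross_col m v w"
  shows "odd v \<longrightarrow> odd u \<or> odd w"
  using assms cross_at_odd by blast

text \<open>
  An odd vertex is incident with at most one cross edge of a rainbow subgraph, and at most one edge
  joins vertices of equal parity. This is contradictory on a cycle with four edges.
\<close>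

lemma no_C4: "\<not> rainbow_copy (pair_coloring (cross_col m)) n 4 C4_list"
proof
  assume "rainbow_copy (pair_coloring (cross_col m)) n 4 C4_list"
  then obtain a b c d where d: "distinct [cross_col m a b, cross_col m b c, cross_col m c d, cross_col m a d]"
    by (auto dest!: rainbow_copy_4D simp: C4_list_def pair_coloring_apply[OF col_sym(4)])
  note [simp] = col_sym(4)[of m b a] col_sym(4)[of m c b] col_sym(4)[of m d c] col_sym(4)[of m d a]
  have "odd a \<longrightarrow> odd b \<or> odd d" "odd b \<longrightarrow> odd a \<or> odd c" "odd c \<longrightarrow> odd b \<or> odd d" "odd d \<longrightarrow> odd a \<or> odd c"
    using d by (intro cross_path[of m]; simp)+
  moreover have "\<not> (cross_col m a b = 1 \<and> cross_col m b c = 1)" "\<not> (cross_col m a b = 1 \<and> cross_col m c d = 1)"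
    "\<not> (cross_col m a b = 1 \<and> cross_col m a d = 1)" "\<not> (cross_col m b c = 1 \<and> cross_col m c d = 1)"
    "\<not> (cross_col m b c = 1 \<and> cross_col m a d = 1)" "\<not> (cross_col m c d = 1 \<and> cross_col m a d = 1)"
    using d by auto
  ultimately show False unfolding cross_same by argo
qed

lemma no_S221: "\<not> rainbow_copy (pair_coloring (cross_col m)) n 6 S221_list"
proof
  assume "rainbow_copy (pair_coloring (cross_col m)) n 6 S221_list"
  then obtain z a b c d e where d: "distinct [cross_col m z a, cross_col m z b, cross_col m z c, cross_col m a d, cross_col m b e]"
    by (auto dest!: rainbow_copy_6D simp: S221_list_def pair_coloring_apply[OF col_sym(4)])
  note [simp] = col_sym(4)[of m a z] col_sym(4)[of m b z]
  have "odd z \<longrightarrow> odd a \<or> odd b" "odd z \<longrightarrow> odd a \<or> odd c" "odd z \<longrightarrow> odd b \<or> odd c"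
    "odd a \<longrightarrow> odd z \<or> odd d" "odd b \<longrightarrow> odd z \<or> odd e"
    using d by (intro cross_path[of m]; simp)+
  moreover have "\<not> (cross_col m z a = 1 \<and> cross_col m z b = 1)" "\<not> (cross_col m z a = 1 \<and> cross_col m z c = 1)"
    "\<not> (cross_col m z b = 1 \<and> cross_col m z c = 1)" "\<not> (cross_col m z a = 1 \<and> cross_col m a d = 1)"
    "\<not> (cross_col m z a = 1 \<and> cross_col m b e = 1)" "\<not> (cross_col m z b = 1 \<and> cross_col m a d = 1)"
    "\<not> (cross_col m z b = 1 \<and> cross_col m b e = 1)" "\<not> (cross_col m a d = 1 \<and> cross_col m b e = 1)"
    using d by auto
  ultimately show False unfolding cross_same by argo
qed

lemma block_of_two:
  fixes x :: nat
  shows "x mod 4 = 0 \<Longrightarrow> x = 8 * (x div 8) \<or> x = 8 * (x div 8) + 4"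
    and "x mod 3 = 0 \<Longrightarrow> x = 6 * (x div 6) \<or> x = 6 * (x div 6) + 3"
  by presburger+

text \<open>
  The two ends of a matching edge look alike to every other vertex, so a rainbow triangle contains no
  matching edge.
\<close>

lemma four_twin:
  assumes "4 \<le> four_col m u v" "u \<noteq> v" "w \<noteq> u" "w \<noteq> v"
  shows "four_col m u w = four_col m v w"
proof -
  have uv: "u mod 4 = 0" "v mod 4 = 0" "u div 8 = v div 8"
    using assms(1) by (auto simp: four_col_def base4_def split: if_splits)
  have "\<not> (w mod 4 = 0 \<and> w div 8 = u div 8)"
  proof
    assume w: "w mod 4 = 0 \<and> w div 8 = u div 8"
    define q where "q = u div 8"
    have "x \<in> {8 * q, 8 * q + 4}" if "x mod 4 = 0" "x div 8 = q" for x
      using block_of_two(1)[OF that(1)] that(2) by auto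
    then have "u \<in> {8 * q, 8 * q + 4}" "v \<in> {8 * q, 8 * q + 4}" "w \<in> {8 * q, 8 * q + 4}"
      using uv w unfolding q_def by simp_all
    then show False using assms(2-) by auto
  qed
  then show ?thesis using uv by (auto simp: four_col_def)
qed

lemma four_new: "4 \<le> four_col m u v \<Longrightarrow> u mod 4 = 0"
  by (auto simp: four_col_def base4_def split: if_splits)

lemma four_base: "four_col m u v < 4 \<Longrightarrow> four_col m u v = base4 (u mod 4) (v mod 4)"
  by (auto simp: four_col_def)

lemma base4_range: "base4 p q \<in> {1, 2, 3}"
  by (auto simp: base4_def)

lemma base4_triangle:
  assumes "p < 4" "q < 4" "r < 4" "distinct [base4 p q, base4 p r, base4 q r]"
  shows "p \<noteq> 0"
proof
  assume "p = 0"
  then show False using assms unfolding less_4 by (elim disjE) (auto simp: base4_def)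
qed

text \<open>
  A rainbow triangle has the colors 1, 2 and 3, so it avoids the class 0 and the pendant edge cannot
  have a further color.
\<close>

lemma no_paw: "\<not> rainbow_copy (pair_coloring (four_col m)) n 4 paw_list"
proof
  assume "rainbow_copy (pair_coloring (four_col m)) n 4 paw_list"
  then obtain x y z w where dv: "distinct [x, y, z, w]"
    and d: "distinct [four_col m x y, four_col m x z, four_col m y z, four_col m x w]"
    by (auto dest!: rainbow_copy_4D simp: paw_list_def pair_coloring_apply[OF col_sym(3)])
  note [simp] = col_sym(3)[of m y x] col_sym(3)[of m z x] col_sym(3)[of m z y]
  have small: "four_col m x y < 4" "four_col m x z < 4" "four_col m y z < 4"
    using four_twin[of m x y z] four_twin[of m x z y] four_twin[of m y z x] dv d by (auto simp: not_le[symmetric])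
  then have "x mod 4 \<noteq> 0"
    using base4_triangle[of "x mod 4" "y mod 4" "z mod 4"] d
    by (simp add: small[THEN four_base])
  then have "four_col m x w < 4" using four_new[of m x w] by linarith
  then have "four_col m x w \<in> {1, 2, 3}" using base4_range[of "x mod 4" "w mod 4"] four_base[of m x w] by simp
  moreover have "four_col m x y \<in> {1, 2, 3}" "four_col m x z \<in> {1, 2, 3}" "four_col m y z \<in> {1, 2, 3}"
    using base4_range by (auto simp: small[THEN four_base] simp del: insert_iff)
  ultimately show False using d by (simp, argo)
qed

lemma match_new: "4 \<le> match_col m u v \<Longrightarrow> u mod 3 = 0 \<and> v mod 3 = 0 \<and> u div 6 = v div 6"
  by (auto simp: match_col_def base3_def split: if_splits)

lemma match_twin:
  assumes "4 \<le> match_col m u v" "u \<noteq> v" "w \<noteq> u" "w \<noteq> v"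
  shows "match_col m u w = match_col m v w" "match_col m u w < 4"
proof -
  have uv: "u mod 3 = 0" "v mod 3 = 0" "u div 6 = v div 6" using match_new[OF assms(1)] by auto
  have "\<not> (w mod 3 = 0 \<and> w div 6 = u div 6)"
  proof
    assume w: "w mod 3 = 0 \<and> w div 6 = u div 6"
    define q where "q = u div 6"
    have "x \<in> {6 * q, 6 * q + 3}" if "x mod 3 = 0" "x div 6 = q" for x
      using block_of_two(2)[OF that(1)] that(2) by auto
    then have "u \<in> {6 * q, 6 * q + 3}" "v \<in> {6 * q, 6 * q + 3}" "w \<in> {6 * q, 6 * q + 3}"
      using uv w unfolding q_def by simp_all
    then show False using assms(2-) by auto
  qed
  then show "match_col m u w = match_col m v w" "match_col m u w < 4"
    using uv by (auto simp: match_col_def base3_def)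
qed

lemma match_palette:
  shows "u mod 3 = 0 \<Longrightarrow> match_col m u v < 4 \<Longrightarrow> match_col m u v \<in> {1, 3}"
    and "u mod 3 = 1 \<Longrightarrow> match_col m u v \<in> {1, 2}"
    and "u mod 3 = 2 \<Longrightarrow> match_col m u v \<in> {2, 3}"
    and "match_col m u v \<noteq> 0"
proof -
  have v: "v mod 3 < 3" by simp
  show "u mod 3 = 0 \<Longrightarrow> match_col m u v < 4 \<Longrightarrow> match_col m u v \<in> {1, 3}"
    by (auto simp: match_col_def base3_def)
  show "u mod 3 = 1 \<Longrightarrow> match_col m u v \<in> {1, 2}"
    using v by (auto simp: match_col_def base3_def)
  show "u mod 3 = 2 \<Longrightarrow> match_col m u v \<in> {2, 3}"
    using v by (auto simp: match_col_def base3_def)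
  show "match_col m u v \<noteq> 0" by (auto simp: match_col_def base3_def)
qed

text \<open>
  Three colors at a vertex are 1, 3 and a color of the matching.
\<close>

lemma match_degree_3:
  assumes "distinct [u, v1, v2, v3]" and d: "distinct [match_col m u v1, match_col m u v2, match_col m u v3]"
  shows "{1, 3} \<subseteq> {match_col m u v1, match_col m u v2, match_col m u v3}"
proof -
  have "u mod 3 < 3" by simp
  then consider "u mod 3 = 1" | "u mod 3 = 2" | "u mod 3 = 0" by linarith
  then show ?thesis
  proof cases
    case 1
    then have "match_col m u v \<in> {1, 2}" for v by (rule match_palette(2))
    from this[of v1] this[of v2] this[of v3] show ?thesis using d by auto
  next
    case 2
    then have "match_col m u v \<in> {2, 3}" for v by (rule match_palette(3))
    from this[of v1] this[of v2] this[of v3] show ?thesis using d by auto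
  next
    case 3
    have small: "match_col m u v \<in> {1, 3}" if "match_col m u v < 4" for v
      by (rule match_palette(1)[OF 3 that])
    have other: "match_col m u w \<in> {1, 3}" if "4 \<le> match_col m u v" "u \<noteq> v" "w \<noteq> u" "w \<noteq> v" for v w
      by (rule small[OF match_twin(2)[OF that]])
    consider "4 \<le> match_col m u v1" | "4 \<le> match_col m u v2" | "match_col m u v1 < 4" "match_col m u v2 < 4"
      by linarith
    then show ?thesis
    proof cases
      case 1
      then have "match_col m u v2 \<in> {1, 3}" "match_col m u v3 \<in> {1, 3}"
        using other[of v1] assms(1) by auto
      then show ?thesis using d by auto
    next
      case 2
      then have "match_col m u v1 \<in> {1, 3}" "match_col m u v3 \<in> {1, 3}"
        using other[of v2] assms(1) by auto
      then show ?thesis using d by auto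
    next
      case 3
      then have "match_col m u v1 \<in> {1, 3}" "match_col m u v2 \<in> {1, 3}" using small by auto
      then show ?thesis using d by auto
    qed
  qed
qed

text \<open>
  The color 2 does not occur at a matching edge, and matching edges do not meet.
\<close>

lemma match_path:
  assumes "distinct [p, q, s]" "match_col m q p \<noteq> match_col m q s"
  shows "match_col m q p \<in> {1, 3} \<or> match_col m q s \<in> {1, 3}"
proof -
  have "q mod 3 < 3" by simp
  then consider "q mod 3 = 0" | "q mod 3 = 1" | "q mod 3 = 2" by linarith
  then show ?thesis
  proof cases
    case 1
    then show ?thesis
      using match_palette(1)[of q m p] match_palette(1)[of q m s] match_twin(2)[of m q p s] assms(1)
      by (cases "match_col m q p < 4") auto
  next
    case 2 then show ?thesis using match_palette(2)[of q m p] match_palette(2)[of q m s] assms(2) by auto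
  next
    case 3 then show ?thesis using match_palette(3)[of q m p] match_palette(3)[of q m s] assms(2) by auto
  qed
qed

lemmas match_apply = pair_coloring_apply[OF col_sym(2)]

lemma no_K14: "\<not> rainbow_copy (pair_coloring (match_col m)) n 5 K14_list"
proof
  assume "rainbow_copy (pair_coloring (match_col m)) n 5 K14_list"
  then obtain z a b c d where dv: "distinct [z, a, b, c, d]"
    and d: "distinct [match_col m z a, match_col m z b, match_col m z c, match_col m z d]"
    by (auto dest!: rainbow_copy_5D simp: K14_list_def match_apply)
  have "{1, 3} \<subseteq> {match_col m z a, match_col m z b, match_col m z c}"
    "{1, 3} \<subseteq> {match_col m z a, match_col m z b, match_col m z d}"
    "{1, 3} \<subseteq> {match_col m z a, match_col m z c, match_col m z d}"
    "{1, 3} \<subseteq> {match_col m z b, match_col m z c, match_col m z d}"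
    by (rule match_degree_3; use dv d in simp)+
  then have "1 \<in> {match_col m z a, match_col m z b, match_col m z c}"
    "1 \<in> {match_col m z a, match_col m z b, match_col m z d}"
    "1 \<in> {match_col m z a, match_col m z c, match_col m z d}"
    "1 \<in> {match_col m z b, match_col m z c, match_col m z d}" by blast+
  then show False using d by (simp, argo)
qed

lemma common_entry:
  assumes "distinct [e, p, q, r, s]" "x \<in> {e, p, q}" "x \<in> {e, r, s}" shows "e = x"
  using assms by auto

lemma no_S22: "\<not> rainbow_copy (pair_coloring (match_col m)) n 6 S22_list"
proof
  assume "rainbow_copy (pair_coloring (match_col m)) n 6 S22_list"
  then obtain z y a b c d where dv: "distinct [z, y, a, b, c, d]"
    and d: "distinct [match_col m z y, match_col m z a, match_col m z b, match_col m y c, match_col m y d]"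
    by (auto dest!: rainbow_copy_6D simp: S22_list_def match_apply)
  have "{1, 3} \<subseteq> {match_col m z y, match_col m z a, match_col m z b}"
    by (rule match_degree_3; use dv d in simp)
  moreover have "{1, 3} \<subseteq> {match_col m y z, match_col m y c, match_col m y d}"
    by (rule match_degree_3; use dv d in \<open>auto simp: col_sym(2)[of m y z]\<close>)
  ultimately have t: "1 \<in> {match_col m z y, match_col m z a, match_col m z b}"
    "1 \<in> {match_col m z y, match_col m y c, match_col m y d}"
    "3 \<in> {match_col m z y, match_col m z a, match_col m z b}"
    "3 \<in> {match_col m z y, match_col m y c, match_col m y d}"
    by (simp_all only: col_sym(2)[of m y z] insert_subset)
  have "match_col m z y = 1" by (rule common_entry[OF d t(1,2)])
  moreover have "match_col m z y = 3" by (rule common_entry[OF d t(3,4)])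
  ultimately show False by simp
qed

lemma no_S113: "\<not> rainbow_copy (pair_coloring (match_col m)) n 6 S113_list"
proof
  assume "rainbow_copy (pair_coloring (match_col m)) n 6 S113_list"
  then obtain z a b p q s where dv: "distinct [z, a, b, p, q, s]"
    and d: "distinct [match_col m z a, match_col m z b, match_col m z p, match_col m p q, match_col m q s]"
    by (auto dest!: rainbow_copy_6D simp: S113_list_def match_apply)
  note [simp] = col_sym(2)[of m p q]
  have "{1, 3} \<subseteq> {match_col m z a, match_col m z b, match_col m z p}"
    by (rule match_degree_3; use dv d in simp)
  moreover have "match_col m q p \<in> {1, 3} \<or> match_col m q s \<in> {1, 3}"
    by (rule match_path; use dv d in simp)
  ultimately show False using d by (simp, argo)
qed

lemma no_K13_P3: "\<not> rainbow_copy (pair_coloring (match_col m)) n 7 K13_P3_list"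
proof
  assume "rainbow_copy (pair_coloring (match_col m)) n 7 K13_P3_list"
  then obtain z a b c p q s where dv: "distinct [z, a, b, c, p, q, s]"
    and d: "distinct [match_col m z a, match_col m z b, match_col m z c, match_col m p q, match_col m q s]"
    by (auto dest!: rainbow_copy_7D simp: K13_P3_list_def match_apply)
  note [simp] = col_sym(2)[of m p q]
  have "{1, 3} \<subseteq> {match_col m z a, match_col m z b, match_col m z c}"
    by (rule match_degree_3; use dv d in simp)
  moreover have "match_col m q p \<in> {1, 3} \<or> match_col m q s \<in> {1, 3}"
    by (rule match_path; use dv d in simp)
  ultimately show False using d by (simp, argo)
qed

lemma all_of_three:
  fixes x y z :: nat
  assumes "x \<in> {1, 2, 3}" "y \<in> {1, 2, 3}" "z \<in> {1, 2, 3}" "distinct [x, y, z]"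
  shows "{1, 3} \<subseteq> {x, y, z}"
  using assms by (elim insertE emptyE) simp_all

lemma no_K3_P3: "\<not> rainbow_copy (pair_coloring (match_col m)) n 6 K3_P3_list"
proof
  assume "rainbow_copy (pair_coloring (match_col m)) n 6 K3_P3_list"
  then obtain x y z p q s where dv: "distinct [x, y, z, p, q, s]"
    and d: "distinct [match_col m x y, match_col m x z, match_col m y z, match_col m p q, match_col m q s]"
    by (auto dest!: rainbow_copy_6D simp: K3_P3_list_def match_apply)
  note [simp] = col_sym(2)[of m p q]
  have "match_col m x y < 4" "match_col m x z < 4" "match_col m y z < 4"
    using match_twin(1)[of m x y z] match_twin(1)[of m x z y] match_twin(1)[of m y z x] dv d
      col_sym(2)[of m y x] col_sym(2)[of m z x] col_sym(2)[of m z y] by (auto simp: not_le[symmetric])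
  then have "match_col m x y \<in> {1, 2, 3}" "match_col m x z \<in> {1, 2, 3}" "match_col m y z \<in> {1, 2, 3}"
    using match_palette(4)[of m x y] match_palette(4)[of m x z] match_palette(4)[of m y z] by auto
  then have "{1, 3} \<subseteq> {match_col m x y, match_col m x z, match_col m y z}"
    by (rule all_of_three) (use d in simp)
  moreover have "match_col m q p \<in> {1, 3} \<or> match_col m q s \<in> {1, 3}"
    by (rule match_path; use dv d in simp)
  ultimately have "match_col m q p \<in> {match_col m x y, match_col m x z, match_col m y z} \<or>
      match_col m q s \<in> {match_col m x y, match_col m x z, match_col m y z}" by blast
  then show False using d by auto
qed

lemma ASMS_excluded_copies:
  assumes "H \<in> ASMS_graphs"
  shows "\<not> has_copy 4 C4_list H" "\<not> has_copy 6 S221_list H" "\<not> has_copy 4 paw_list H" "\<not> has_copy 5 K14_list H"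
    "\<not> has_copy 6 S22_list H" "\<not> has_copy 6 S113_list H" "\<not> has_copy 7 K13_P3_list H" "\<not> has_copy 6 K3_P3_list H"
proof -
  note cover = lessThan_nat_numeral lessThan_Suc doubleton_eq_iff
  show "\<not> has_copy 4 C4_list H"
    by (rule no_copy_if_bad_coloring[OF assms bad_cross no_C4]) (auto simp: C4_list_def cover)
  show "\<not> has_copy 6 S221_list H"
    by (rule no_copy_if_bad_coloring[OF assms bad_cross no_S221]) (auto simp: S221_list_def cover)
  show "\<not> has_copy 4 paw_list H"
    by (rule no_copy_if_bad_coloring[OF assms bad_four no_paw]) (auto simp: paw_list_def cover)
  show "\<not> has_copy 5 K14_list H"
    by (rule no_copy_if_bad_coloring[OF assms bad_match no_K14]) (auto simp: K14_list_def cover)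
  show "\<not> has_copy 6 S22_list H"
    by (rule no_copy_if_bad_coloring[OF assms bad_match no_S22]) (auto simp: S22_list_def cover)
  show "\<not> has_copy 6 S113_list H"
    by (rule no_copy_if_bad_coloring[OF assms bad_match no_S113]) (auto simp: S113_list_def cover)
  show "\<not> has_copy 7 K13_P3_list H"
    by (rule no_copy_if_bad_coloring[OF assms bad_match no_K13_P3]) (auto simp: K13_P3_list_def cover)
  show "\<not> has_copy 6 K3_P3_list H"
    by (rule no_copy_if_bad_coloring[OF assms bad_match no_K3_P3]) (auto simp: K3_P3_list_def cover)
qed

text \<open>
  Edges that avoid the centre of the star have one of three colors. The copy of \<open>H\<close> need not contain
  that centre; then \<open>H\<close> has at most three edges and any vertex will do.
\<close>

lemma ASMS_few_edges_off_vertex: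
  assumes H: "H \<in> ASMS_graphs"
  obtains v where "v \<in> verts H" "card {e \<in> edges H. v \<notin> e} \<le> 3"
proof -
  have simple: "simple_graph H" and ord: "3 \<le> card (verts H)"
    using H by (auto simp: ASMS_graphs_def graph_order_def)
  obtain m n where mn: "\<not> rainbow_free n (pair_coloring (star_col m)) H"
    using ASMS_rainbow_in_bad_coloring[OF H bad_star] by blast
  then obtain G where G: "subgraph G (complete_graph n)" "isomorphic H G" "rainbow (pair_coloring (star_col m)) G"
    unfolding rainbow_free_def by blast
  obtain \<phi> where \<phi>: "bij_betw \<phi> (verts H) (verts G)" "(\<lambda>e. \<phi> ` e) ` edges H = edges G"
    using G(2) unfolding isomorphic_def by blast
  have inj: "inj_on \<phi> (verts H)" using \<phi>(1) by (simp add: bij_betw_def)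
  have HV: "e \<subseteq> verts H" if "e \<in> edges H" for e using simple that by (auto simp: simple_graph_def)
  have sG: "simple_graph G" using G(1) by (simp add: subgraph_def)
  let ?c = "pair_coloring (star_col m)"
  have few: "card {e \<in> edges G. 0 \<notin> e} \<le> 3"
  proof -
    have "?c e \<in> {1, 2, 3}" if e: "e \<in> edges G" "0 \<notin> e" for e
    proof -
      obtain u v where "e = {u, v}" "u \<noteq> v" by (rule simple_edgeE[OF sG e(1)])
      then show ?thesis using e(2) pair_coloring_apply[of "star_col m" u v, OF col_sym(1)]
        by (auto simp: star_col_def base3_def)
    qed
    then have "card {e \<in> edges G. 0 \<notin> e} \<le> card {1::nat, 2, 3}"
      using G(3) by (intro card_inj_on_le[of ?c]) (auto simp: rainbow_def intro: inj_on_subset)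
    then show ?thesis by simp
  qed
  have finG: "finite (edges G)"
  proof -
    have "edges G \<subseteq> Pow (verts G)" "finite (verts G)" using sG by (auto simp: simple_graph_def)
    then show ?thesis by (meson finite_Pow_iff finite_subset)
  qed
  obtain v where v: "v \<in> verts H" "0 \<in> verts G \<longrightarrow> \<phi> v = 0"
  proof (cases "0 \<in> verts G")
    case True
    then obtain v where "v \<in> verts H" "\<phi> v = 0" using \<phi>(1) by (metis bij_betw_imp_surj_on imageE)
    then show ?thesis using that by blast
  next
    case False
    have "verts H \<noteq> {}" using ord by auto
    then show ?thesis using that False by blast
  qed
  have "card {e \<in> edges H. v \<notin> e} \<le> card {e \<in> edges G. 0 \<notin> e}"
  proof (rule card_inj_on_le[of "(`) \<phi>"])
    show "inj_on ((`) \<phi>) {e \<in> edges H. v \<notin> e}"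
    proof (rule inj_onI)
      fix e e' assume "e \<in> {e \<in> edges H. v \<notin> e}" "e' \<in> {e \<in> edges H. v \<notin> e}" "\<phi> ` e = \<phi> ` e'"
      then show "e = e'" using inj_on_image_eq_iff[OF inj HV HV, of e e'] by simp
    qed
    show "(`) \<phi> ` {e \<in> edges H. v \<notin> e} \<subseteq> {e \<in> edges G. 0 \<notin> e}"
    proof (rule image_subsetI)
      fix e assume e: "e \<in> {e \<in> edges H. v \<notin> e}"
      have "\<phi> ` e \<in> edges G" using e \<phi>(2) by auto
      moreover have "0 \<notin> \<phi> ` e"
      proof
        assume "0 \<in> \<phi> ` e"
        then obtain w where w: "w \<in> e" "\<phi> w = 0" by auto
        have "w \<in> verts H" using w(1) e HV by blast
        then have "0 \<in> verts G" using w(2) \<phi>(1) by (metis bij_betwE)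
        then have "\<phi> v = \<phi> w" using v(2) w(2) by simp
        then have "v = w" using inj v(1) \<open>w \<in> verts H\<close> by (meson inj_onD)
        then show False using w(1) e by blast
      qed
      ultimately show "\<phi> ` e \<in> {e \<in> edges G. 0 \<notin> e}" by blast
    qed
    show "finite {e \<in> edges G. 0 \<notin> e}" using finG by simp
  qed
  then have "card {e \<in> edges H. v \<notin> e} \<le> 3" using few by (rule order_trans)
  then show ?thesis by (rule that[OF v(1)])
qed

section \<open>Shapes of small edge sets\<close>

lemma has_copyI:
  assumes "distinct xs" "length xs = r" "\<forall>(i, j)\<in>set L. {xs ! i, xs ! j} \<in> edges H"
  shows "has_copy r L H"
  using assms unfolding has_copy_def by blast

text \<open>
  An embedding stated for the edge set alone. A graph without isolated vertices is determined by its
  edges.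
\<close>

definition fits :: "'a set set \<Rightarrow> nat \<Rightarrow> (nat \<times> nat) list \<Rightarrow> bool" where
  "fits E r L \<longleftrightarrow> (\<exists>\<phi>. inj_on \<phi> (\<Union>E) \<and> \<phi> ` \<Union>E \<subseteq> {..<r} \<and> (\<forall>e\<in>E. \<phi> ` e \<in> (\<lambda>(i, j). {i, j}) ` set L))"

lemma fits_imp_isomorphic_to_subgraph:
  assumes H: "simple_graph H" "no_isolated_vertices H" and fits: "fits (edges H) r L"
  shows "isomorphic_to_subgraph H (list_graph r L)"
proof -
  have "verts H = \<Union>(edges H)"
  proof
    show "verts H \<subseteq> \<Union>(edges H)"
    proof
      fix v assume "v \<in> verts H"
      then have "graph_degree H v \<noteq> 0" using H(2) by (simp add: no_isolated_vertices_def)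
      then have "{e \<in> edges H. v \<in> e} \<noteq> {}" unfolding graph_degree_def by (metis card.empty)
      then show "v \<in> \<Union>(edges H)" by blast
    qed
    show "\<Union>(edges H) \<subseteq> verts H" using H(1) by (auto simp: simple_graph_def)
  qed
  then show ?thesis
    using fits unfolding isomorphic_to_subgraph_iff[OF H(1)] fits_def list_graph_def by auto
qed

text \<open>
  The list \<open>ps\<close> pairs vertices with positions. Only vertices that occur are listed, so no vertex
  has to be found for unused positions, of which a finite type may have too few.
\<close>

lemma fitsI:
  assumes "distinct (map fst ps)" "distinct (map snd ps)" "\<forall>p\<in>set ps. snd p < r"
    and "\<forall>e\<in>E. \<exists>p\<in>set ps. \<exists>q\<in>set ps. e = {fst p, fst q} \<and> (snd p, snd q) \<in> set L"
  shows "fits E r L"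
proof -
  define \<phi> where "\<phi> v = the (map_of ps v)" for v
  have \<phi>: "\<phi> (fst p) = snd p" if "p \<in> set ps" for p
    unfolding \<phi>_def using map_of_is_SomeI[OF assms(1), of "fst p" "snd p"] that by simp
  have U: "\<exists>p\<in>set ps. v = fst p" if "v \<in> \<Union>E" for v using that assms(4) by fastforce
  have "inj_on \<phi> (\<Union>E)"
  proof (rule inj_onI)
    fix u v assume "u \<in> \<Union>E" "v \<in> \<Union>E" and eq: "\<phi> u = \<phi> v"
    then obtain p q where pq: "p \<in> set ps" "u = fst p" "q \<in> set ps" "v = fst q" using U by metis
    then have "snd p = snd q" using eq \<phi> by simp
    then have "p = q" using assms(2) pq by (metis distinct_map inj_onD)
    then show "u = v" using pq by simp
  qed
  moreover have "\<phi> ` \<Union>E \<subseteq> {..<r}"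
  proof
    fix i assume "i \<in> \<phi> ` \<Union>E"
    then obtain v where v: "v \<in> \<Union>E" "i = \<phi> v" by blast
    obtain p where "p \<in> set ps" "v = fst p" using U[OF v(1)] by blast
    then show "i \<in> {..<r}" using v(2) \<phi> assms(3) by simp
  qed
  moreover have "\<phi> ` e \<in> (\<lambda>(i, j). {i, j}) ` set L" if e: "e \<in> E" for e
  proof -
    obtain p q where pq: "p \<in> set ps" "q \<in> set ps" "e = {fst p, fst q}" "(snd p, snd q) \<in> set L"
      using assms(4) e by blast
    have "\<phi> ` e = {snd p, snd q}" using pq \<phi> by simp
    then show ?thesis using pq(4) by force
  qed
  ultimately show ?thesis unfolding fits_def by blast
qed

definition shape :: "nat \<Rightarrow> (nat \<times> nat) list \<Rightarrow> 'a set set \<Rightarrow> bool" where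
  "shape r L E \<longleftrightarrow> (\<exists>xs. length xs = r \<and> distinct xs \<and> E = (\<lambda>(i, j). {xs ! i, xs ! j}) ` set L)"

lemma shapeI: "distinct xs \<Longrightarrow> length xs = r \<Longrightarrow> E = (\<lambda>(i, j). {xs ! i, xs ! j}) ` set L \<Longrightarrow> shape r L E"
  unfolding shape_def by blast

definition covers :: "nat \<Rightarrow> (nat \<times> nat) list \<Rightarrow> bool" where
  "covers r L \<longleftrightarrow> (\<forall>p\<in>set L. fst p < r \<and> snd p < r) \<and> (\<forall>i\<in>set [0..<r]. \<exists>p\<in>set L. i = fst p \<or> i = snd p)"

definition join :: "nat \<Rightarrow> (nat \<times> nat) list \<Rightarrow> (nat \<times> nat) list \<Rightarrow> (nat \<times> nat) list" where
  "join r L M = L @ map (\<lambda>(i, j). (r + i, r + j)) M"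

lemma shape_join:
  assumes L: "shape r L E" "covers r L" and M: "shape s M F" "covers s M" and disj: "\<Union>E \<inter> \<Union>F = {}"
  shows "shape (r + s) (join r L M) (E \<union> F)"
proof -
  obtain xs where xs: "length xs = r" "distinct xs" "E = (\<lambda>(i, j). {xs ! i, xs ! j}) ` set L"
    using L(1) unfolding shape_def by (elim exE conjE)
  obtain ys where ys: "length ys = s" "distinct ys" "F = (\<lambda>(i, j). {ys ! i, ys ! j}) ` set M"
    using M(1) unfolding shape_def by (elim exE conjE)
  have cov: "set zs \<subseteq> \<Union>((\<lambda>(i, j). {zs ! i, zs ! j}) ` set K)" if K: "covers t K" and zs: "length zs = t"
    for zs :: "'a list" and t K
  proof
    fix z assume "z \<in> set zs"
    then obtain i where i: "i < t" "z = zs ! i" using zs by (auto simp: in_set_conv_nth)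
    have "\<exists>p\<in>set K. i = fst p \<or> i = snd p" using K i(1) by (simp add: covers_def)
    then obtain p where "p \<in> set K" "i = fst p \<or> i = snd p" by (elim bexE)
    then show "z \<in> \<Union>((\<lambda>(i, j). {zs ! i, zs ! j}) ` set K)" using i(2) by (auto simp: case_prod_beta)
  qed
  have "set xs \<inter> set ys = {}" using cov[OF L(2) xs(1)] cov[OF M(2) ys(1)] disj xs(3) ys(3) by blast
  then have "distinct (xs @ ys)" using xs(2) ys(2) by simp
  moreover have "E \<union> F = (\<lambda>(i, j). {(xs @ ys) ! i, (xs @ ys) ! j}) ` set (join r L M)"
  proof -
    have "E = (\<lambda>(i, j). {(xs @ ys) ! i, (xs @ ys) ! j}) ` set L"
      unfolding xs(3) using L(2) xs(1) by (intro image_cong) (auto simp: covers_def nth_append)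
    moreover have "F = (\<lambda>(i, j). {(xs @ ys) ! i, (xs @ ys) ! j}) ` set (map (\<lambda>(i, j). (r + i, r + j)) M)"
      unfolding ys(3) set_map image_image using xs(1) by (intro image_cong) (auto simp: nth_append)
    ultimately show ?thesis by (simp add: join_def image_Un)
  qed
  ultimately show ?thesis using xs(1) ys(1) by (intro shapeI[of "xs @ ys"]) simp_all
qed

text \<open>
  An embedding between edge lists is a list of positions \<open>\<pi>\<close>, so each instance is decided by
  simplification.
\<close>

lemma shape_fits:
  assumes "shape r L E" "list_all (\<lambda>(i, j). i < r \<and> j < r) L"
    and "length \<pi> = r" "distinct \<pi>" "list_all (\<lambda>i. i < t) \<pi>"
    and "list_all (\<lambda>(i, j). (\<pi> ! i, \<pi> ! j) \<in> set T \<or> (\<pi> ! j, \<pi> ! i) \<in> set T) L"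
  shows "fits E t T"
proof -
  obtain xs where xs: "length xs = r" "distinct xs" "E = (\<lambda>(i, j). {xs ! i, xs ! j}) ` set L"
    using assms(1) unfolding shape_def by (elim exE conjE)
  show ?thesis
  proof (rule fitsI[of "zip xs \<pi>"])
    show "\<forall>e\<in>E. \<exists>p\<in>set (zip xs \<pi>). \<exists>q\<in>set (zip xs \<pi>). e = {fst p, fst q} \<and> (snd p, snd q) \<in> set T"
    proof
      fix e assume "e \<in> E"
      then obtain k where k: "k \<in> set L" "e = {xs ! fst k, xs ! snd k}" using xs(3) by auto
      have lt: "fst k < r" "snd k < r" using assms(2) k(1) by (auto simp: list_all_iff)
      have z: "(xs ! fst k, \<pi> ! fst k) \<in> set (zip xs \<pi>)" "(xs ! snd k, \<pi> ! snd k) \<in> set (zip xs \<pi>)"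
        using lt xs(1) assms(3) by (auto simp: set_zip)
      have "(\<pi> ! fst k, \<pi> ! snd k) \<in> set T \<or> (\<pi> ! snd k, \<pi> ! fst k) \<in> set T"
        using assms(6) k(1) by (auto simp: list_all_iff)
      then show "\<exists>p\<in>set (zip xs \<pi>). \<exists>q\<in>set (zip xs \<pi>). e = {fst p, fst q} \<and> (snd p, snd q) \<in> set T"
      proof
        assume "(\<pi> ! fst k, \<pi> ! snd k) \<in> set T"
        then show ?thesis by (intro bexI[OF _ z(1)] bexI[OF _ z(2)]) (simp add: k(2))
      next
        assume "(\<pi> ! snd k, \<pi> ! fst k) \<in> set T"
        then show ?thesis by (intro bexI[OF _ z(2)] bexI[OF _ z(1)]) (simp add: k(2) insert_commute)
      qed
    qed
  qed (use xs assms(3-5) in \<open>auto simp: list_all_iff dest: set_zip_rightD\<close>)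
qed

lemma shape_has_copy:
  assumes "shape r L E" "E \<subseteq> edges H" "distinct \<sigma>" "list_all (\<lambda>i. i < r) \<sigma>" "length \<sigma> = k"
    and "list_all (\<lambda>(i, j). i < k \<and> j < k \<and> ((\<sigma> ! i, \<sigma> ! j) \<in> set L \<or> (\<sigma> ! j, \<sigma> ! i) \<in> set L)) P"
  shows "has_copy k P H"
proof -
  obtain xs where xs: "length xs = r" "distinct xs" "E = (\<lambda>(i, j). {xs ! i, xs ! j}) ` set L"
    using assms(1) unfolding shape_def by (elim exE conjE)
  show ?thesis
  proof (rule has_copyI[of "map ((!) xs) \<sigma>"])
    have "inj_on ((!) xs) (set \<sigma>)"
      using assms(4) xs(1,2) by (auto simp: inj_on_def list_all_iff nth_eq_iff_index_eq)
    then show "distinct (map ((!) xs) \<sigma>)" using assms(3) by (simp add: distinct_map)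
    show "length (map ((!) xs) \<sigma>) = k" using assms(5) by simp
    show "\<forall>(i, j)\<in>set P. {map ((!) xs) \<sigma> ! i, map ((!) xs) \<sigma> ! j} \<in> edges H"
    proof
      fix p assume p: "p \<in> set P"
      define u where "u = \<sigma> ! fst p"
      define w where "w = \<sigma> ! snd p"
      have lt: "fst p < k" "snd p < k" and "(u, w) \<in> set L \<or> (w, u) \<in> set L"
        using assms(6) p by (auto simp: list_all_iff u_def w_def)
      then have "{xs ! u, xs ! w} \<in> E" unfolding xs(3) by (force simp: insert_commute)
      then show "case p of (i, j) \<Rightarrow> {map ((!) xs) \<sigma> ! i, map ((!) xs) \<sigma> ! j} \<in> edges H"
        using assms(2,5) lt by (auto simp: case_prod_beta u_def w_def)
    qed
  qed
qed

definition "K2_l = [(0::nat,1::nat)]"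

definition "P3_l = [(0::nat,1::nat),(1,2)]"

definition "P4_l = [(0::nat,1::nat),(1,2),(2,3)]"

definition "P5_l = [(0::nat,1::nat),(1,2),(2,3),(3,4)]"

definition "K3_l = [(0::nat,1::nat),(1,2),(0,2)]"

definition "K13_l = [(0::nat,1::nat),(0,2),(0,3)]"

definition "P4plus_l = [(0::nat,1::nat),(1,2),(2,3),(1,4)]"

definition "twoK2_l = [(0::nat,1::nat),(2,3)]"

definition "threeK2_l = [(0::nat,1::nat),(2,3),(4,5)]"

definition "P3_K2_l = [(0::nat,1::nat),(1,2),(3,4)]"

lemmas shape_list_defs = K2_l_def P3_l_def P4_l_def P5_l_def K3_l_def K13_l_def P4plus_l_def twoK2_l_def threeK2_l_def P3_K2_l_def

lemma covers_shape_lists: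
  "covers 2 K2_l" "covers 3 P3_l" "covers 4 P4_l" "covers 5 P5_l" "covers 3 K3_l" "covers 4 K13_l" "covers 5 P4plus_l"
  "covers 4 twoK2_l" "covers 6 threeK2_l" "covers 5 P3_K2_l"
  by (simp_all add: covers_def shape_list_defs upt_rec)

definition listed :: "'a set set \<Rightarrow> bool" where
  "listed E \<longleftrightarrow> (\<exists>(r, L)\<in>maximal_lists. fits E r L)"

lemma listedI:
  "fits E 7 P3_P4 \<Longrightarrow> listed E" "fits E 7 K2_P5 \<Longrightarrow> listed E" "fits E 8 K2_2P3 \<Longrightarrow> listed E"
  "fits E 7 twoK2_K3 \<Longrightarrow> listed E" "fits E 9 twoK2_P4plus \<Longrightarrow> listed E" "fits E 10 threeK2_K13 \<Longrightarrow> listed E"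
  by (auto simp: listed_def maximal_lists_def)

context
  fixes E F :: "'a set set"
  assumes disj: "\<Union>E \<inter> \<Union>F = {}"
begin
text \<open>
  The table of all pairs of shapes for the component of the distinguished vertex and the edges outside
  it: each pair either embeds into one of the six graphs or contains one of the excluded graphs.
\<close>

lemma listed_K2_K2: "shape 2 K2_l E \<Longrightarrow> shape 2 K2_l F \<Longrightarrow> listed (E \<union> F)"
  by (rule listedI(1), rule shape_fits[OF shape_join[OF _ covers_shape_lists(1) _ covers_shape_lists(1) disj], of "[0, 1, 3, 4]"])
    (simp_all add: join_def shape_list_defs P3_P4_def)

lemma listed_K2_twoK2: "shape 2 K2_l E \<Longrightarrow> shape 4 twoK2_l F \<Longrightarrow> listed (E \<union> F)"
  by (rule listedI(1), rule shape_fits[OF shape_join[OF _ covers_shape_lists(1) _ covers_shape_lists(8) disj], of "[0, 1, 3, 4, 5, 6]"])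
    (simp_all add: join_def shape_list_defs P3_P4_def)

lemma listed_K2_P3: "shape 2 K2_l E \<Longrightarrow> shape 3 P3_l F \<Longrightarrow> listed (E \<union> F)"
  by (rule listedI(1), rule shape_fits[OF shape_join[OF _ covers_shape_lists(1) _ covers_shape_lists(2) disj], of "[0, 1, 3, 4, 5]"])
    (simp_all add: join_def shape_list_defs P3_P4_def)

lemma listed_K2_threeK2: "shape 2 K2_l E \<Longrightarrow> shape 6 threeK2_l F \<Longrightarrow> listed (E \<union> F)"
  by (rule listedI(5), rule shape_fits[OF shape_join[OF _ covers_shape_lists(1) _ covers_shape_lists(9) disj], of "[0, 1, 2, 3, 4, 5, 6, 7]"])
    (simp_all add: join_def shape_list_defs twoK2_P4plus_def)

lemma listed_K2_P3_K2: "shape 2 K2_l E \<Longrightarrow> shape 5 P3_K2_l F \<Longrightarrow> listed (E \<union> F)"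
  by (rule listedI(1), rule shape_fits[OF shape_join[OF _ covers_shape_lists(1) _ covers_shape_lists(10) disj], of "[3, 4, 0, 1, 2, 5, 6]"])
    (simp_all add: join_def shape_list_defs P3_P4_def)

lemma listed_K2_P4: "shape 2 K2_l E \<Longrightarrow> shape 4 P4_l F \<Longrightarrow> listed (E \<union> F)"
  by (rule listedI(1), rule shape_fits[OF shape_join[OF _ covers_shape_lists(1) _ covers_shape_lists(3) disj], of "[0, 1, 3, 4, 5, 6]"])
    (simp_all add: join_def shape_list_defs P3_P4_def)

lemma listed_K2_K13: "shape 2 K2_l E \<Longrightarrow> shape 4 K13_l F \<Longrightarrow> listed (E \<union> F)"
  by (rule listedI(5), rule shape_fits[OF shape_join[OF _ covers_shape_lists(1) _ covers_shape_lists(6) disj], of "[0, 1, 5, 4, 6, 8]"])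
    (simp_all add: join_def shape_list_defs twoK2_P4plus_def)

lemma listed_K2_K3: "shape 2 K2_l E \<Longrightarrow> shape 3 K3_l F \<Longrightarrow> listed (E \<union> F)"
  by (rule listedI(4), rule shape_fits[OF shape_join[OF _ covers_shape_lists(1) _ covers_shape_lists(5) disj], of "[0, 1, 4, 5, 6]"])
    (simp_all add: join_def shape_list_defs twoK2_K3_def)

lemma listed_P3_K2: "shape 3 P3_l E \<Longrightarrow> shape 2 K2_l F \<Longrightarrow> listed (E \<union> F)"
  by (rule listedI(1), rule shape_fits[OF shape_join[OF _ covers_shape_lists(2) _ covers_shape_lists(1) disj], of "[0, 1, 2, 3, 4]"])
    (simp_all add: join_def shape_list_defs P3_P4_def)

lemma listed_P3_twoK2: "shape 3 P3_l E \<Longrightarrow> shape 4 twoK2_l F \<Longrightarrow> listed (E \<union> F)"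
  by (rule listedI(1), rule shape_fits[OF shape_join[OF _ covers_shape_lists(2) _ covers_shape_lists(8) disj], of "[0, 1, 2, 3, 4, 5, 6]"])
    (simp_all add: join_def shape_list_defs P3_P4_def)

lemma listed_P3_P3: "shape 3 P3_l E \<Longrightarrow> shape 3 P3_l F \<Longrightarrow> listed (E \<union> F)"
  by (rule listedI(1), rule shape_fits[OF shape_join[OF _ covers_shape_lists(2) _ covers_shape_lists(2) disj], of "[0, 1, 2, 3, 4, 5]"])
    (simp_all add: join_def shape_list_defs P3_P4_def)

lemma listed_P3_threeK2: "shape 3 P3_l E \<Longrightarrow> shape 6 threeK2_l F \<Longrightarrow> listed (E \<union> F)"
  by (rule listedI(5), rule shape_fits[OF shape_join[OF _ covers_shape_lists(2) _ covers_shape_lists(9) disj], of "[4, 5, 8, 0, 1, 2, 3, 6, 7]"])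
    (simp_all add: join_def shape_list_defs twoK2_P4plus_def)

lemma listed_P3_P3_K2: "shape 3 P3_l E \<Longrightarrow> shape 5 P3_K2_l F \<Longrightarrow> listed (E \<union> F)"
  by (rule listedI(3), rule shape_fits[OF shape_join[OF _ covers_shape_lists(2) _ covers_shape_lists(10) disj], of "[2, 3, 4, 5, 6, 7, 0, 1]"])
    (simp_all add: join_def shape_list_defs K2_2P3_def)

lemma listed_P3_P4: "shape 3 P3_l E \<Longrightarrow> shape 4 P4_l F \<Longrightarrow> listed (E \<union> F)"
  by (rule listedI(1), rule shape_fits[OF shape_join[OF _ covers_shape_lists(2) _ covers_shape_lists(3) disj], of "[0, 1, 2, 3, 4, 5, 6]"])
    (simp_all add: join_def shape_list_defs P3_P4_def)

lemma excluded_P3_K13: "shape 3 P3_l E \<Longrightarrow> shape 4 K13_l F \<Longrightarrow> E \<union> F \<subseteq> edges H \<Longrightarrow> has_copy 7 K13_P3_list H"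
  by (rule shape_has_copy[OF shape_join[OF _ covers_shape_lists(2) _ covers_shape_lists(6) disj], where \<sigma> = "[3, 4, 5, 6, 0, 1, 2]"])
    (simp_all add: join_def shape_list_defs K13_P3_list_def)

lemma excluded_P3_K3: "shape 3 P3_l E \<Longrightarrow> shape 3 K3_l F \<Longrightarrow> E \<union> F \<subseteq> edges H \<Longrightarrow> has_copy 6 K3_P3_list H"
  by (rule shape_has_copy[OF shape_join[OF _ covers_shape_lists(2) _ covers_shape_lists(5) disj], where \<sigma> = "[3, 4, 5, 0, 1, 2]"])
    (simp_all add: join_def shape_list_defs K3_P3_list_def)

lemma listed_K13_K2: "shape 4 K13_l E \<Longrightarrow> shape 2 K2_l F \<Longrightarrow> listed (E \<union> F)"
  by (rule listedI(5), rule shape_fits[OF shape_join[OF _ covers_shape_lists(6) _ covers_shape_lists(1) disj], of "[5, 4, 6, 8, 0, 1]"])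
    (simp_all add: join_def shape_list_defs twoK2_P4plus_def)

lemma listed_K13_twoK2: "shape 4 K13_l E \<Longrightarrow> shape 4 twoK2_l F \<Longrightarrow> listed (E \<union> F)"
  by (rule listedI(5), rule shape_fits[OF shape_join[OF _ covers_shape_lists(6) _ covers_shape_lists(8) disj], of "[5, 4, 6, 8, 0, 1, 2, 3]"])
    (simp_all add: join_def shape_list_defs twoK2_P4plus_def)

lemma excluded_K13_P3: "shape 4 K13_l E \<Longrightarrow> shape 3 P3_l F \<Longrightarrow> E \<union> F \<subseteq> edges H \<Longrightarrow> has_copy 7 K13_P3_list H"
  by (rule shape_has_copy[OF shape_join[OF _ covers_shape_lists(6) _ covers_shape_lists(2) disj], where \<sigma> = "[0, 1, 2, 3, 4, 5, 6]"])
    (simp_all add: join_def shape_list_defs K13_P3_list_def)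

lemma listed_K13_threeK2: "shape 4 K13_l E \<Longrightarrow> shape 6 threeK2_l F \<Longrightarrow> listed (E \<union> F)"
  by (rule listedI(6), rule shape_fits[OF shape_join[OF _ covers_shape_lists(6) _ covers_shape_lists(9) disj], of "[6, 7, 8, 9, 0, 1, 2, 3, 4, 5]"])
    (simp_all add: join_def shape_list_defs threeK2_K13_def)

lemma excluded_K13_P3_K2: "shape 4 K13_l E \<Longrightarrow> shape 5 P3_K2_l F \<Longrightarrow> E \<union> F \<subseteq> edges H \<Longrightarrow> has_copy 7 K13_P3_list H"
  by (rule shape_has_copy[OF shape_join[OF _ covers_shape_lists(6) _ covers_shape_lists(10) disj], where \<sigma> = "[0, 1, 2, 3, 4, 5, 6]"])
    (simp_all add: join_def shape_list_defs K13_P3_list_def)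

lemma excluded_K13_P4: "shape 4 K13_l E \<Longrightarrow> shape 4 P4_l F \<Longrightarrow> E \<union> F \<subseteq> edges H \<Longrightarrow> has_copy 7 K13_P3_list H"
  by (rule shape_has_copy[OF shape_join[OF _ covers_shape_lists(6) _ covers_shape_lists(3) disj], where \<sigma> = "[0, 1, 2, 3, 4, 5, 6]"])
    (simp_all add: join_def shape_list_defs K13_P3_list_def)

lemma excluded_K13_K13: "shape 4 K13_l E \<Longrightarrow> shape 4 K13_l F \<Longrightarrow> E \<union> F \<subseteq> edges H \<Longrightarrow> has_copy 7 K13_P3_list H"
  by (rule shape_has_copy[OF shape_join[OF _ covers_shape_lists(6) _ covers_shape_lists(6) disj], where \<sigma> = "[0, 1, 2, 3, 5, 4, 6]"])
    (simp_all add: join_def shape_list_defs K13_P3_list_def)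

lemma excluded_K13_K3: "shape 4 K13_l E \<Longrightarrow> shape 3 K3_l F \<Longrightarrow> E \<union> F \<subseteq> edges H \<Longrightarrow> has_copy 7 K13_P3_list H"
  by (rule shape_has_copy[OF shape_join[OF _ covers_shape_lists(6) _ covers_shape_lists(5) disj], where \<sigma> = "[0, 1, 2, 3, 4, 5, 6]"])
    (simp_all add: join_def shape_list_defs K13_P3_list_def)

lemma listed_K3_K2: "shape 3 K3_l E \<Longrightarrow> shape 2 K2_l F \<Longrightarrow> listed (E \<union> F)"
  by (rule listedI(4), rule shape_fits[OF shape_join[OF _ covers_shape_lists(5) _ covers_shape_lists(1) disj], of "[4, 5, 6, 0, 1]"])
    (simp_all add: join_def shape_list_defs twoK2_K3_def)

lemma listed_K3_twoK2: "shape 3 K3_l E \<Longrightarrow> shape 4 twoK2_l F \<Longrightarrow> listed (E \<union> F)"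
  by (rule listedI(4), rule shape_fits[OF shape_join[OF _ covers_shape_lists(5) _ covers_shape_lists(8) disj], of "[4, 5, 6, 0, 1, 2, 3]"])
    (simp_all add: join_def shape_list_defs twoK2_K3_def)

lemma excluded_K3_P3: "shape 3 K3_l E \<Longrightarrow> shape 3 P3_l F \<Longrightarrow> E \<union> F \<subseteq> edges H \<Longrightarrow> has_copy 6 K3_P3_list H"
  by (rule shape_has_copy[OF shape_join[OF _ covers_shape_lists(5) _ covers_shape_lists(2) disj], where \<sigma> = "[0, 1, 2, 3, 4, 5]"])
    (simp_all add: join_def shape_list_defs K3_P3_list_def)

lemma listed_P4_K2: "shape 4 P4_l E \<Longrightarrow> shape 2 K2_l F \<Longrightarrow> listed (E \<union> F)"
  by (rule listedI(1), rule shape_fits[OF shape_join[OF _ covers_shape_lists(3) _ covers_shape_lists(1) disj], of "[3, 4, 5, 6, 0, 1]"])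
    (simp_all add: join_def shape_list_defs P3_P4_def)

lemma listed_P4_twoK2: "shape 4 P4_l E \<Longrightarrow> shape 4 twoK2_l F \<Longrightarrow> listed (E \<union> F)"
  by (rule listedI(5), rule shape_fits[OF shape_join[OF _ covers_shape_lists(3) _ covers_shape_lists(8) disj], of "[4, 5, 6, 7, 0, 1, 2, 3]"])
    (simp_all add: join_def shape_list_defs twoK2_P4plus_def)

lemma listed_P4_P3: "shape 4 P4_l E \<Longrightarrow> shape 3 P3_l F \<Longrightarrow> listed (E \<union> F)"
  by (rule listedI(1), rule shape_fits[OF shape_join[OF _ covers_shape_lists(3) _ covers_shape_lists(2) disj], of "[3, 4, 5, 6, 0, 1, 2]"])
    (simp_all add: join_def shape_list_defs P3_P4_def)

lemma listed_P4plus_K2: "shape 5 P4plus_l E \<Longrightarrow> shape 2 K2_l F \<Longrightarrow> listed (E \<union> F)"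
  by (rule listedI(5), rule shape_fits[OF shape_join[OF _ covers_shape_lists(7) _ covers_shape_lists(1) disj], of "[4, 5, 6, 7, 8, 0, 1]"])
    (simp_all add: join_def shape_list_defs twoK2_P4plus_def)

lemma listed_P4plus_twoK2: "shape 5 P4plus_l E \<Longrightarrow> shape 4 twoK2_l F \<Longrightarrow> listed (E \<union> F)"
  by (rule listedI(5), rule shape_fits[OF shape_join[OF _ covers_shape_lists(7) _ covers_shape_lists(8) disj], of "[4, 5, 6, 7, 8, 0, 1, 2, 3]"])
    (simp_all add: join_def shape_list_defs twoK2_P4plus_def)

lemma excluded_P4plus_P3: "shape 5 P4plus_l E \<Longrightarrow> shape 3 P3_l F \<Longrightarrow> E \<union> F \<subseteq> edges H \<Longrightarrow> has_copy 7 K13_P3_list H"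
  by (rule shape_has_copy[OF shape_join[OF _ covers_shape_lists(7) _ covers_shape_lists(2) disj], where \<sigma> = "[1, 0, 2, 4, 5, 6, 7]"])
    (simp_all add: join_def shape_list_defs K13_P3_list_def)

lemma listed_P5_K2: "shape 5 P5_l E \<Longrightarrow> shape 2 K2_l F \<Longrightarrow> listed (E \<union> F)"
  by (rule listedI(2), rule shape_fits[OF shape_join[OF _ covers_shape_lists(4) _ covers_shape_lists(1) disj], of "[2, 3, 4, 5, 6, 0, 1]"])
    (simp_all add: join_def shape_list_defs K2_P5_def)

lemmas listed_cases = listed_K2_K2 listed_K2_twoK2 listed_K2_P3 listed_K2_threeK2 listed_K2_P3_K2 listed_K2_P4 listed_K2_K13 listed_K2_K3 listed_P3_K2 listed_P3_twoK2 listed_P3_P3 listed_P3_threeK2 listed_P3_P3_K2 listed_P3_P4 listed_K13_K2 listed_K13_twoK2 listed_K13_threeK2 listed_K3_K2 listed_K3_twoK2 listed_P4_K2 listed_P4_twoK2 listed_P4_P3 listed_P4plus_K2 listed_P4plus_twoK2 listed_P5_K2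

lemmas excluded_cases = excluded_P3_K13 excluded_P3_K3 excluded_K13_P3 excluded_K13_P3_K2 excluded_K13_P4 excluded_K13_K13 excluded_K13_K3 excluded_K3_P3 excluded_P4plus_P3

end

section \<open>The component of the distinguished vertex\<close>

lemma card_2_other:
  assumes "card e = 2" "q \<in> e"
  obtains p where "e = {q, p}" "p \<noteq> q"
  using assms by (auto simp: card_2_iff)

lemma two_edges_shape:
  assumes "card e = 2" "card f = 2" "e \<noteq> f"
  obtains "shape 4 twoK2_l {e, f}" | p q s where "distinct [p, q, s]" "e = {p, q}" "f = {q, s}"
proof (cases "e \<inter> f = {}")
  case True
  obtain p q where e: "e = {p, q}" "p \<noteq> q" using assms(1) by (auto simp: card_2_iff)
  obtain s t where f: "f = {s, t}" "s \<noteq> t" using assms(2) by (auto simp: card_2_iff)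
  have "shape 4 twoK2_l {e, f}"
    by (rule shapeI[of "[p, q, s, t]"]) (use e f True in \<open>auto simp: shape_list_defs\<close>)
  then show ?thesis using that by blast
next
  case False
  then obtain q where q: "q \<in> e" "q \<in> f" by blast
  obtain p where p: "e = {q, p}" "p \<noteq> q" by (rule card_2_other[OF assms(1) q(1)])
  obtain s where s: "f = {q, s}" "s \<noteq> q" by (rule card_2_other[OF assms(2) q(2)])
  show ?thesis by (rule that(2)[of p q s]) (use p s assms(3) in auto)
qed

text \<open>
  The third edge either avoids the path or meets it in one or both ends or in its centre.
\<close>

lemma three_edges_with_path_shape:
  assumes d: "distinct [p, q, s]" and h: "card h = 2" "h \<noteq> {p, q}" "h \<noteq> {q, s}"
  shows "shape 5 P3_K2_l {{p, q}, {q, s}, h} \<or> shape 4 P4_l {{p, q}, {q, s}, h} \<or>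
    shape 4 K13_l {{p, q}, {q, s}, h} \<or> shape 3 K3_l {{p, q}, {q, s}, h}"
proof (cases "h \<inter> {p, q, s} = {}")
  case True
  obtain x y where h': "h = {x, y}" "x \<noteq> y" using h(1) by (auto simp: card_2_iff)
  have "shape 5 P3_K2_l {{p, q}, {q, s}, h}"
    by (rule shapeI[of "[p, q, s, x, y]"]) (use d h' True in \<open>auto simp: shape_list_defs\<close>)
  then show ?thesis by blast
next
  case False
  then obtain z where z: "z \<in> h" "z \<in> {p, q, s}" by blast
  obtain t where t: "h = {z, t}" "t \<noteq> z" by (rule card_2_other[OF h(1) z(1)])
  consider "z = q" | "z = p" "t = s" | "z = s" "t = p" | "z = p" "t \<noteq> s" | "z = s" "t \<noteq> p" using z(2) by auto
  then show ?thesis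
  proof cases
    case 1
    then have "t \<noteq> p" "t \<noteq> s" using h t by (auto simp: insert_commute)
    then have "shape 4 K13_l {{p, q}, {q, s}, h}"
      by (intro shapeI[of "[q, p, s, t]"]) (use d t 1 in \<open>auto simp: shape_list_defs insert_commute\<close>)
    then show ?thesis by blast
  next
    case 2
    have "shape 3 K3_l {{p, q}, {q, s}, h}"
      by (rule shapeI[of "[p, q, s]"]) (use d t 2 in \<open>auto simp: shape_list_defs insert_commute\<close>)
    then show ?thesis by blast
  next
    case 3
    have "shape 3 K3_l {{p, q}, {q, s}, h}"
      by (rule shapeI[of "[p, q, s]"]) (use d t 3 in \<open>auto simp: shape_list_defs insert_commute\<close>)
    then show ?thesis by blast
  next
    case 4
    then have "t \<noteq> q" using h t by (auto simp: insert_commute)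
    then have "shape 4 P4_l {{p, q}, {q, s}, h}"
      by (intro shapeI[of "[t, p, q, s]"]) (use d t 4 in \<open>auto simp: shape_list_defs insert_commute\<close>)
    then show ?thesis by blast
  next
    case 5
    then have "t \<noteq> q" using h t by (auto simp: insert_commute)
    then have "shape 4 P4_l {{p, q}, {q, s}, h}"
      by (intro shapeI[of "[p, q, s, t]"]) (use d t 5 in \<open>auto simp: shape_list_defs insert_commute\<close>)
    then show ?thesis by blast
  qed
qed

lemma at_most_three_edges_shape:
  assumes F: "F \<noteq> {}" "\<And>e. e \<in> F \<Longrightarrow> card e = 2" "finite F" "card F \<le> 3"
  obtains "card F = 1" "shape 2 K2_l F" | "card F = 2" "shape 4 twoK2_l F" | "card F = 2" "shape 3 P3_l F"
    | "card F = 3" "shape 6 threeK2_l F" | "card F = 3" "shape 5 P3_K2_l F" | "card F = 3" "shape 4 P4_l F"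
    | "card F = 3" "shape 4 K13_l F" | "card F = 3" "shape 3 K3_l F"
proof -
  note alternative = that
  have "card F \<noteq> 0" using F(1,3) by simp
  then consider "card F = 1" | "card F = 2" | "card F = 3" using F(4) by linarith
  then show ?thesis
  proof cases
    case 1
    then obtain e where e: "F = {e}" by (auto simp: card_1_singleton_iff)
    then obtain p q where pq: "e = {p, q}" "p \<noteq> q" using F(2)[of e] by (auto simp: card_2_iff)
    have "shape 2 K2_l F" by (rule shapeI[of "[p, q]"]) (use e pq in \<open>auto simp: shape_list_defs\<close>)
    then show ?thesis using that(1)[OF 1] by blast
  next
    case 2
    then obtain e f where ef: "F = {e, f}" "e \<noteq> f" by (auto simp: card_2_iff)
    have c: "card e = 2" "card f = 2" using F(2) ef by auto
    show ?thesis
    proof (rule two_edges_shape[OF c ef(2)])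
      assume "shape 4 twoK2_l {e, f}"
      then show ?thesis using that(2)[OF 2] ef(1) by blast
    next
      fix p q s assume *: "distinct [p, q, s]" "e = {p, q}" "f = {q, s}"
      have "shape 3 P3_l F" by (rule shapeI[of "[p, q, s]"]) (use * ef(1) in \<open>auto simp: shape_list_defs\<close>)
      then show ?thesis using that(3)[OF 2] by blast
    qed
  next
    case 3
    then obtain e f h where efh: "F = {e, f, h}" "e \<noteq> f" "e \<noteq> h" "f \<noteq> h" by (auto simp: card_3_iff)
    have c: "card e = 2" "card f = 2" "card h = 2" using F(2) efh by auto
    have path: ?thesis if *: "distinct [p, q, s]" "F = {{p, q}, {q, s}, k}" "card k = 2" "k \<noteq> {p, q}" "k \<noteq> {q, s}"
      for p q s k
      using three_edges_with_path_shape[OF *(1,3,4,5)] alternative(5-8)[OF 3] unfolding *(2) by blast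
    show ?thesis
    proof (cases "e \<inter> f = {} \<and> e \<inter> h = {} \<and> f \<inter> h = {}")
      case True
      obtain p q where e: "e = {p, q}" "p \<noteq> q" using c(1) by (auto simp: card_2_iff)
      obtain s t where f: "f = {s, t}" "s \<noteq> t" using c(2) by (auto simp: card_2_iff)
      obtain x y where h: "h = {x, y}" "x \<noteq> y" using c(3) by (auto simp: card_2_iff)
      have "shape 6 threeK2_l F"
        by (rule shapeI[of "[p, q, s, t, x, y]"]) (use e f h True efh(1) in \<open>auto simp: shape_list_defs\<close>)
      then show ?thesis using that(4)[OF 3] by blast
    next
      case False
      then obtain e' f' h' where *: "F = {e', f', h'}" "e' \<noteq> f'" "e' \<noteq> h'" "f' \<noteq> h'" "e' \<inter> f' \<noteq> {}"
        using efh by (metis insert_commute)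
      have c': "card e' = 2" "card f' = 2" "card h' = 2" using F(2) *(1) by auto
      obtain q where q: "q \<in> e'" "q \<in> f'" using *(5) by blast
      obtain p where p: "e' = {q, p}" "p \<noteq> q" by (rule card_2_other[OF c'(1) q(1)])
      obtain s where s: "f' = {q, s}" "s \<noteq> q" by (rule card_2_other[OF c'(2) q(2)])
      have e': "e' = {p, q}" using p(1) by (simp add: insert_commute)
      show ?thesis
      proof (rule path[of p q s h'])
        show "distinct [p, q, s]" using p s *(2) by auto
        show "F = {{p, q}, {q, s}, h'}" using *(1) e' s(1) by simp
        show "card h' = 2" by (rule c'(3))
        show "h' \<noteq> {p, q}" using *(3) e' by simp
        show "h' \<noteq> {q, s}" using *(4) s(1) by simp
      qed
    qed
  qed
qed

lemma pawI: "distinct [x, y, z, w] \<Longrightarrow> {x, y} \<in> edges H \<Longrightarrow> {x, z} \<in> edges H \<Longrightarrow> {y, z} \<in> edges H \<Longrightarrow>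
    {x, w} \<in> edges H \<Longrightarrow> has_copy 4 paw_list H"
  by (rule has_copyI[of "[x, y, z, w]"]) (simp_all add: paw_list_def)

lemma C4I: "distinct [x, y, z, w] \<Longrightarrow> {x, y} \<in> edges H \<Longrightarrow> {y, z} \<in> edges H \<Longrightarrow> {z, w} \<in> edges H \<Longrightarrow>
    {x, w} \<in> edges H \<Longrightarrow> has_copy 4 C4_list H"
  by (rule has_copyI[of "[x, y, z, w]"]) (simp_all add: C4_list_def)

lemma K14I: "distinct [v, a, b, d, e] \<Longrightarrow> {v, a} \<in> edges H \<Longrightarrow> {v, b} \<in> edges H \<Longrightarrow> {v, d} \<in> edges H \<Longrightarrow>
    {v, e} \<in> edges H \<Longrightarrow> has_copy 5 K14_list H"
  by (rule has_copyI[of "[v, a, b, d, e]"]) (simp_all add: K14_list_def)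

lemma S22I: "distinct [v, a, b, d, x, t] \<Longrightarrow> {v, a} \<in> edges H \<Longrightarrow> {v, b} \<in> edges H \<Longrightarrow> {v, d} \<in> edges H \<Longrightarrow>
    {a, x} \<in> edges H \<Longrightarrow> {a, t} \<in> edges H \<Longrightarrow> has_copy 6 S22_list H"
  by (rule has_copyI[of "[v, a, b, d, x, t]"]) (simp_all add: S22_list_def)

lemma S221I: "distinct [v, a, b, d, x, t] \<Longrightarrow> {v, a} \<in> edges H \<Longrightarrow> {v, b} \<in> edges H \<Longrightarrow> {v, d} \<in> edges H \<Longrightarrow>
    {a, x} \<in> edges H \<Longrightarrow> {b, t} \<in> edges H \<Longrightarrow> has_copy 6 S221_list H"
  by (rule has_copyI[of "[v, a, b, d, x, t]"]) (simp_all add: S221_list_def)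

lemma S113I: "distinct [v, a, b, d, x, t] \<Longrightarrow> {v, a} \<in> edges H \<Longrightarrow> {v, b} \<in> edges H \<Longrightarrow> {v, d} \<in> edges H \<Longrightarrow>
    {d, x} \<in> edges H \<Longrightarrow> {x, t} \<in> edges H \<Longrightarrow> has_copy 6 S113_list H"
  by (rule has_copyI[of "[v, a, b, d, x, t]"]) (simp_all add: S113_list_def)

text \<open>
  The set \<open>A\<close> consists of the neighbours of \<open>v\<close> and \<open>F\<close> of the other edges of the component. The growth
  condition expresses connectedness: the edges of \<open>F\<close> can be added one after the other, each meeting
  what is there already. Every way of doing this that is not listed creates an excluded graph.
\<close>

lemma component_shape:
  fixes H :: "'a graph"
  assumes no: "\<not> has_copy 4 C4_list H" "\<not> has_copy 6 S221_list H" "\<not> has_copy 4 paw_list H" "\<not> has_copy 5 K14_list H"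
      "\<not> has_copy 6 S22_list H" "\<not> has_copy 6 S113_list H"
    and A: "finite A" "A \<noteq> {}" "v \<notin> A" and F: "\<And>e. e \<in> F \<Longrightarrow> card e = 2" "v \<notin> \<Union>F" "finite F" "card F \<le> 2"
    and grow: "\<And>S. S \<subset> F \<Longrightarrow> \<exists>e\<in>F - S. e \<inter> (A \<union> \<Union>S) \<noteq> {}"
    and E: "E = (\<lambda>x. {v, x}) ` A \<union> F" "E \<subseteq> edges H"
  obtains "card F = 0" "shape 2 K2_l E \<or> shape 3 P3_l E \<or> shape 4 K13_l E"
    | "card F = 1" "shape 3 P3_l E \<or> shape 3 K3_l E \<or> shape 4 P4_l E \<or> shape 5 P4plus_l E"
    | "card F = 2" "shape 4 K13_l E \<or> shape 4 P4_l E \<or> shape 5 P5_l E \<or> shape 5 P4plus_l E"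
proof -
  have vA: "{v, x} \<in> edges H" if "x \<in> A" for x using E that by blast
  have FH: "f \<in> edges H" if "f \<in> F" for f using E that by blast
  have "card A \<le> 3"
  proof (rule ccontr)
    assume "\<not> card A \<le> 3"
    then have "4 \<le> card A" by simp
    then obtain T where "T \<subseteq> A" "card T = 4" by (meson obtain_subset_with_card_n)
    moreover obtain xs where xs: "distinct xs" "set xs = T" "length xs = 4"
      using list_of_card[of T 4] \<open>card T = 4\<close> by auto
    moreover obtain a b d e where "xs = [a, b, d, e]"
      using xs(3) by (auto simp: numeral_eq_Suc length_Suc_conv)
    ultimately have T: "{a, b, d, e} \<subseteq> A" "distinct [a, b, d, e]" by auto
    then have "has_copy 5 K14_list H" using A(3) by (intro K14I[of v a b d e] vA) auto
    then show False using no(4) by simp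
  qed
  have other: "\<exists>a x. f = {a, x} \<and> a \<in> B \<and> a \<noteq> x \<and> a \<noteq> v \<and> x \<noteq> v" if "f \<in> F" "f \<inter> B \<noteq> {}" for f B
  proof -
    note f = that
    obtain a where a: "a \<in> f" "a \<in> B" using f(2) by blast
    obtain x where "f = {a, x}" "x \<noteq> a" by (rule card_2_other[OF F(1)[OF f(1)] a(1)])
    then show ?thesis using a(2) F(2) f(1) by blast
  qed
  have nbrs: "A = {a} \<or> (\<exists>b. A = {a, b} \<and> a \<noteq> b) \<or> (\<exists>b d. A = {a, b, d} \<and> distinct [a, b, d])" if aA: "a \<in> A" for a
  proof -
    have "card (A - {a}) \<le> 2" using \<open>card A \<le> 3\<close> A(1) aA by simp
    then consider "card (A - {a}) = 0" | "card (A - {a}) = 1" | "card (A - {a}) = 2" by linarith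
    then show ?thesis
    proof cases
      case 1
      then have "A - {a} = {}" using A(1) by (metis card_0_eq finite_Diff)
      then show ?thesis using aA by blast
    next
      case 2
      then obtain b where "A - {a} = {b}" by (auto simp: card_1_singleton_iff)
      then have "A = {a, b} \<and> a \<noteq> b" using aA by blast
      then show ?thesis by blast
    next
      case 3
      then obtain b d where "A - {a} = {b, d}" "b \<noteq> d" by (auto simp: card_2_iff)
      then have "A = {a, b, d} \<and> distinct [a, b, d]" using aA by auto
      then show ?thesis by blast
    qed
  qed
  have E1: "E = insert {v, a} F" if "A = {a}" for a using E(1) that by auto
  have E2: "E = insert {v, a} (insert {v, b} F)" if "A = {a, b}" for a b using E(1) that by auto
  have E3: "E = insert {v, a} (insert {v, b} (insert {v, d} F))" if "A = {a, b, d}" for a b d using E(1) that by auto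
  consider "card F = 0" | "card F = 1" | "card F = 2" using F(4) by linarith
  then show ?thesis
  proof cases
    case 1
    then have F0: "F = {}" using F(3) by simp
    obtain a where a: "a \<in> A" using A(2) by blast
    consider "A = {a}" | b where "A = {a, b}" "a \<noteq> b" | b d where "A = {a, b, d}" "distinct [a, b, d]"
      using nbrs[OF a] by blast
    then have "shape 2 K2_l E \<or> shape 3 P3_l E \<or> shape 4 K13_l E"
    proof cases
      case 1
      have "shape 2 K2_l E" by (rule shapeI[of "[v, a]"]) (use E1[OF 1] F0 A(3) a in \<open>auto simp: shape_list_defs\<close>)
      then show ?thesis by blast
    next
      case (2 b)
      have "shape 3 P3_l E"
        by (rule shapeI[of "[a, v, b]"]) (use E2[OF 2(1)] 2 F0 A(3) in \<open>auto simp: shape_list_defs insert_commute\<close>)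
      then show ?thesis by blast
    next
      case (3 b d)
      have "shape 4 K13_l E"
        by (rule shapeI[of "[v, a, b, d]"]) (use E3[OF 3(1)] 3 F0 A(3) in \<open>auto simp: shape_list_defs insert_commute\<close>)
      then show ?thesis by blast
    qed
    then show ?thesis using that(1)[OF 1] by blast
  next
    case 2
    then obtain f where F1: "F = {f}" by (auto simp: card_1_singleton_iff)
    have "\<exists>e\<in>F - {}. e \<inter> (A \<union> \<Union>{}) \<noteq> {}" by (rule grow) (use F1 in auto)
    then have "f \<inter> A \<noteq> {}" using F1 by auto
    then obtain a x where f: "f = {a, x}" "a \<in> A" "a \<noteq> x" "a \<noteq> v" "x \<noteq> v" using other[of f A] F1 by blast
    have eH: "{a, x} \<in> edges H" using FH F1 f(1) by blast
    consider "A = {a}" | b where "A = {a, b}" "a \<noteq> b" | b d where "A = {a, b, d}" "distinct [a, b, d]"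
      using nbrs[OF f(2)] by blast
    then have "shape 3 P3_l E \<or> shape 3 K3_l E \<or> shape 4 P4_l E \<or> shape 5 P4plus_l E"
    proof cases
      case 1
      have "shape 3 P3_l E" by (rule shapeI[of "[v, a, x]"]) (use E1[OF 1] F1 f in \<open>auto simp: shape_list_defs\<close>)
      then show ?thesis by blast
    next
      case (2 b)
      show ?thesis
      proof (cases "x = b")
        case True
        have "shape 3 K3_l E"
          by (rule shapeI[of "[v, a, b]"]) (use E2[OF 2(1)] 2 True F1 f in \<open>auto simp: shape_list_defs insert_commute\<close>)
        then show ?thesis by blast
      next
        case False
        have "shape 4 P4_l E"
          by (rule shapeI[of "[b, v, a, x]"]) (use E2[OF 2(1)] 2 False F1 f A(3) in \<open>auto simp: shape_list_defs insert_commute\<close>)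
        then show ?thesis by blast
      qed
    next
      case (3 b d)
      have v: "{v, a} \<in> edges H" "{v, b} \<in> edges H" "{v, d} \<in> edges H" "v \<noteq> b" "v \<noteq> d" using vA 3(1) A(3) by auto
      have "x \<noteq> b" using no(3) pawI[of v a b d H] v eH 3(2) f by auto
      moreover have "x \<noteq> d" using no(3) pawI[of v a d b H] v eH 3(2) f by auto
      ultimately have "shape 5 P4plus_l E"
        by (intro shapeI[of "[b, v, a, x, d]"]) (use E3[OF 3(1)] 3 v F1 f in \<open>auto simp: shape_list_defs insert_commute\<close>)
      then show ?thesis by blast
    qed
    then show ?thesis using that(2)[OF 2] by blast
  next
    case 3
    have "\<exists>e\<in>F - {}. e \<inter> (A \<union> \<Union>{}) \<noteq> {}" by (rule grow) (use 3 in auto)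
    then obtain f where fF: "f \<in> F" "f \<inter> A \<noteq> {}" by auto
    then obtain a x where f: "f = {a, x}" "a \<in> A" "a \<noteq> x" "a \<noteq> v" "x \<noteq> v" using other[of f A] by blast
    have "{f} \<subset> F" using 3 fF(1) by auto
    then obtain g where g: "g \<in> F - {f}" "g \<inter> (A \<union> {a, x}) \<noteq> {}" using grow[of "{f}"] f(1) by auto
    then obtain z t where zt: "g = {z, t}" "z \<in> A \<union> {a, x}" "z \<noteq> t" "z \<noteq> v" "t \<noteq> v"
      using other[of g "A \<union> {a, x}"] by blast
    have ne: "{z, t} \<noteq> {a, x}" using g(1) f(1) zt(1) by blast
    have F2: "F = {{a, x}, {z, t}}"
    proof -
      have "f \<noteq> g" "{f, g} \<subseteq> F" using fF(1) g(1) by auto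
      moreover from this have "card {f, g} = 2" by (intro card_2_iff[THEN iffD2] exI conjI) simp_all
      ultimately have "{f, g} = F" using F(3) 3 by (metis card_subset_eq)
      then show ?thesis using f(1) zt(1) by simp
    qed
    have eH: "{a, x} \<in> edges H" "{x, a} \<in> edges H" "{z, t} \<in> edges H" "{t, z} \<in> edges H"
      using FH F2 by (auto simp: insert_commute)
    consider "A = {a}" | b where "A = {a, b}" "a \<noteq> b" | b d where "A = {a, b, d}" "distinct [a, b, d]"
      using nbrs[OF f(2)] by blast
    then have "shape 4 K13_l E \<or> shape 4 P4_l E \<or> shape 5 P5_l E \<or> shape 5 P4plus_l E"
    proof cases
      case 1
      consider "z = a" | "z = x" using zt(2) 1 by auto
      then show ?thesis
      proof cases
        case 11: 1
        then have "t \<noteq> x" using ne by auto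
        then have "shape 4 K13_l E"
          by (intro shapeI[of "[a, v, x, t]"]) (use E1[OF 1] F2 f zt 11 in \<open>auto simp: shape_list_defs insert_commute\<close>)
        then show ?thesis by blast
      next
        case 12: 2
        then have "t \<noteq> a" using ne by auto
        then have "shape 4 P4_l E"
          by (intro shapeI[of "[v, a, x, t]"]) (use E1[OF 1] F2 f zt 12 in \<open>auto simp: shape_list_defs insert_commute\<close>)
        then show ?thesis by blast
      qed
    next
      case (2 b)
      have v: "{v, a} \<in> edges H" "{v, b} \<in> edges H" "{a, v} \<in> edges H" "{b, v} \<in> edges H" "v \<noteq> b" "v \<noteq> a"
        using vA[of a] vA[of b] 2(1) A(3) by (auto simp: insert_commute)
      show ?thesis
      proof (cases "x = b")
        case True
        then consider "z = a" "t \<noteq> b" | "z = b" "t \<noteq> a" using zt(2) 2(1) ne by auto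
        then have "has_copy 4 paw_list H"
        proof cases
          case 1 show ?thesis by (rule pawI[of a v b t]) (use v eH zt f True 1 2 in auto)
        next
          case b: 2 show ?thesis by (rule pawI[of b v a t]) (use v eH zt f True b 2 in auto)
        qed
        then show ?thesis using no(3) by simp
      next
        case False
        have ab: "False" if "{a, b} \<in> edges H"
          using no(3) pawI[of a v b x H] v eH that f False 2(2) by auto
        have bx: "False" if "{b, x} \<in> edges H"
          using no(1) C4I[of v a x b H] v eH that f False 2(2) by (auto simp: insert_commute)
        have tb: "\<not> (z = a \<and> t = b)" "\<not> (z = b \<and> t = a)" "\<not> (z = b \<and> t = x)" "\<not> (z = x \<and> t = b)"
          using ab bx eH(3,4) by auto
        have xa: "\<not> (z = a \<and> t = x)" "\<not> (z = x \<and> t = a)" using ne by auto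
        consider "z = a" | "z = b" | "z = x" using zt(2) 2(1) by auto
        then show ?thesis
        proof cases
          case 1
          then have "shape 5 P4plus_l E"
            by (intro shapeI[of "[x, a, v, b, t]"])
              (use E2[OF 2(1)] F2 f zt 2 v False tb xa in \<open>auto simp: shape_list_defs insert_commute\<close>)
          then show ?thesis by blast
        next
          case z: 2
          then have "shape 5 P5_l E"
            by (intro shapeI[of "[t, b, v, a, x]"])
              (use E2[OF 2(1)] F2 f zt 2 v False tb xa in \<open>auto simp: shape_list_defs insert_commute\<close>)
          then show ?thesis by blast
        next
          case 3
          then have "shape 5 P5_l E"
            by (intro shapeI[of "[b, v, a, x, t]"])
              (use E2[OF 2(1)] F2 f zt 2 v False tb xa in \<open>auto simp: shape_list_defs insert_commute\<close>)
          then show ?thesis by blast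
        qed
      qed
    next
      case (3 b d)
      have v: "{v, a} \<in> edges H" "{v, b} \<in> edges H" "{v, d} \<in> edges H" "v \<noteq> b" "v \<noteq> d" "v \<noteq> a"
        using vA 3(1) A(3) by auto
      have tri: "\<not> {p, q} \<subseteq> {a, b, d}" if "{p, q} \<in> edges H" "p \<noteq> q" for p q
      proof
        assume pq: "{p, q} \<subseteq> {a, b, d}"
        then obtain s where s: "s \<in> {a, b, d}" "s \<noteq> p" "s \<noteq> q" using 3(2) by (metis distinct_length_2_or_more insertCI)
        have "has_copy 4 paw_list H" by (rule pawI[of v p q s]) (use that v pq s in auto)
        then show False using no(3) by simp
      qed
      have x: "x \<noteq> b" "x \<noteq> d" using tri[OF eH(1) f(3)] by auto
      have zt': "\<not> {z, t} \<subseteq> {a, b, d}" by (rule tri[OF eH(3) zt(3)])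
      have c4: "\<not> (z = b \<and> t = x)" "\<not> (z = x \<and> t = b)" "\<not> (z = d \<and> t = x)" "\<not> (z = x \<and> t = d)"
        using no(1) C4I[of v a x b H] C4I[of v a x d H] v eH f x 3(2) by (auto simp: insert_commute)
      have xa: "\<not> (z = a \<and> t = x)" "\<not> (z = x \<and> t = a)" using ne by auto
      consider "z = a" | "z = b" | "z = d" | "z = x" using zt(2) 3(1) by auto
      then have False
      proof cases
        case 1
        have "has_copy 6 S22_list H"
          by (rule S22I[of v a b d x t]) (use v eH f x zt zt' c4 xa 1 3(2) in auto)
        then show False using no(5) by simp
      next
        case 2
        have "has_copy 6 S221_list H"
          by (rule S221I[of v a b d x t]) (use v eH f x zt zt' c4 xa 2 3(2) in auto)
        then show False using no(2) by simp
      next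
        case z: 3
        have "has_copy 6 S221_list H"
          by (rule S221I[of v a d b x t]) (use v eH f x zt zt' c4 xa z 3(2) in auto)
        then show False using no(2) by simp
      next
        case 4
        have "has_copy 6 S113_list H"
          by (rule S113I[of v b d a x t]) (use v eH f x zt zt' c4 xa 4 3(2) in auto)
        then show False using no(6) by simp
      qed
      then show ?thesis by simp
    qed
    then show ?thesis using that(3)[OF 3] by blast
  qed
qed

section \<open>The classification\<close>

text \<open>
  The component of \<open>v\<close> is the set of vertices reachable from \<open>v\<close>. If no edge of \<open>F - S\<close> met the vertices
  reached through \<open>A\<close> and \<open>S\<close>, these vertices would already be all reachable ones.
\<close>

lemma disconnected_split:
  assumes H: "simple_graph H" "no_isolated_vertices H" "\<not> connected_graph H" and v: "v \<in> verts H"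
  obtains A F F' where "edges H = (\<lambda>x. {v, x}) ` A \<union> F \<union> F'" "finite A" "A \<noteq> {}" "v \<notin> A"
    "v \<notin> \<Union>F" "v \<notin> \<Union>F'" "(insert v A \<union> \<Union>F) \<inter> \<Union>F' = {}" "F' \<noteq> {}"
    "\<forall>S. S \<subset> F \<longrightarrow> (\<exists>e\<in>F - S. e \<inter> (A \<union> \<Union>S) \<noteq> {})"
proof -
  define r where "r = {(x, y). {x, y} \<in> edges H}"
  define R where "R = {x. (v, x) \<in> r\<^sup>*}"
  define A where "A = {x. {v, x} \<in> edges H}"
  define F where "F = {e \<in> edges H. v \<notin> e \<and> e \<subseteq> R}"
  define F' where "F' = {e \<in> edges H. v \<notin> e \<and> e \<inter> R = {}}"
  have edgeE: "\<exists>x y. e = {x, y} \<and> x \<noteq> y" if "e \<in> edges H" for e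
    using H(1) that by (metis simple_edgeE)
  have symr: "sym r" by (auto simp: r_def sym_def insert_commute)
  have step: "y \<in> R" if "x \<in> R" "{x, y} \<in> edges H" for x y
    using that unfolding R_def r_def by (auto intro: rtrancl_into_rtrancl)
  have closed: "e \<subseteq> R" if e: "e \<in> edges H" "e \<inter> R \<noteq> {}" for e
  proof -
    obtain x y where "e = {x, y}" using edgeE[OF e(1)] by blast
    then show ?thesis using e step[of x y] step[of y x] by (auto simp: insert_commute)
  qed
  have vR: "v \<in> R" by (simp add: R_def)
  have at_v: "\<exists>x. e = {v, x} \<and> x \<in> A" if e: "e \<in> edges H" "v \<in> e" for e
  proof -
    obtain x y where xy: "e = {x, y}" "x \<noteq> y" using edgeE[OF e(1)] by blast
    show ?thesis
    proof (cases "x = v")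
      case True
      then show ?thesis using xy e by (auto simp: A_def)
    next
      case False
      then have "e = {v, x}" using xy e(2) by auto
      then show ?thesis using e(1) by (auto simp: A_def)
    qed
  qed
  have AR: "A \<subseteq> R" using step[OF vR] by (auto simp: A_def)
  have incident: "\<exists>e\<in>edges H. w \<in> e" if "w \<in> verts H" for w
  proof -
    have "graph_degree H w \<noteq> 0" using H(2) that by (simp add: no_isolated_vertices_def)
    then have "{e \<in> edges H. w \<in> e} \<noteq> {}" unfolding graph_degree_def by (metis card.empty)
    then show ?thesis by blast
  qed
  have vA: "v \<notin> A" using H(1) by (auto simp: A_def simple_graph_def)
  have "A \<subseteq> verts H" using H(1) by (auto simp: A_def simple_graph_def)
  then have finA: "finite A" using H(1) by (auto simp: simple_graph_def intro: finite_subset)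
  have Ane: "A \<noteq> {}" using incident[OF v] at_v by blast
  have split: "edges H = (\<lambda>x. {v, x}) ` A \<union> F \<union> F'"
  proof
    show "edges H \<subseteq> (\<lambda>x. {v, x}) ` A \<union> F \<union> F'"
    proof
      fix e assume e: "e \<in> edges H"
      show "e \<in> (\<lambda>x. {v, x}) ` A \<union> F \<union> F'"
      proof (cases "v \<in> e")
        case True then show ?thesis using at_v[OF e] by blast
      next
        case False then show ?thesis using closed[OF e] e by (cases "e \<inter> R = {}") (auto simp: F_def F'_def)
      qed
    qed
  qed (auto simp: F_def F'_def A_def)
  have F'ne: "F' \<noteq> {}"
  proof -
    obtain x y where xy: "x \<in> verts H" "y \<in> verts H" "(x, y) \<notin> r\<^sup>*"
      using H(3) v unfolding connected_graph_def r_def by blast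
    have "\<not> (x \<in> R \<and> y \<in> R)"
    proof
      assume "x \<in> R \<and> y \<in> R"
      then have "(x, v) \<in> r\<^sup>*" "(v, y) \<in> r\<^sup>*"
        using sym_rtrancl[OF symr] by (auto simp: R_def dest: symD)
      then show False using xy(3) by (meson rtrancl_trans)
    qed
    then obtain w where w: "w \<in> verts H" "w \<notin> R" using xy by blast
    obtain e where e: "e \<in> edges H" "w \<in> e" using incident[OF w(1)] by blast
    have "e \<inter> R = {}" using closed[OF e(1)] e(2) w(2) by blast
    then show ?thesis using e(1) vR by (auto simp: F'_def)
  qed
  have apart: "(insert v A \<union> \<Union>F) \<inter> \<Union>F' = {}"
    using AR vR by (auto simp: F_def F'_def)
  have grow: "\<forall>S. S \<subset> F \<longrightarrow> (\<exists>e\<in>F - S. e \<inter> (A \<union> \<Union>S) \<noteq> {})"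
  proof (intro allI impI, rule ccontr)
    fix S assume S: "S \<subset> F" and no: "\<not> (\<exists>e\<in>F - S. e \<inter> (A \<union> \<Union>S) \<noteq> {})"
    have T: "x \<in> insert v (A \<union> \<Union>S)" if "(v, x) \<in> r\<^sup>*" for x
      using that
    proof (induction rule: rtrancl_induct)
      case base
      then show ?case by simp
    next
      case (step y z)
      have yz: "{y, z} \<in> edges H" "y \<in> R" "z \<in> R"
        using step.hyps by (auto simp: r_def R_def intro: rtrancl_into_rtrancl)
      show ?case
      proof (cases "v \<in> {y, z}")
        case True
        then show ?thesis using yz(1) by (auto simp: A_def)
      next
        case False
        then have F: "{y, z} \<in> F" using yz by (auto simp: F_def)
        have "y \<in> A \<union> \<Union>S" using step.IH False by auto
        then have meet: "{y, z} \<inter> (A \<union> \<Union>S) \<noteq> {}" by simp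
        have "{y, z} \<in> S"
        proof (rule ccontr)
          assume "{y, z} \<notin> S"
          then have "{y, z} \<in> F - S" using F by simp
          with meet have "\<exists>e\<in>F - S. e \<inter> (A \<union> \<Union>S) \<noteq> {}" by (rule bexI)
          then show False using no by (rule notE[rotated])
        qed
        then show ?thesis by blast
      qed
    qed
    obtain e where e: "e \<in> F" "e \<notin> S" using S by blast
    then have eR: "e \<in> edges H" "e \<subseteq> R" "v \<notin> e" by (auto simp: F_def)
    obtain x where "x \<in> e" using edgeE[OF eR(1)] by blast
    then have "x \<in> A \<union> \<Union>S" using T[of x] eR(2,3) by (auto simp: R_def)
    then have "e \<inter> (A \<union> \<Union>S) \<noteq> {}" using \<open>x \<in> e\<close> by (metis IntI empty_iff)
    moreover have "e \<in> F - S" using e by simp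
    ultimately have "\<exists>e\<in>F - S. e \<inter> (A \<union> \<Union>S) \<noteq> {}" by (rule bexI)
    then show False using no by (rule notE[rotated])
  qed
  have "v \<notin> \<Union>F" "v \<notin> \<Union>F'" by (simp_all add: F_def F'_def)
  from that[OF split finA Ane vA this apart F'ne grow] show ?thesis .
qed

text \<open>
  At most three edges avoid \<open>v\<close>, and at least one of them lies outside the component of \<open>v\<close>. The counts
  restrict which pairs of shapes occur, and the table settles them.
\<close>

theorem ASMS_graphs_listed:
  assumes H: "H \<in> ASMS_graphs"
  shows "listed (edges H)"
proof -
  have basic: "simple_graph H" "no_isolated_vertices H" "\<not> connected_graph H"
    using H by (auto simp: ASMS_graphs_def)
  note no = ASMS_excluded_copies[OF H]
  obtain v where v: "v \<in> verts H" "card {e \<in> edges H. v \<notin> e} \<le> 3"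
    using ASMS_few_edges_off_vertex[OF H] by blast
  obtain A F F' where split: "edges H = (\<lambda>x. {v, x}) ` A \<union> F \<union> F'" "finite A" "A \<noteq> {}" "v \<notin> A"
    "v \<notin> \<Union>F" "v \<notin> \<Union>F'" "(insert v A \<union> \<Union>F) \<inter> \<Union>F' = {}" "F' \<noteq> {}"
    and grow: "\<forall>S. S \<subset> F \<longrightarrow> (\<exists>e\<in>F - S. e \<inter> (A \<union> \<Union>S) \<noteq> {})"
    by (rule disconnected_split[OF basic v(1)])
  have two: "card e = 2" if "e \<in> edges H" for e using basic(1) that by (auto simp: simple_graph_def)
  have finE: "finite (edges H)"
  proof -
    have "edges H \<subseteq> Pow (verts H)" "finite (verts H)" using basic(1) by (auto simp: simple_graph_def)
    then show ?thesis by (meson finite_Pow_iff finite_subset)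
  qed
  have finF: "finite F" "finite F'" using finE split(1) by auto
  have off: "{e \<in> edges H. v \<notin> e} = F \<union> F'" using split(1,5,6) by auto
  have "F \<inter> F' = {}"
  proof (rule ccontr)
    assume "F \<inter> F' \<noteq> {}"
    then obtain e where e: "e \<in> F" "e \<in> F'" by blast
    then have "e = {}" using split(7) by blast
    then show False using two[of e] e split(1) by simp
  qed
  then have cards: "card F + card F' \<le> 3" using v(2) finF unfolding off by (simp add: card_Un_disjoint)
  have "card F' \<noteq> 0" using split(8) finF by simp
  then have cF: "card F \<le> 2" using cards by linarith
  define E where "E = (\<lambda>x. {v, x}) ` A \<union> F"
  have EH: "edges H = E \<union> F'" using split(1) by (simp add: E_def)
  have "\<Union>E \<subseteq> insert v A \<union> \<Union>F" by (auto simp: E_def)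
  then have disj: "\<Union>E \<inter> \<Union>F' = {}" using split(7) by blast
  note L = listed_cases[OF disj]
  note X = excluded_cases[OF disj, of H]
  have sub: "E \<union> F' \<subseteq> edges H" using EH by simp
  have two': "card e = 2" if "e \<in> F'" for e using two that split(1) by blast
  have c3: "card F' \<le> 3" using cards by linarith
  have F': "card F' = 1 \<and> shape 2 K2_l F' \<or> card F' = 2 \<and> shape 4 twoK2_l F' \<or>
      card F' = 2 \<and> shape 3 P3_l F' \<or> card F' = 3 \<and> shape 6 threeK2_l F' \<or>
      card F' = 3 \<and> shape 5 P3_K2_l F' \<or> card F' = 3 \<and> shape 4 P4_l F' \<or>
      card F' = 3 \<and> shape 4 K13_l F' \<or> card F' = 3 \<and> shape 3 K3_l F'"
    by (rule at_most_three_edges_shape[OF split(8) two' finF(2) c3]) simp_all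
  have "listed (E \<union> F')"
  proof (rule component_shape[OF no(1-6) split(2-4), of F E])
    show "card e = 2" if "e \<in> F" for e using two that split(1) by blast
    show "v \<notin> \<Union>F" by (rule split(5))
    show "finite F" by (rule finF(1))
    show "card F \<le> 2" by (rule cF)
    show "\<exists>e\<in>F - S. e \<inter> (A \<union> \<Union>S) \<noteq> {}" if "S \<subset> F" for S by (rule grow[rule_format, OF that])
    show "E = (\<lambda>x. {v, x}) ` A \<union> F" by (rule E_def)
    show "E \<subseteq> edges H" using EH by blast
  next
    assume c: "card F = 0" "shape 2 K2_l E \<or> shape 3 P3_l E \<or> shape 4 K13_l E"
    show ?thesis
      using c(2) F'
      by (elim disjE conjE) (((rule L; assumption) | (rule notE[OF no(7)], rule X; (assumption | rule sub)) |
          (rule notE[OF no(8)], rule X; (assumption | rule sub)))+)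
  next
    assume c: "card F = 1" "shape 3 P3_l E \<or> shape 3 K3_l E \<or> shape 4 P4_l E \<or> shape 5 P4plus_l E"
    have "card F' \<noteq> 3" using c(1) cards by simp
    then show ?thesis
      using c(2) F'
      by (elim disjE conjE) (((rule L; assumption) | (rule notE[OF no(7)], rule X; (assumption | rule sub)) |
          (rule notE[OF no(8)], rule X; (assumption | rule sub)) | (erule notE, assumption))+)
  next
    assume c: "card F = 2" "shape 4 K13_l E \<or> shape 4 P4_l E \<or> shape 5 P5_l E \<or> shape 5 P4plus_l E"
    have "card F' \<noteq> 3" "card F' \<noteq> 2" using c(1) cards by simp_all
    then show ?thesis
      using c(2) F'
      by (elim disjE conjE) (((rule L; assumption) | (erule notE, assumption))+)
  qed
  then show ?thesis using EH by simp
qed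

lemma simple_concrete:
  "simple_graph (path_graph 3 \<uplus>\<^sub>G path_graph 4)"
  "simple_graph (complete_graph 2 \<uplus>\<^sub>G path_graph 5)"
  "simple_graph (complete_graph 2 \<uplus>\<^sub>G graph_copies 2 (path_graph 3))"
  "simple_graph (graph_copies 2 (complete_graph 2) \<uplus>\<^sub>G complete_graph 3)"
  "simple_graph (graph_copies 2 (complete_graph 2) \<uplus>\<^sub>G P4_plus)"
  "simple_graph (graph_copies 3 (complete_graph 2) \<uplus>\<^sub>G star_graph 3)"
  by (simp_all add: simple_graph_def concrete_graph_simps Plus_def image_Un ball_Un Sigma_def)

theorem theorem1p6:
  fixes H :: "'a graph"
  shows "H \<in> ASMS_graphs \<longleftrightarrow>
    simple_graph H \<and> \<not> connected_graph H \<and> graph_order H \<ge> 3 \<and> no_isolated_vertices H \<and>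
    (isomorphic_to_subgraph H (path_graph 3 \<uplus>\<^sub>G path_graph 4) \<or>
     isomorphic_to_subgraph H (complete_graph 2 \<uplus>\<^sub>G path_graph 5) \<or>
     isomorphic_to_subgraph H (complete_graph 2 \<uplus>\<^sub>G graph_copies 2 (path_graph 3)) \<or>
     isomorphic_to_subgraph H (graph_copies 2 (complete_graph 2) \<uplus>\<^sub>G complete_graph 3) \<or>
     isomorphic_to_subgraph H (graph_copies 2 (complete_graph 2) \<uplus>\<^sub>G P4_plus) \<or>
     isomorphic_to_subgraph H (graph_copies 3 (complete_graph 2) \<uplus>\<^sub>G star_graph 3))"
  (is "_ \<longleftrightarrow> _ \<and> _ \<and> _ \<and> _ \<and> ?iso")
proof (cases "simple_graph H")
  case False
  then show ?thesis by (simp add: ASMS_graphs_def)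
next
  case simple: True
  note emb = embedding_into_isomorphic[OF simple simple_concrete(1) iso_P3_P4]
    embedding_into_isomorphic[OF simple simple_concrete(2) iso_K2_P5]
    embedding_into_isomorphic[OF simple simple_concrete(3) iso_K2_2P3]
    embedding_into_isomorphic[OF simple simple_concrete(4) iso_twoK2_K3]
    embedding_into_isomorphic[OF simple simple_concrete(5) iso_twoK2_P4plus]
    embedding_into_isomorphic[OF simple simple_concrete(6) iso_threeK2_K13]
  have iso: "?iso \<longleftrightarrow> (\<exists>(r, L)\<in>maximal_lists. isomorphic_to_subgraph H (list_graph r L))"
    unfolding emb maximal_lists_def by simp
  show ?thesis
  proof
    assume H: "H \<in> ASMS_graphs"
    then have basic: "\<not> connected_graph H" "graph_order H \<ge> 3" "no_isolated_vertices H"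
      by (auto simp: ASMS_graphs_def)
    obtain r L where rL: "(r, L) \<in> maximal_lists" "fits (edges H) r L"
      using ASMS_graphs_listed[OF H] unfolding listed_def by blast
    have "isomorphic_to_subgraph H (list_graph r L)"
      by (rule fits_imp_isomorphic_to_subgraph[OF simple basic(3) rL(2)])
    then have ?iso unfolding iso using rL(1) by blast
    then show "simple_graph H \<and> \<not> connected_graph H \<and> graph_order H \<ge> 3 \<and> no_isolated_vertices H \<and> ?iso"
      using simple basic by (intro conjI)
  next
    assume rhs: "simple_graph H \<and> \<not> connected_graph H \<and> graph_order H \<ge> 3 \<and> no_isolated_vertices H \<and> ?iso"
    then have ?iso by (elim conjE)
    then obtain r L where "(r, L) \<in> maximal_lists" "isomorphic_to_subgraph H (list_graph r L)"
      unfolding iso by blast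
    then show "H \<in> ASMS_graphs" using rhs by (intro maximal_lists_sufficient[OF simple]) simp_all
  qed
qed

end
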